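(* For each $\epsilon>0$ sufficiently small, the system $$u_\xi=v,\qquad v_\xi=-\mu u+u^3,\qquad \mu_\xi=-\epsilon(1-\mu^2),\qquad \mu(0)=0,$$ has a heteroclinic orbit $(u^*,v^*,\mu^* )(\xi)$, going from $(u,v,\mu)=(1,0,1)$ (as $\xi\to-\infty$) to $(0,0,-1)$ (as $\xi\to+\infty$), which lies in the transverse intersection of the unstable manifold $W^{\mathrm u}(1,0,1)$ and the stable manifold $W^{\mathrm s}(0,0,-1)$. Furthermore, there exists a small $\rho>0$, independent of $\epsilon$, such that $$u^*(\xi)=u_{HM}(\xi)+\mathcal O(\epsilon^{2/3})\qquad\text{for all } |\xi|\le\rho\,\epsilon^{-1/3},$$ where $u_{HM}(\xi)=\sqrt2\,\epsilon^{1/3}w_{HM}(\epsilon^{1/3}\xi)$ and $w_{HM}$ is the Hastings–McLeod solution of the second Painlevé equation.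
   Context: The Hastings–McLeod solution $w_{HM}$ is the unique positive, monotone solution on $\mathbb R$ of the second Painlevé equation $w_{\eta\eta}=\eta w+2w^3$ satisfying $w_{HM}(\eta)\sim\mathrm{Ai}(\eta)$ as $\eta\to+\infty$ and $w_{HM}(\eta)\sim\sqrt{-\eta/2}$ as $\eta\to-\infty$; it satisfies $w_{HM}'(\eta)<0$ for all $\eta$. Here $\mathrm{Ai}$ is the Airy function. The normalization $\mu(0)=0$ means $\mu(\xi)=-\tanh(\epsilon\xi)$. The $\mathcal O(\epsilon^{2/3})$ term is as $\epsilon\to0^+$, uniform over $|\xi|\le\rho\epsilon^{-1/3}$. *)

theory Defs
  imports "HOL-Analysis.Analysis" "HOL-Library.Landau_Symbols"
begin

text \<open>The integral below is only conditionally convergent; the Henstock--Kurzweil integral over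
  a half-line is the limit of the integrals over bounded intervals, i.e. the improper Riemann
  integral in the classical formula for the Airy function.\<close>

definition airy_Ai :: "real \<Rightarrow> real" where
  "airy_Ai x = integral {0..} (\<lambda>t. cos (t ^ 3 / 3 + x * t)) / pi"

definition hastings_mcleod :: "(real \<Rightarrow> real) \<Rightarrow> bool" where
  "hastings_mcleod w \<longleftrightarrow>
     (\<exists>w'. \<forall>\<eta>. (w has_real_derivative w' \<eta>) (at \<eta>) \<and>
                (w' has_real_derivative (\<eta> * w \<eta> + 2 * w \<eta> ^ 3)) (at \<eta>)) \<and>
     (\<forall>\<eta>. 0 < w \<eta>) \<and> antimono w \<and>
     w \<sim>[at_top] airy_Ai \<and>
     w \<sim>[at_bot] (\<lambda>\<eta>. sqrt (- \<eta> / 2))"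

definition solves_on :: "('a::real_normed_vector \<Rightarrow> 'a) \<Rightarrow> (real \<Rightarrow> 'a) \<Rightarrow> real set \<Rightarrow> bool" where
  "solves_on f x I \<longleftrightarrow> (\<forall>t\<in>I. (x has_vector_derivative f (x t)) (at t within I))"

definition heteroclinic_orbit ::
  "('a::real_normed_vector \<Rightarrow> 'a) \<Rightarrow> 'a \<Rightarrow> 'a \<Rightarrow> (real \<Rightarrow> 'a) \<Rightarrow> bool" where
  "heteroclinic_orbit f p q x \<longleftrightarrow>
     solves_on f x UNIV \<and> (x \<longlongrightarrow> p) at_bot \<and> (x \<longlongrightarrow> q) at_top"

definition unstable_manifold :: "('a::real_normed_vector \<Rightarrow> 'a) \<Rightarrow> 'a \<Rightarrow> 'a set" where
  "unstable_manifold f q = {p. \<exists>x. solves_on f x {..0} \<and> x 0 = p \<and> (x \<longlongrightarrow> q) at_bot}"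

definition stable_manifold :: "('a::real_normed_vector \<Rightarrow> 'a) \<Rightarrow> 'a \<Rightarrow> 'a set" where
  "stable_manifold f q = {p. \<exists>x. solves_on f x {0..} \<and> x 0 = p \<and> (x \<longlongrightarrow> q) at_top}"

text \<open>The global invariant manifolds of a hyperbolic equilibrium are in general only injectively
  immersed, so they may accumulate on themselves, and a curve that is smooth in the ambient space
  and contained in the manifold need not be smooth in the manifold's own topology. The tangent
  space at \<open>p\<close> therefore consists of the velocities at \<open>p\<close> of those \<open>C\<^sup>1\<close> curves along
  which the convergence to the equilibrium is uniform: equivalently, of the curves that are carried
  by the flow, after some finite time, into the local (embedded) manifold of the equilibrium.\<close>

definition tangent_unstable :: "('a::real_normed_vector \<Rightarrow> 'a) \<Rightarrow> 'a \<Rightarrow> 'a \<Rightarrow> 'a set" where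
  "tangent_unstable f q p = {d. \<exists>\<delta>>0. \<exists>\<gamma> X.
     \<gamma> C1_differentiable_on {-\<delta><..<\<delta>} \<and> \<gamma> 0 = p \<and> (\<gamma> has_vector_derivative d) (at 0) \<and>
     (\<forall>s\<in>{-\<delta><..<\<delta>}. solves_on f (X s) {..0} \<and> X s 0 = \<gamma> s) \<and>
     uniform_limit {-\<delta><..<\<delta>} (\<lambda>t s. X s t) (\<lambda>s. q) at_bot}"

definition tangent_stable :: "('a::real_normed_vector \<Rightarrow> 'a) \<Rightarrow> 'a \<Rightarrow> 'a \<Rightarrow> 'a set" where
  "tangent_stable f q p = {d. \<exists>\<delta>>0. \<exists>\<gamma> X.
     \<gamma> C1_differentiable_on {-\<delta><..<\<delta>} \<and> \<gamma> 0 = p \<and> (\<gamma> has_vector_derivative d) (at 0) \<and>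
     (\<forall>s\<in>{-\<delta><..<\<delta>}. solves_on f (X s) {0..} \<and> X s 0 = \<gamma> s) \<and>
     uniform_limit {-\<delta><..<\<delta>} (\<lambda>t s. X s t) (\<lambda>s. q) at_top}"

definition transverse_intersection ::
  "('a::real_normed_vector \<Rightarrow> 'a) \<Rightarrow> 'a \<Rightarrow> 'a \<Rightarrow> 'a set" where
  "transverse_intersection f q\<^sub>u q\<^sub>s =
     {p \<in> unstable_manifold f q\<^sub>u \<inter> stable_manifold f q\<^sub>s.
        {a + b | a b. a \<in> tangent_unstable f q\<^sub>u p \<and> b \<in> tangent_stable f q\<^sub>s p} = UNIV}"

definition slow_field :: "real \<Rightarrow> real \<times> real \<times> real \<Rightarrow> real \<times> real \<times> real" where
  "slow_field \<epsilon> = (\<lambda>(u, v, \<mu>). (v, - \<mu> * u + u ^ 3, - \<epsilon> * (1 - \<mu>\<^sup>2)))"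

definition u_HM :: "(real \<Rightarrow> real) \<Rightarrow> real \<Rightarrow> real \<Rightarrow> real" where
  "u_HM w \<epsilon> \<xi> = sqrt 2 * \<epsilon> powr (1/3) * w (\<epsilon> powr (1/3) * \<xi>)"

end

theory Submission
  imports Defs
begin

text \<open>
  Eliminating \<open>\<mu> = - tanh (\<epsilon> \<xi>)\<close> leaves the scalar equation \<open>u'' = tanh (\<epsilon> \<xi>) u + u\<^sup>3\<close>. A monotone
  iteration started at the supersolution \<open>1\<close> yields a positive nonincreasing front from \<open>1\<close> to \<open>0\<close>.
  In the variables \<open>u(\<xi>) = \<surd>2 h W(h \<xi>)\<close>, \<open>h = \<epsilon>\<^bsup>1/3\<^esup>\<close>, \<open>\<delta> = h\<^sup>2\<close>, the equation reads
  \<open>W'' = a W + 2 W\<^sup>3\<close> with \<open>a(x) = tanh (\<delta> x) / \<delta>\<close>, a perturbation of the Painleve equation \<open>a(x) = x\<close>.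

  Everything rests on the bound \<open>a + 6 W\<^sup>2 \<ge> 1/20\<close>, valid for both potentials, which is proved by
  comparing \<open>W\<close> with an explicit subsolution. It makes the linearization at the front a positive
  operator. Consequently the maximum principle controls the difference \<open>W - w\<^sub>H\<^sub>M\<close>: on
  \<open>[-M, M]\<close> with \<open>M = \<delta>\<^bsup>-1/4\<^esup>\<close> the forcing is \<open>O(\<delta>)\<close> and crude boundary values are damped
  exponentially. Likewise the bounded responses of the linearized equation to forcings placed to the
  right and to the left of a point \<open>\<xi>\<^sub>0\<close> are negative, with slopes of opposite sign at \<open>\<xi>\<^sub>0\<close>; they are
  tangent to the unstable and to the stable manifold in the slice of constant \<open>\<mu>\<close>, and together with
  the flow direction they span the whole space.
\<close>

section \<open>Maximum principles on the line\<close>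

text \<open>The potential \<open>a\<close> is negative on the left, so positivity of
  \<open>a + 6 * W\<^sup>2\<close> depends on the size of \<open>W\<close> around the turning point,
  where both terms are of order one and asymptotic expansions at infinity say nothing. This is why
  explicit rational constants appear. The margin has to be independent of \<open>\<delta>\<close>,
  because it sets the damping rate on an interval that grows as \<open>\<delta>\<close> shrinks.

  The tangent vectors of the invariant manifolds are not taken from a stable manifold theorem.
  Prescribing decay at one end is an awkward condition on initial data; instead a small forcing is
  placed on the other side of the base point and the bounded solution on the whole line is taken.
  Where the forcing vanishes this is a genuine orbit, and boundedness together with the positive
  potential forces its return to the front. Existence, uniform decay and differentiable dependence
  on the size of the forcing then all come from one a priori bound.\<close>

lemma second_derivative_nonpos_at_max:
  fixes f f' :: "real \<Rightarrow> real"
  assumes "open S" "x \<in> S"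
    and f: "\<And>y. y \<in> S \<Longrightarrow> (f has_real_derivative f' y) (at y)"
    and f': "(f' has_real_derivative l) (at x)"
    and max: "\<And>y. y \<in> S \<Longrightarrow> f y \<le> f x"
  shows "l \<le> 0"
proof (rule ccontr)
  assume "\<not> l \<le> 0"
  then have "l > 0" by simp
  obtain d where d: "d > 0" "ball x d \<subseteq> S"
    using assms(1,2) open_contains_ball by blast
  have inS: "y \<in> S" if "\<bar>x - y\<bar> < d" for y
    using that d(2) by (auto simp: dist_real_def)
  have "f' x = 0"
    using DERIV_local_max[OF f[OF assms(2)] d(1)] max inS by blast
  obtain e where e: "e > 0" "\<And>h. 0 < h \<Longrightarrow> h < e \<Longrightarrow> f' x < f' (x + h)"
    using DERIV_pos_inc_right[OF f' \<open>l > 0\<close>] by blast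
  define h where "h = min d e / 2"
  have h: "0 < h" "h < d" "h < e" using d e by (auto simp: h_def)
  obtain z where z: "x < z" "z < x + h" "f (x + h) - f x = (x + h - x) * f' z"
    using MVT2[of x "x + h" f f'] f inS h by auto
  have "f' z > 0" using e(2)[of "z - x"] z h \<open>f' x = 0\<close> by auto
  then have "f (x + h) > f x" using z(3) h by (simp add: algebra_simps)
  then show False using max[of "x + h"] inS[of "x + h"] h by auto
qed

text \<open>Subtracting a small multiple of a function \<open>c\<close> with
  \<open>c'' = m * c\<close> that grows at both ends makes a positive supremum attained even on
  unbounded \<open>T\<close>; there the second derivative test contradicts
  \<open>m * f \<le> f''\<close>. Requiring points with \<open>f > 0\<close> to be interior encodes
  the boundary condition \<open>f \<le> 0\<close>.\<close>

lemma maximum_principle: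
  fixes f f' f'' :: "real \<Rightarrow> real"
  assumes "closed T" "continuous_on T f" "0 < m"
    and bd: "\<And>x. x \<in> T \<Longrightarrow> f x \<le> B"
    and pos: "\<And>x. x \<in> T \<Longrightarrow> 0 < f x \<Longrightarrow> x \<in> interior T \<and> m * f x \<le> f'' x"
    and f: "\<And>x. x \<in> interior T \<Longrightarrow> (f has_real_derivative f' x) (at x)"
    and f': "\<And>x. x \<in> interior T \<Longrightarrow> (f' has_real_derivative f'' x) (at x)"
    and "x \<in> T"
  shows "f x \<le> 0"
proof (rule ccontr)
  assume "\<not> f x \<le> 0"
  then have fx: "f x > 0" by simp
  define k where "k = sqrt m"
  have k: "k > 0" "k * k = m" using \<open>0 < m\<close> by (auto simp: k_def)
  define c where "c y = exp (k * y) + exp (- (k * y))" for y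
  have cpos: "c y > 0" for y by (simp add: c_def add_pos_pos)
  have cge: "c y \<ge> k * \<bar>y\<bar>" for y
  proof -
    have "1 + k * y \<le> exp (k * y)" "1 - k * y \<le> exp (- (k * y))"
      using exp_ge_add_one_self[of "k * y"] exp_ge_add_one_self[of "- (k * y)"] by auto
    moreover have "exp (k * y) > 0" "exp (- (k * y)) > 0" by auto
    moreover have "k * \<bar>y\<bar> = k * y \<or> k * \<bar>y\<bar> = - (k * y)" by (auto simp: abs_if)
    ultimately show ?thesis unfolding c_def by linarith
  qed
  \<comment> \<open>This choice leaves \<open>g x = f x / 2\<close>, still positive.\<close>
  define l where "l = f x / (2 * c x)"
  have l: "l > 0" using fx cpos[of x] by (simp add: l_def)
  define g where "g y = f y - l * c y" for y
  have gx: "g x > 0" using fx cpos[of x] by (simp add: g_def l_def)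
  \<comment> \<open>Beyond \<open>R\<close> the linear growth of \<open>l * c\<close> exceeds
    \<open>B\<close>; the first entry of the maximum keeps \<open>x\<close> inside the compact
    set.\<close>
  define R where "R = max \<bar>x\<bar> (\<bar>B\<bar> / (l * k))"
  have outside: "g y \<le> 0" if "y \<in> T" "\<bar>y\<bar> > R" for y
  proof -
    have "\<bar>B\<bar> / (l * k) \<le> \<bar>y\<bar>" using that by (auto simp: R_def)
    then have "\<bar>B\<bar> \<le> l * (k * \<bar>y\<bar>)" using l k by (simp add: field_simps)
    also have "\<dots> \<le> l * c y" using cge l by (simp add: mult_left_mono)
    finally show ?thesis using bd[OF that(1)] by (simp add: g_def)
  qed
  have "compact (T \<inter> {-R..R})" using \<open>closed T\<close> by (simp add: closed_Int_compact)
  moreover have xin: "x \<in> T \<inter> {-R..R}" using \<open>x \<in> T\<close> by (auto simp: R_def)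
  moreover have "continuous_on (T \<inter> {-R..R}) g"
    unfolding g_def c_def
    by (intro continuous_intros continuous_on_subset[OF assms(2)]) auto
  ultimately obtain y where y: "y \<in> T \<inter> {-R..R}" "\<And>z. z \<in> T \<inter> {-R..R} \<Longrightarrow> g z \<le> g y"
    using continuous_attains_sup[of "T \<inter> {-R..R}" g] by blast
  have gy: "g y > 0" using y(2)[OF xin] gx by simp
  have gmax: "g z \<le> g y" if "z \<in> T" for z
  proof (cases "\<bar>z\<bar> \<le> R")
    case True
    then show ?thesis using y(2)[of z] that by (auto simp: abs_le_iff)
  next
    case False
    then show ?thesis using outside[of z] that gy by auto
  qed
  have fy: "f y > l * c y" using gy by (simp add: g_def)
  then have "f y > 0" using l cpos[of y] by (smt (verit) mult_pos_pos)
  then have yi: "y \<in> interior T" "m * f y \<le> f'' y" using pos y(1) by auto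
  have "f'' y - l * (m * c y) \<le> 0"
  proof (rule second_derivative_nonpos_at_max[of "interior T" y g "\<lambda>z. f' z - l * (k * exp (k * z) - k * exp (- (k * z)))"])
    show "(g has_real_derivative f' z - l * (k * exp (k * z) - k * exp (- (k * z)))) (at z)"
      if "z \<in> interior T" for z
      unfolding g_def c_def by (auto intro!: derivative_eq_intros f[OF that])
    show "((\<lambda>z. f' z - l * (k * exp (k * z) - k * exp (- (k * z)))) has_real_derivative
        f'' y - l * (m * c y)) (at y)"
      unfolding c_def
      by (auto intro!: derivative_eq_intros f'[OF yi(1)] simp: k(2)[symmetric] algebra_simps)
    show "g z \<le> g y" if "z \<in> interior T" for z
      using gmax that interior_subset by blast
  qed (use yi in auto)
  then have "m * f y \<le> m * (l * c y)" using yi(2) by (simp add: algebra_simps)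
  then show False using fy \<open>0 < m\<close> by simp
qed

text \<open>Some slope on the unit interval is at most \<open>2 * A\<close>, and the slope at the
  left end differs from it by at most \<open>B\<close>.\<close>

lemma deriv_bound_of_bounds:
  fixes f f' f'' :: "real \<Rightarrow> real"
  assumes f: "\<And>y. x \<le> y \<Longrightarrow> y \<le> x + 1 \<Longrightarrow> (f has_real_derivative f' y) (at y)"
    and f': "\<And>y. x \<le> y \<Longrightarrow> y \<le> x + 1 \<Longrightarrow> (f' has_real_derivative f'' y) (at y)"
    and A: "\<And>y. x \<le> y \<Longrightarrow> y \<le> x + 1 \<Longrightarrow> \<bar>f y\<bar> \<le> A"
    and B: "\<And>y. x \<le> y \<Longrightarrow> y \<le> x + 1 \<Longrightarrow> \<bar>f'' y\<bar> \<le> B"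
  shows "\<bar>f' x\<bar> \<le> 2 * A + B"
proof -
  obtain z where z: "x < z" "z < x + 1" "f (x + 1) - f x = (x + 1 - x) * f' z"
    using MVT2[of x "x + 1" f f'] f by auto
  obtain w where w: "x < w" "w < z" "f' z - f' x = (z - x) * f'' w"
    using MVT2[of x z f' f''] f' z by auto
  have 1: "\<bar>f' z\<bar> \<le> 2 * A" using z(3) A[of x] A[of "x + 1"] by auto
  have "\<bar>f' z - f' x\<bar> = (z - x) * \<bar>f'' w\<bar>" using w z by (simp add: abs_mult)
  also have "\<dots> \<le> 1 * B" using z w B[of w] by (intro mult_mono) auto
  finally show ?thesis using 1 by linarith
qed

section \<open>The resolvent of the second derivative\<close>

text \<open>Normalised to be the solution of \<open>E' = K * E - f\<close> that stays bounded for
  bounded \<open>f\<close>.\<close>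

definition exp_tail :: "real \<Rightarrow> (real \<Rightarrow> real) \<Rightarrow> real \<Rightarrow> real" where
  "exp_tail K f x = exp (K * x) * integral {x..} (\<lambda>y. exp (- (K * y)) * f y)"

text \<open>Convolution with \<open>exp (- K * \<bar>x\<bar>) / (2 * K)\<close>, the Green function
  of \<open>K\<^sup>2 - \<partial>\<^sup>2\<close>. The left half of the integral is written as a
  reflected right tail, so that only \<open>exp_tail\<close> has to be analysed.\<close>

definition resolvent :: "real \<Rightarrow> (real \<Rightarrow> real) \<Rightarrow> real \<Rightarrow> real" where
  "resolvent K f x = (exp_tail K f x + exp_tail K (\<lambda>y. f (- y)) (- x)) / (2 * K)"

definition resolvent_deriv :: "real \<Rightarrow> (real \<Rightarrow> real) \<Rightarrow> real \<Rightarrow> real" where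
  "resolvent_deriv K f x = (exp_tail K f x - exp_tail K (\<lambda>y. f (- y)) (- x)) / 2"

lemma exp_dominator_integrable:
  assumes "K > (0::real)"
  shows "(\<lambda>y. M * exp (- K * y)) integrable_on {x..}"
  using has_integral_mult_right[OF has_integral_exp_minus_to_infinity[OF assms, of x], of M]
  unfolding integrable_on_def by blast

lemma exp_tail_integrable:
  fixes K :: real
  assumes "K > 0" "continuous_on UNIV f" "\<And>y. \<bar>f y\<bar> \<le> M"
  shows "(\<lambda>y. exp (- (K * y)) * f y) integrable_on {x..}"
proof (rule measurable_bounded_by_integrable_imp_integrable[where g = "\<lambda>y::real. M * exp (- K * y)"])
  show "(\<lambda>y. exp (- (K * y)) * f y) \<in> borel_measurable (lebesgue_on {x..})"
    by (intro continuous_imp_measurable_on_sets_lebesgue continuous_intros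
        continuous_on_subset[OF assms(2)]) auto
  show "(\<lambda>y. M * exp (- K * y)) integrable_on {x..}"
    using assms(1) by (rule exp_dominator_integrable)
  show "norm (exp (- (K * y)) * f y) \<le> M * exp (- K * y)" for y
    using assms(3)[of y] by (simp add: abs_mult mult.commute mult_left_mono)
qed auto

lemma exp_tail_bound:
  assumes "K > 0" "continuous_on UNIV f" "\<And>y. \<bar>f y\<bar> \<le> M"
  shows "\<bar>exp_tail K f x\<bar> \<le> M / K"
proof -
  have "norm (integral {x..} (\<lambda>y. exp (- (K * y)) * f y)) \<le> integral {x..} (\<lambda>y. M * exp (- K * y))"
  proof (rule integral_norm_bound_integral)
    show "(\<lambda>y. M * exp (- K * y)) integrable_on {x..}"
      using assms(1) by (rule exp_dominator_integrable)
    show "norm (exp (- (K * y)) * f y) \<le> M * exp (- K * y)" for y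
      using assms(3)[of y] by (simp add: abs_mult mult.commute mult_left_mono)
  qed (rule exp_tail_integrable[OF assms])
  also have "\<dots> = M * (exp (- K * x) / K)"
    using has_integral_mult_right[OF has_integral_exp_minus_to_infinity[OF assms(1), of x], of M]
    by (rule integral_unique)
  finally have "\<bar>exp_tail K f x\<bar> \<le> exp (K * x) * (M * (exp (- K * x) / K))"
    unfolding exp_tail_def by (simp only: abs_mult abs_exp_cancel real_norm_def mult_left_mono exp_ge_zero)
  also have "\<dots> = M / K" by (simp add: exp_minus field_simps)
  finally show ?thesis .
qed

lemma exp_tail_deriv:
  assumes "K > 0" "continuous_on UNIV f" "\<And>y. \<bar>f y\<bar> \<le> M"
  shows "(exp_tail K f has_real_derivative (K * exp_tail K f x - f x)) (at x)"
proof -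
  define g where "g y = exp (- (K * y)) * f y" for y
  have gint: "g integrable_on {y..}" for y
    unfolding g_def using exp_tail_integrable[OF assms] .
  have gcont: "continuous_on S g" for S
    unfolding g_def by (intro continuous_intros continuous_on_subset[OF assms(2)]) auto
  \<comment> \<open>Cutting at the fixed point \<open>x - 1\<close> moves the dependence on
    \<open>y\<close> into a finite integral, where the fundamental theorem of calculus
    applies.\<close>
  have split: "integral {y..} g = integral {x - 1..} g - integral {x - 1..y} g" if "y \<ge> x - 1" for y
  proof -
    have "(g has_integral (integral {x - 1..y} g + integral {y..} g)) ({x - 1..y} \<union> {y..})"
    proof (rule has_integral_Un)
      show "(g has_integral integral {x - 1..y} g) {x - 1..y}"
        by (intro integrable_integral integrable_continuous_real gcont)
      show "(g has_integral integral {y..} g) {y..}" using gint by (rule integrable_integral)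
      have "{x - 1..y} \<inter> {y..} \<subseteq> {y}" by auto
      then show "negligible ({x - 1..y} \<inter> {y..})" by (rule negligible_subset[OF negligible_sing])
    qed
    moreover have "{x - 1..y} \<union> {y..} = {x - 1..}" using that by auto
    ultimately show ?thesis by (simp add: integral_unique)
  qed
  have "((\<lambda>y. integral {x - 1..y} g) has_real_derivative g x) (at x within {x - 1..x + 1})"
    by (rule integral_has_real_derivative[OF gcont]) auto
  then have "((\<lambda>y. integral {x - 1..y} g) has_real_derivative g x) (at x)"
    by (subst (asm) at_within_interior) auto
  then have "((\<lambda>y. exp (K * y) * (integral {x - 1..} g - integral {x - 1..y} g)) has_real_derivative
      K * (exp (K * x) * (integral {x - 1..} g - integral {x - 1..x} g)) - f x) (at x)"
    by (auto intro!: derivative_eq_intros simp: g_def exp_minus field_simps)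
  moreover have "K * (exp (K * x) * (integral {x - 1..} g - integral {x - 1..x} g)) - f x = K * exp_tail K f x - f x"
    by (subst split[of x, symmetric]) (auto simp: exp_tail_def g_def[abs_def])
  ultimately have *: "((\<lambda>y. exp (K * y) * (integral {x - 1..} g - integral {x - 1..y} g)) has_real_derivative
      K * exp_tail K f x - f x) (at x)"
    by simp
  show ?thesis
  proof (rule has_field_derivative_transform_within_open[OF *, of "{x - 1<..}"])
    fix y assume "y \<in> {x - 1<..}"
    then show "exp (K * y) * (integral {x - 1..} g - integral {x - 1..y} g) = exp_tail K f y"
      by (subst split[of y, symmetric]) (auto simp: exp_tail_def g_def[abs_def])
  qed auto
qed

lemma exp_tail_tendsto:
  assumes "K > 0" "\<And>n. continuous_on UNIV (f n)" "\<And>n y. \<bar>f n y\<bar> \<le> M"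
    and "\<And>y. (\<lambda>n. f n y) \<longlonglongrightarrow> g y"
  shows "(\<lambda>n. exp_tail K (f n) x) \<longlonglongrightarrow> exp_tail K g x"
  unfolding exp_tail_def
proof (rule tendsto_mult[OF tendsto_const], rule dominated_convergence(2)[where h = "\<lambda>y::real. M * exp (- K * y)"])
  show "(\<lambda>y. exp (- (K * y)) * f n y) integrable_on {x..}" for n
    by (rule exp_tail_integrable[OF assms(1,2,3)])
  show "(\<lambda>y. M * exp (- K * y)) integrable_on {x..}"
    using assms(1) by (rule exp_dominator_integrable)
  show "norm (exp (- (K * y)) * f n y) \<le> M * exp (- K * y)" for n y
    using assms(3)[of n y] by (simp add: abs_mult mult.commute mult_left_mono)
  show "(\<lambda>n. exp (- (K * y)) * f n y) \<longlonglongrightarrow> exp (- (K * y)) * g y" for y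
    by (intro tendsto_intros assms)
qed

context
  fixes K M :: real and f :: "real \<Rightarrow> real"
  assumes K: "K > 0" and cont: "continuous_on UNIV f" and bd: "\<And>y. \<bar>f y\<bar> \<le> M"
begin

private lemma reflect_cont: "continuous_on UNIV (\<lambda>y. f (- y))"
  by (intro continuous_intros continuous_on_compose2[OF cont]) auto

private lemma exp_tail_reflect_deriv:
  "((\<lambda>x. exp_tail K (\<lambda>y. f (- y)) (- x)) has_real_derivative
     f x - K * exp_tail K (\<lambda>y. f (- y)) (- x)) (at x)"
proof -
  have "(exp_tail K (\<lambda>y. f (- y)) has_real_derivative K * exp_tail K (\<lambda>y. f (- y)) (- x) - f (- (- x))) (at (- x))"
    by (rule exp_tail_deriv[OF K reflect_cont]) (use bd in blast)
  from DERIV_chain2[where f = "exp_tail K (\<lambda>y. f (- y))" and g = uminus and Db = "-1" and s = UNIV, OF this]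
  show ?thesis by (simp add: DERIV_minus[OF DERIV_ident])
qed

lemma resolvent_has_deriv: "(resolvent K f has_real_derivative resolvent_deriv K f x) (at x)"
  unfolding resolvent_def[abs_def] resolvent_deriv_def using K
  by (auto intro!: derivative_eq_intros exp_tail_deriv[OF K cont bd] exp_tail_reflect_deriv simp: field_simps)

lemma resolvent_deriv_has_deriv:
  "(resolvent_deriv K f has_real_derivative K\<^sup>2 * resolvent K f x - f x) (at x)"
  unfolding resolvent_def resolvent_deriv_def[abs_def] using K
  by (auto intro!: derivative_eq_intros exp_tail_deriv[OF K cont bd] exp_tail_reflect_deriv
      simp: field_simps power2_eq_square)

lemma resolvent_continuous: "continuous_on S (resolvent K f)"
  by (meson DERIV_continuous resolvent_has_deriv continuous_at_imp_continuous_on)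

lemma resolvent_bound: "\<bar>resolvent K f x\<bar> \<le> M / K\<^sup>2"
proof -
  have "\<bar>exp_tail K f x\<bar> \<le> M / K" by (rule exp_tail_bound[OF K cont bd])
  moreover have "\<bar>exp_tail K (\<lambda>y. f (- y)) (- x)\<bar> \<le> M / K"
    by (rule exp_tail_bound[OF K reflect_cont]) (use bd in blast)
  ultimately have "\<bar>exp_tail K f x + exp_tail K (\<lambda>y. f (- y)) (- x)\<bar> / (2 * K) \<le> (2 * (M / K)) / (2 * K)"
    using K by (intro divide_right_mono) auto
  then show ?thesis using K by (simp add: resolvent_def power2_eq_square abs_mult)
qed

end

lemma resolvent_tendsto:
  assumes "K > 0" "\<And>n. continuous_on UNIV (f n)" "\<And>n y. \<bar>f n y\<bar> \<le> M"
    and "\<And>y. (\<lambda>n. f n y) \<longlonglongrightarrow> g y"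
  shows "(\<lambda>n. resolvent K (f n) x) \<longlonglongrightarrow> resolvent K g x"
  unfolding resolvent_def
proof (intro tendsto_intros exp_tail_tendsto[where M=M] assms)
  show "continuous_on UNIV (\<lambda>y. f n (- y))" for n
    by (intro continuous_intros continuous_on_compose2[OF assms(2)]) auto
qed (use assms in auto)

text \<open>The difference \<open>D\<close> of the two sides satisfies
  \<open>D'' \<ge> K\<^sup>2 * D\<close>, so the maximum principle applies. The shift gives two
  uses: \<open>c = 0\<close> compares iterates, other \<open>c\<close> transfer spatial monotonicity
  to the resolvent.\<close>

lemma resolvent_mono:
  assumes K: "K > 0" and f: "continuous_on UNIV f" "\<And>y. \<bar>f y\<bar> \<le> M"
    and g: "continuous_on UNIV g" "\<And>y. \<bar>g y\<bar> \<le> N"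
    and le: "\<And>y. f y \<le> g (y + c)"
  shows "resolvent K f x \<le> resolvent K g (x + c)"
proof -
  have d: "((\<lambda>x. resolvent K f x - resolvent K g (x + c)) has_real_derivative
      resolvent_deriv K f y - resolvent_deriv K g (y + c)) (at y)" for y
    by (auto intro!: derivative_eq_intros resolvent_has_deriv[OF K f] 
        DERIV_chain2[OF resolvent_has_deriv[OF K g]])
  have "resolvent K f x - resolvent K g (x + c) \<le> 0"
  proof (rule maximum_principle[of UNIV "\<lambda>x. resolvent K f x - resolvent K g (x + c)" "K\<^sup>2" "M / K\<^sup>2 + N / K\<^sup>2" "\<lambda>x. K\<^sup>2 * resolvent K f x - f x - (K\<^sup>2 * resolvent K g (x + c) - g (x + c))"
        "\<lambda>x. resolvent_deriv K f x - resolvent_deriv K g (x + c)"])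
    show "continuous_on UNIV (\<lambda>x. resolvent K f x - resolvent K g (x + c))"
      using d by (meson DERIV_continuous continuous_at_imp_continuous_on)
    show "resolvent K f x - resolvent K g (x + c) \<le> M / K\<^sup>2 + N / K\<^sup>2" for x
      using resolvent_bound[OF K f, of x] resolvent_bound[OF K g, of "x + c"] by auto
    show "x \<in> interior UNIV \<and> K\<^sup>2 * (resolvent K f x - resolvent K g (x + c))
        \<le> K\<^sup>2 * resolvent K f x - f x - (K\<^sup>2 * resolvent K g (x + c) - g (x + c))" for x
      using le[of x] by (simp add: algebra_simps)
    show "((\<lambda>x. resolvent_deriv K f x - resolvent_deriv K g (x + c)) has_real_derivative
       K\<^sup>2 * resolvent K f y - f y - (K\<^sup>2 * resolvent K g (y + c) - g (y + c))) (at y)" for y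
      by (auto intro!: derivative_eq_intros resolvent_deriv_has_deriv[OF K f]
        DERIV_chain2[OF resolvent_deriv_has_deriv[OF K g]])
  qed (use K d in auto)
  then show ?thesis by simp
qed

lemma resolvent_diff_bound:
  assumes K: "K > 0" and f: "continuous_on UNIV f" "\<And>y. \<bar>f y\<bar> \<le> M"
    and g: "continuous_on UNIV g" "\<And>y. \<bar>g y\<bar> \<le> N"
    and le: "\<And>y. \<bar>f y - g y\<bar> \<le> d"
  shows "\<bar>resolvent K f x - resolvent K g x\<bar> \<le> d / K\<^sup>2"
proof -
  have h: "continuous_on UNIV (\<lambda>y. f y - g y)" using f(1) g(1) by (intro continuous_intros)
  have 1: "exp_tail K (\<lambda>y. f y - g y) x = exp_tail K f x - exp_tail K g x"
    if "continuous_on UNIV f" "continuous_on UNIV g" "\<And>y. \<bar>f y\<bar> \<le> M" "\<And>y. \<bar>g y\<bar> \<le> N" for f g x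
    using integral_diff[OF exp_tail_integrable[OF K that(1,3)] exp_tail_integrable[OF K that(2,4)], of x]
    by (simp add: exp_tail_def right_diff_distrib)
  have r: "continuous_on UNIV (\<lambda>y. h (- y))" if "continuous_on UNIV h" for h :: "real \<Rightarrow> real"
    by (intro continuous_intros continuous_on_compose2[OF that]) auto
  have "resolvent K (\<lambda>y. f y - g y) x = resolvent K f x - resolvent K g x"
    using 1[OF f(1) g(1) f(2) g(2), of x] 1[OF r[OF f(1)] r[OF g(1)] f(2) g(2), of "-x"]
    by (simp add: resolvent_def diff_divide_distrib add_divide_distrib)
  then show ?thesis using resolvent_bound[OF K h le, of x] by simp
qed

text \<open>The unknown is the fixed point of \<open>z \<mapsto> (K\<^sup>2 - \<partial>\<^sup>2)\<^sup>-\<^sup>1 (K\<^sup>2 z - h(\<cdot>, z))\<close>, which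
  contracts with factor \<open>1 - m / K\<^sup>2\<close>.\<close>

lemma bounded_solution_exists:
  fixes h :: "real \<Rightarrow> real \<Rightarrow> real"
  assumes "K > 0" "m > 0"
    and cont: "continuous_on UNIV (\<lambda>(x, z). h x z)"
    and h0: "\<And>x. \<bar>h x 0\<bar> \<le> C"
    and mono: "\<And>x z z'. z' \<le> z \<Longrightarrow> m * (z - z') \<le> h x z - h x z' \<and> h x z - h x z' \<le> K\<^sup>2 * (z - z')"
  obtains z z' where "\<And>x. (z has_real_derivative z' x) (at x)"
    "\<And>x. (z' has_real_derivative h x (z x)) (at x)" "bounded (range z)"
proof -
  define N where "N z x = K\<^sup>2 * z x - h x (z x)" for z x
  have mK: "m \<le> K\<^sup>2" using mono[of 0 1 0] by simp
  have Nlip: "\<bar>(K\<^sup>2 * a - h x a) - (K\<^sup>2 * b - h x b)\<bar> \<le> (K\<^sup>2 - m) * \<bar>a - b\<bar>" for a b x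
    using mono[of b a x] mono[of a b x] by (cases "b \<le> a") (auto simp: algebra_simps)
  have Ncont: "continuous_on UNIV (N z)" if "continuous_on UNIV z" for z
  proof -
    have "continuous_on UNIV (\<lambda>x. (\<lambda>(x, z). h x z) (x, z x))"
      by (rule continuous_on_compose2[OF cont]) (auto intro!: continuous_intros that)
    then show ?thesis unfolding N_def by (auto intro!: continuous_intros that)
  qed
  have Nbd: "\<bar>N z x\<bar> \<le> C + (K\<^sup>2 - m) * B" if "\<And>x. \<bar>z x\<bar> \<le> B" for z B x
  proof -
    have "(K\<^sup>2 - m) * \<bar>z x\<bar> \<le> (K\<^sup>2 - m) * B" using mK that by (intro mult_left_mono) auto
    then show ?thesis using Nlip[of "z x" x 0] h0[of x] by (auto simp: N_def)
  qed
  \<comment> \<open>Working in the Banach space of bounded continuous functions builds boundedness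
    into the fixed point; \<open>ap\<close> checks that the resolvent stays in that space.\<close>
  define \<Phi> where "\<Phi> z = Bcontfun (resolvent K (N (apply_bcontfun z)))" for z :: "real \<Rightarrow>\<^sub>C real"
  have bz: "\<exists>B. \<forall>x. \<bar>apply_bcontfun z x\<bar> \<le> B" for z :: "real \<Rightarrow>\<^sub>C real"
    using bounded_apply_bcontfun[of z] by (auto simp: bounded_iff)
  have ap: "apply_bcontfun (\<Phi> z) = resolvent K (N (apply_bcontfun z))" for z
  proof -
    obtain B where B: "\<And>x. \<bar>apply_bcontfun z x\<bar> \<le> B" using bz by blast
    have c: "continuous_on UNIV (N (apply_bcontfun z))" by (rule Ncont) simp
    have "resolvent K (N (apply_bcontfun z)) \<in> bcontfun"
      unfolding bcontfun_def bounded_iff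
      using resolvent_continuous[OF \<open>K > 0\<close> c Nbd[OF B]] resolvent_bound[OF \<open>K > 0\<close> c Nbd[OF B]] by auto
    then show ?thesis unfolding \<Phi>_def by (rule Bcontfun_inverse)
  qed
  have lip: "dist (\<Phi> z) (\<Phi> w) \<le> ((K\<^sup>2 - m) / K\<^sup>2) * dist z w" for z w
  proof (rule dist_bound)
    fix x
    obtain B where B: "\<And>x. \<bar>apply_bcontfun z x\<bar> \<le> B" using bz by blast
    obtain D where D: "\<And>x. \<bar>apply_bcontfun w x\<bar> \<le> D" using bz by blast
    have c: "continuous_on UNIV (N (apply_bcontfun z))" for z by (rule Ncont) simp
    have "\<bar>N (apply_bcontfun z) y - N (apply_bcontfun w) y\<bar> \<le> (K\<^sup>2 - m) * dist z w" for y
    proof -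
      have "\<bar>N (apply_bcontfun z) y - N (apply_bcontfun w) y\<bar> \<le> (K\<^sup>2 - m) * dist (z y) (w y)"
        unfolding N_def dist_real_def by (rule Nlip)
      also have "\<dots> \<le> (K\<^sup>2 - m) * dist z w" using mK by (intro mult_left_mono dist_bounded) auto
      finally show ?thesis .
    qed
    from resolvent_diff_bound[OF \<open>K > 0\<close> c Nbd[OF B] c Nbd[OF D] this, of x]
    show "dist (\<Phi> z x) (\<Phi> w x) \<le> (K\<^sup>2 - m) / K\<^sup>2 * dist z w" by (simp add: ap dist_real_def)
  qed
  have "\<exists>!z. \<Phi> z = z"
    by (rule banach_fix_type[of "(K\<^sup>2 - m) / K\<^sup>2"]) (use mK lip assms(1,2) in auto)
  then obtain z where z: "\<Phi> z = z" by blast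
  obtain B where B: "\<And>x. \<bar>apply_bcontfun z x\<bar> \<le> B" using bz by blast
  have c: "continuous_on UNIV (N (apply_bcontfun z))" by (rule Ncont) simp
  have e: "apply_bcontfun z = resolvent K (N (apply_bcontfun z))" using ap[of z] z by simp
  show thesis
  proof (rule that[of "apply_bcontfun z" "resolvent_deriv K (N (apply_bcontfun z))"])
    show "(apply_bcontfun z has_real_derivative resolvent_deriv K (N (apply_bcontfun z)) x) (at x)" for x
      by (subst e) (rule resolvent_has_deriv[OF \<open>K > 0\<close> c Nbd[OF B]])
    have "K\<^sup>2 * resolvent K (N (apply_bcontfun z)) x - N (apply_bcontfun z) x = h x (z x)" for x
      by (subst e[symmetric]) (simp add: N_def)
    then show "(resolvent_deriv K (N (apply_bcontfun z)) has_real_derivative h x (z x)) (at x)" for x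
      using resolvent_deriv_has_deriv[OF \<open>K > 0\<close> c Nbd[OF B], of x] by simp
  qed simp
qed

section \<open>Existence of a monotone front\<close>

lemma filterlim_shifted:
  fixes z :: "real \<Rightarrow> real"
  assumes F: "F = at_top \<or> F = at_bot" and z: "\<And>x. x \<le> z x" "\<And>x. z x \<le> x + c"
  shows "filterlim z F F"
  using F
proof
  assume F: "F = at_top"
  show ?thesis unfolding F filterlim_at_top eventually_at_top_linorder
    using z(1) order_trans by blast
next
  assume F: "F = at_bot"
  have "z x \<le> Z" if "x \<le> Z - c" for x Z using z(2)[of x] that by linarith
  then show ?thesis unfolding F filterlim_at_bot eventually_at_bot_linorder by blast
qed

text \<open>The mean slopes over \<open>[x, x + 1]\<close> and \<open>[x + 2, x + 3]\<close> are
  attained at points at least one apart, so the mean value theorem for \<open>u'\<close> divides by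
  a number not below \<open>1\<close>.\<close>

lemma second_deriv_witness:
  fixes u u' u'' :: "real \<Rightarrow> real"
  assumes u: "\<And>x. (u has_real_derivative u' x) (at x)"
    and u': "\<And>x. (u' has_real_derivative u'' x) (at x)"
  obtains z where "x \<le> z" "z \<le> x + 3" "\<bar>u'' z\<bar> \<le> \<bar>(u (x + 3) - u (x + 2)) - (u (x + 1) - u x)\<bar>"
proof -
  obtain p where p: "x < p" "p < x + 1" "u (x + 1) - u x = (x + 1 - x) * u' p"
    using MVT2[of x "x + 1" u u'] u by auto
  obtain q where q: "x + 2 < q" "q < x + 3" "u (x + 3) - u (x + 2) = (x + 3 - (x + 2)) * u' q"
    using MVT2[of "x + 2" "x + 3" u u'] u by auto
  obtain z where z: "p < z" "z < q" "u' q - u' p = (q - p) * u'' z"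
    using MVT2[of p q u' u''] u' p q by auto
  have "1 * \<bar>u'' z\<bar> \<le> \<bar>q - p\<bar> * \<bar>u'' z\<bar>" using p q by (intro mult_right_mono) auto
  also have "\<dots> = \<bar>(u (x + 3) - u (x + 2)) - (u (x + 1) - u x)\<bar>" using p q z by (simp add: abs_mult)
  finally show thesis using that[of z] z p q by auto
qed

text \<open>Increments of a convergent \<open>u\<close> over fixed steps vanish, so
  \<open>u''\<close> is small along points escaping to the same end. This identifies the end states
  of the front as equilibria of the limiting equations.\<close>

lemma limit_of_second_deriv_zero:
  fixes u u' u'' :: "real \<Rightarrow> real"
  assumes u: "\<And>x. (u has_real_derivative u' x) (at x)"
    and u': "\<And>x. (u' has_real_derivative u'' x) (at x)"
    and F: "F = at_top \<or> F = at_bot"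
    and lim: "(u \<longlongrightarrow> L) F" and lim'': "(u'' \<longlongrightarrow> l) F"
  shows "l = 0"
proof -
  have "\<forall>x. \<exists>z. x \<le> z \<and> z \<le> x + 3 \<and> \<bar>u'' z\<bar> \<le> \<bar>(u (x + 3) - u (x + 2)) - (u (x + 1) - u x)\<bar>"
    using second_deriv_witness[OF u u'] by metis
  then obtain z where z: "\<And>x. x \<le> z x" "\<And>x. z x \<le> x + 3"
    "\<And>x. \<bar>u'' (z x)\<bar> \<le> \<bar>(u (x + 3) - u (x + 2)) - (u (x + 1) - u x)\<bar>" by metis
  have shift: "filterlim (\<lambda>x. x + c) F F" if "0 \<le> c" for c :: real
    using filterlim_shifted[OF F, of "\<lambda>x. x + c" c] that by simp
  have "filterlim z F F" using filterlim_shifted[OF F z(1,2)] .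
  then have 1: "((\<lambda>x. u'' (z x)) \<longlongrightarrow> l) F" by (rule filterlim_compose[OF lim''])
  have "((\<lambda>x. (u (x + 3) - u (x + 2)) - (u (x + 1) - u x)) \<longlongrightarrow> (L - L) - (L - L)) F"
    by (intro tendsto_diff filterlim_compose[OF lim shift] lim) simp_all
  then have "((\<lambda>x. \<bar>(u (x + 3) - u (x + 2)) - (u (x + 1) - u x)\<bar>) \<longlongrightarrow> 0) F"
    by (simp add: tendsto_rabs_zero)
  then have 2: "((\<lambda>x. u'' (z x)) \<longlongrightarrow> 0) F"
    by (rule Lim_null_comparison[rotated]) (simp add: z(3))
  have "F \<noteq> bot" using F trivial_limit_at_top_linorder trivial_limit_at_bot_linorder by metis
  then show ?thesis using tendsto_unique[OF _ 1 2] by simp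
qed

lemma deriv_tendsto_zero:
  fixes u u' u'' :: "real \<Rightarrow> real"
  assumes u: "\<And>x. (u has_real_derivative u' x) (at x)"
    and u': "\<And>x. (u' has_real_derivative u'' x) (at x)"
    and F: "F = at_top \<or> F = at_bot"
    and lim: "(u \<longlongrightarrow> L) F" and lim'': "(u'' \<longlongrightarrow> 0) F"
  shows "(u' \<longlongrightarrow> 0) F"
proof -
  have "\<exists>w. x \<le> w \<and> w \<le> x + 1 \<and> \<bar>u' x\<bar> \<le> \<bar>u (x + 1) - u x\<bar> + \<bar>u'' w\<bar>" for x
  proof -
    obtain z where z: "x < z" "z < x + 1" "u (x + 1) - u x = (x + 1 - x) * u' z"
      using MVT2[of x "x + 1" u u'] u by auto
    obtain w where w: "x < w" "w < z" "u' z - u' x = (z - x) * u'' w"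
      using MVT2[of x z u' u''] u' z by auto
    have "\<bar>u' z - u' x\<bar> = (z - x) * \<bar>u'' w\<bar>" using w z by (simp add: abs_mult)
    also have "\<dots> \<le> 1 * \<bar>u'' w\<bar>" using z w by (intro mult_right_mono) auto
    finally show ?thesis using z w by (intro exI[of _ w]) auto
  qed
  then obtain z where z: "\<And>x. x \<le> z x" "\<And>x. z x \<le> x + 1"
    "\<And>x. \<bar>u' x\<bar> \<le> \<bar>u (x + 1) - u x\<bar> + \<bar>u'' (z x)\<bar>" by metis
  have shift: "filterlim (\<lambda>x. x + c) F F" if "0 \<le> c" for c :: real
    using filterlim_shifted[OF F, of "\<lambda>x. x + c" c] that by simp
  have "filterlim z F F" using filterlim_shifted[OF F z(1,2)] .
  then have 1: "((\<lambda>x. u'' (z x)) \<longlongrightarrow> 0) F" by (rule filterlim_compose[OF lim''])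
  have "((\<lambda>x. \<bar>u (x + 1) - u x\<bar> + \<bar>u'' (z x)\<bar>) \<longlongrightarrow> \<bar>L - L\<bar> + \<bar>0\<bar>) F"
    by (intro tendsto_add tendsto_diff tendsto_rabs filterlim_compose[OF lim shift] lim 1) simp
  then have "((\<lambda>x. \<bar>u (x + 1) - u x\<bar> + \<bar>u'' (z x)\<bar>) \<longlongrightarrow> 0) F" by simp
  then show ?thesis by (rule Lim_null_comparison[rotated]) (simp add: z(3))
qed

lemma antimono_bounded_tendsto:
  fixes u :: "real \<Rightarrow> real"
  assumes "antimono u" "\<And>x. A \<le> u x" "\<And>x. u x \<le> B"
  obtains L R where "(u \<longlongrightarrow> L) at_bot" "(u \<longlongrightarrow> R) at_top" "\<And>x. u x \<le> L" "\<And>x. R \<le> u x"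
proof -
  have bdd: "bdd_above (range u)" "bdd_below (range u)" using assms(2,3) by (auto intro!: bdd_aboveI bdd_belowI)
  have "(u \<longlongrightarrow> (SUP x. u x)) at_bot"
  proof (rule order_tendstoI)
    fix y assume "y < (SUP x. u x)"
    then obtain x where "y < u x" using less_cSUP_iff[OF _ bdd(1)] by auto
    then show "\<forall>\<^sub>F x in at_bot. y < u x"
      unfolding eventually_at_bot_linorder using antimonoD[OF assms(1)] by (meson less_le_trans)
  next
    fix y assume "(SUP x. u x) < y"
    then show "\<forall>\<^sub>F x in at_bot. u x < y"
      using cSUP_upper[OF _ bdd(1)] by (intro always_eventually allI) (meson UNIV_I le_less_trans)
  qed
  moreover have "(u \<longlongrightarrow> (INF x. u x)) at_top"
  proof (rule order_tendstoI)
    fix y assume "(INF x. u x) < y"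
    then obtain x where "u x < y" using cINF_less_iff[OF _ bdd(2)] by auto
    then show "\<forall>\<^sub>F x in at_top. u x < y"
      unfolding eventually_at_top_linorder using antimonoD[OF assms(1)] by (meson le_less_trans)
  next
    fix y assume "y < (INF x. u x)"
    then show "\<forall>\<^sub>F x in at_top. y < u x"
      using cINF_lower[OF bdd(2)] by (intro always_eventually allI) (meson UNIV_I less_le_trans)
  qed
  ultimately show thesis
    using that cSUP_upper[OF UNIV_I bdd(1)] cINF_lower[OF bdd(2) UNIV_I] by blast
qed

text \<open>The derivative in the state, \<open>4 - p - 3 * b\<^sup>2\<close>, is nonnegative for
  \<open>p \<le> 1\<close> and states in \<open>[0, 1]\<close>; hence the shift \<open>4\<close>,
  the square of the \<open>2\<close> in \<open>resolvent 2\<close>. Letting the potential drop from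
  \<open>p\<close> to \<open>q\<close> as well allows comparison between different points of the
  line.\<close>

lemma reaction_mono:
  fixes p q a b :: real
  assumes "0 \<le> a" "a \<le> b" "b \<le> 1" "q \<le> p" "p \<le> 1"
  shows "4 * a - p * a - a ^ 3 \<le> 4 * b - q * b - b ^ 3"
proof -
  have "a * b \<le> 1 * 1" using assms by (intro mult_mono) auto
  moreover have "a ^ 2 \<le> 1" "b ^ 2 \<le> 1" using assms by (auto intro!: power_le_one)
  ultimately have "0 \<le> (b - a) * (4 - p - (a ^ 2 + a * b + b ^ 2))" using assms by (intro mult_nonneg_nonneg) auto
  moreover have "0 \<le> (p - q) * b" using assms by auto
  ultimately show ?thesis by (simp add: algebra_simps power2_eq_square power3_eq_cube)
qed

text \<open>A decreasing iteration might collapse to zero. A sine bump placed where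
  \<open>Q \<le> - 1 / 2\<close> stays below every iterate and prevents this; positivity and
  monotonicity then determine both end states.\<close>

lemma front_exists:
  fixes Q :: "real \<Rightarrow> real"
  assumes Qcont: "continuous_on UNIV Q" and Qmono: "mono Q"
    and Qbot: "(Q \<longlongrightarrow> - 1) at_bot" and Qtop: "(Q \<longlongrightarrow> 1) at_top"
  obtains u u' where "\<And>x. (u has_real_derivative u' x) (at x)"
    "\<And>x. (u' has_real_derivative Q x * u x + u x ^ 3) (at x)"
    "\<And>x. 0 < u x" "\<And>x. u x \<le> 1"
    "(u \<longlongrightarrow> 1) at_bot" "(u \<longlongrightarrow> 0) at_top" "(u' \<longlongrightarrow> 0) at_bot" "(u' \<longlongrightarrow> 0) at_top"
proof -
  have Q1: "Q x \<le> 1" for x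
    by (rule tendsto_lowerbound[OF Qtop])
      (auto simp: eventually_at_top_linorder intro!: exI[of _ x] monoD[OF Qmono])
  have Q2: "-1 \<le> Q x" for x
    by (rule tendsto_upperbound[OF Qbot])
      (auto simp: eventually_at_bot_linorder intro!: exI[of _ x] monoD[OF Qmono])
  \<comment> \<open>With this shift \<open>u'' = Q * u + u ^ 3\<close> reads
    \<open>u = resolvent 2 (N u)\<close>.\<close>
  define N where "N v x = 4 * v x - Q x * v x - v x ^ 3" for v x
  define U where "U n = ((\<lambda>v. resolvent 2 (N v)) ^^ n) (\<lambda>_. 1)" for n
  have U0: "U 0 = (\<lambda>_. 1)" and US: "U (Suc n) = resolvent 2 (N (U n))" for n
    by (auto simp: U_def)
  have Nb: "0 \<le> N v x" "N v x \<le> 4" if "0 \<le> v x" "v x \<le> 1" for v x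
    using reaction_mono[of 0 "v x" "Q x" "Q x"] reaction_mono[of "v x" 1 "Q x" "Q x"] that Q1[of x] Q2[of x]
    by (auto simp: N_def)
  have Nc: "continuous_on UNIV (N v)" if "continuous_on UNIV v" for v
    unfolding N_def[abs_def] by (intro continuous_intros that Qcont)
  have res0: "resolvent 2 (\<lambda>_. 0) x = 0" for x
    using resolvent_bound[of 2 "\<lambda>_. 0" 0 x] by simp
  have inv: "continuous_on UNIV (U n) \<and> (\<forall>x. 0 \<le> U n x \<and> U n x \<le> 1) \<and> antimono (U n)" for n
  proof (induction n)
    case 0 then show ?case by (auto simp: U0 intro: antimonoI)
  next
    case (Suc n)
    then have c: "continuous_on UNIV (U n)" and b: "\<And>x. 0 \<le> U n x" "\<And>x. U n x \<le> 1" and m: "antimono (U n)"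
      by auto
    have bd: "\<bar>N (U n) x\<bar> \<le> 4" for x using Nb[of "U n" x] b[of x] by auto
    have "U (Suc n) x \<le> 1" for x
      using resolvent_bound[OF _ Nc[OF c] bd, of 2 x] by (simp add: US)
    moreover have "0 \<le> U (Suc n) x" for x
      using resolvent_mono[of 2 "\<lambda>_. 0" 0 "N (U n)" 4 0 x] Nc[OF c] bd Nb[of "U n"] b by (simp add: US res0)
    moreover have "antimono (U (Suc n))"
    proof (rule antimonoI)
      fix x y :: real assume xy: "x \<le> y"
      \<comment> \<open>Moving left lowers \<open>Q\<close> and raises \<open>U n\<close>; both
        raise \<open>N (U n)\<close>, and the resolvent inherits this.\<close>
      have "resolvent 2 (N (U n)) y \<le> resolvent 2 (N (U n)) (y + (x - y))"
      proof (rule resolvent_mono[OF _ Nc[OF c] bd Nc[OF c] bd])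
        fix z show "N (U n) z \<le> N (U n) (z + (x - y))"
          unfolding N_def
          by (rule reaction_mono) (use b xy Q1 in \<open>auto intro: antimonoD[OF m] monoD[OF Qmono]\<close>)
      qed simp
      then show "U (Suc n) y \<le> U (Suc n) x" by (simp add: US)
    qed
    ultimately show ?case using resolvent_continuous[OF _ Nc[OF c] bd, of 2] by (auto simp: US)
  qed
  have c: "continuous_on UNIV (U n)" and b: "0 \<le> U n x" "U n x \<le> 1" and m: "antimono (U n)" for n x
    using inv by auto
  have bd: "\<bar>N (U n) x\<bar> \<le> 4" for n x using Nb[of "U n" x] b[of n x] by auto
  have dU: "(U (Suc n) has_real_derivative resolvent_deriv 2 (N (U n)) x) (at x)" for n x
    unfolding US by (rule resolvent_has_deriv[OF _ Nc[OF c] bd]) simp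
  have ddU: "(resolvent_deriv 2 (N (U n)) has_real_derivative 4 * U (Suc n) x - N (U n) x) (at x)" for n x
    unfolding US using resolvent_deriv_has_deriv[OF _ Nc[OF c] bd, of 2] by simp
  have dec: "U (Suc n) x \<le> U n x" for n x
  proof (induction n arbitrary: x)
    case 0 show ?case using b(2)[of "Suc 0" x] by (simp add: U0)
  next
    case (Suc n)
    have "resolvent 2 (N (U (Suc n))) x \<le> resolvent 2 (N (U n)) (x + 0)"
    proof (rule resolvent_mono[OF _ Nc[OF c] bd Nc[OF c] bd])
      fix z show "N (U (Suc n)) z \<le> N (U n) (z + 0)"
        unfolding N_def using reaction_mono[of "U (Suc n) z" "U n z" "Q z" "Q z"] Suc b Q1 by simp
    qed simp
    then show ?case by (simp add: US)
  qed
  obtain X where X: "\<And>x. x \<le> X \<Longrightarrow> Q x \<le> - 1 / 2"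
  proof -
    have "\<forall>\<^sub>F x in at_bot. Q x < - 1 / 2" using order_tendstoD(2)[OF Qbot, of "-1/2"] by simp
    then show thesis using that unfolding eventually_at_bot_linorder by force
  qed
  \<comment> \<open>The bump satisfies \<open>s'' = - s / 4\<close>, vanishes at
    \<open>X - 2 * pi\<close> and \<open>X\<close>, is positive between them and has height
    \<open>1 / 2\<close>. Then \<open>Q + s\<^sup>2 \<le> - 1 / 2 + 1 / 4\<close> makes it a
    subsolution there.\<close>
  define s where "s x = sin ((x - X) / 2 + pi) / 2" for x
  have s_le: "s x \<le> 1 / 2" for x using sin_le_one[of "(x - X) / 2 + pi"] by (simp add: s_def)
  have bump: "s x \<le> U n x" if "x \<in> {X - 2 * pi..X}" for n x
    using that
  proof (induction n arbitrary: x)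
    case 0 show ?case using s_le[of x] by (simp add: U0)
  next
    case (Suc n)
    have "s x - U (Suc n) x \<le> 0"
    proof (rule maximum_principle[of "{X - 2 * pi..X}" "\<lambda>x. s x - U (Suc n) x" 4 1
          "\<lambda>x. - s x / 4 - (4 * U (Suc n) x - N (U n) x)"
          "\<lambda>x. cos ((x - X) / 2 + pi) / 4 - resolvent_deriv 2 (N (U n)) x"])
      show "continuous_on {X - 2 * pi..X} (\<lambda>x. s x - U (Suc n) x)"
        unfolding s_def by (intro continuous_intros continuous_on_subset[OF c]) auto
      show "s x - U (Suc n) x \<le> 1" for x
        using b(1)[of "Suc n" x] s_le[of x] by linarith
      show "x \<in> interior {X - 2 * pi..X} \<and>
         4 * (s x - U (Suc n) x) \<le> - s x / 4 - (4 * U (Suc n) x - N (U n) x)"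
        if x: "x \<in> {X - 2 * pi..X}" and p: "0 < s x - U (Suc n) x" for x
      proof
        have "s X = 0" "s (X - 2 * pi) = 0" by (auto simp: s_def)
        then have "x \<noteq> X" "x \<noteq> X - 2 * pi" using p b(1)[of "Suc n" x] by auto
        then show "x \<in> interior {X - 2 * pi..X}" using x by auto
        have s0: "0 \<le> s x" using p b(1)[of "Suc n" x] by auto
        note s1 = s_le[of x]
        have sU: "s x \<le> U n x" using Suc.IH x by blast
        have "4 * s x - Q x * s x - s x ^ 3 \<le> N (U n) x"
          unfolding N_def by (rule reaction_mono) (use s0 sU b Q1 in auto)
        moreover have "Q x * s x + s x ^ 3 \<le> - s x / 4"
        proof -
          have "s x ^ 2 \<le> (1 / 2) ^ 2" using s0 s1 by (intro power_mono) auto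
          then have "Q x + s x ^ 2 \<le> - 1 / 4" using X[of x] x by (simp add: power2_eq_square)
          then have "(Q x + s x ^ 2) * s x \<le> (- 1 / 4) * s x" using s0 by (intro mult_right_mono)
          then show ?thesis by (simp add: algebra_simps power2_eq_square power3_eq_cube)
        qed
        ultimately show "4 * (s x - U (Suc n) x) \<le> - s x / 4 - (4 * U (Suc n) x - N (U n) x)" by simp
      qed
      show "((\<lambda>x. s x - U (Suc n) x) has_real_derivative cos ((x - X) / 2 + pi) / 4 - resolvent_deriv 2 (N (U n)) x) (at x)"
        for x unfolding s_def by (auto intro!: derivative_eq_intros dU)
      show "((\<lambda>x. cos ((x - X) / 2 + pi) / 4 - resolvent_deriv 2 (N (U n)) x) has_real_derivative
          - s x / 4 - (4 * U (Suc n) x - N (U n) x)) (at x)" for x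
        unfolding s_def by (auto intro!: derivative_eq_intros ddU)
    qed (use Suc.prems in auto)
    then show ?case by simp
  qed
  have "\<exists>l. (\<lambda>n. U n x) \<longlonglongrightarrow> l" for x
  proof -
    have "decseq (\<lambda>n. U n x)" using dec by (rule decseq_SucI)
    then show ?thesis using decseq_convergent[of "\<lambda>n. U n x" 0] b(1) by metis
  qed
  then obtain u where lim: "\<And>x. (\<lambda>n. U n x) \<longlonglongrightarrow> u x" by metis
  have ub: "0 \<le> u x" "u x \<le> 1" for x
    using LIMSEQ_le_const[OF lim] LIMSEQ_le_const2[OF lim] b by blast+
  have um: "antimono u"
    by (rule antimonoI) (use LIMSEQ_le[OF lim lim] antimonoD[OF m] in blast)
  \<comment> \<open>A common Lipschitz constant passes to the pointwise limit and makes it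
    continuous, as the resolvent estimates require; \<open>6\<close> is \<open>2 * 1 + 4\<close>
    from \<open>deriv_bound_of_bounds\<close>.\<close>
  have lipU: "\<bar>U (Suc n) x - U (Suc n) y\<bar> \<le> 6 * \<bar>x - y\<bar>" for n x y
  proof -
    have "\<bar>resolvent_deriv 2 (N (U n)) x\<bar> \<le> 2 * 1 + 4" for x
    proof (rule deriv_bound_of_bounds[OF dU ddU])
      show "\<bar>4 * U (Suc n) z - N (U n) z\<bar> \<le> 4" for z
        using b[of "Suc n" z] b[of n z] Nb[of "U n" z] by auto
      show "\<bar>U (Suc n) z\<bar> \<le> 1" for z using b[of "Suc n" z] by auto
    qed
    then show ?thesis
      using field_differentiable_bound[of UNIV "U (Suc n)" "resolvent_deriv 2 (N (U n))" 6 x y]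
        dU[THEN DERIV_subset] by (auto simp: abs_minus_commute)
  qed
  have lipu: "\<bar>u x - u y\<bar> \<le> 6 * \<bar>x - y\<bar>" for x y
  proof (rule LIMSEQ_le_const2)
    show "(\<lambda>n. \<bar>U (Suc n) x - U (Suc n) y\<bar>) \<longlonglongrightarrow> \<bar>u x - u y\<bar>"
      by (intro tendsto_intros LIMSEQ_Suc lim)
  qed (use lipU in auto)
  have uc: "continuous_on UNIV u"
  proof (rule lipschitz_on_continuous_on)
    show "6-lipschitz_on UNIV u" by (rule lipschitz_onI) (auto simp: dist_real_def lipu)
  qed
  have bdu: "\<bar>N u x\<bar> \<le> 4" for x using Nb[of u x] ub[of x] by auto
  have "u x = resolvent 2 (N u) x" for x
  proof -
    have "(\<lambda>n. resolvent 2 (N (U n)) x) \<longlonglongrightarrow> resolvent 2 (N u) x"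
    proof (rule resolvent_tendsto[OF _ Nc[OF c] bd])
      show "(\<lambda>n. N (U n) y) \<longlonglongrightarrow> N u y" for y unfolding N_def by (intro tendsto_intros lim)
    qed simp
    moreover have "(\<lambda>n. resolvent 2 (N (U n)) x) \<longlonglongrightarrow> u x"
      using LIMSEQ_Suc[OF lim[of x]] by (simp add: US)
    ultimately show ?thesis using LIMSEQ_unique by blast
  qed
  then have ufix: "u = resolvent 2 (N u)" by blast
  define u' where "u' = resolvent_deriv 2 (N u)"
  have du: "(u has_real_derivative u' x) (at x)" for x
    unfolding u'_def by (subst ufix) (rule resolvent_has_deriv[OF _ Nc[OF uc] bdu], simp)
  have "4 * u x - N u x = Q x * u x + u x ^ 3" for x by (simp add: N_def)
  then have du': "(u' has_real_derivative Q x * u x + u x ^ 3) (at x)" for x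
    unfolding u'_def using resolvent_deriv_has_deriv[OF _ Nc[OF uc] bdu, of 2 x] ufix by simp
  define x1 where "x1 = X - pi"
  have "s x1 = 1 / 2" by (simp add: s_def x1_def sin_add)
  then have "1 / 2 \<le> u x1"
    using LIMSEQ_le_const[OF lim[of x1], of "s x1"] bump[of x1] pi_gt_zero by (auto simp: x1_def)
  then have ux1: "0 < u x1" by simp
  have upos: "0 < u x" for x
  proof (cases "x \<le> x1")
    case True
    then show ?thesis using antimonoD[OF um True] ux1 by linarith
  next
    case False
    \<comment> \<open>Nonnegativity of \<open>N u\<close> means \<open>u'' \<le> 4 * u\<close>, so
      \<open>u\<close> cannot fall below the decaying solution of \<open>f'' = 4 * f\<close> with
      the same value at \<open>x1\<close>.\<close>
    have "u x1 * exp (- 2 * (x - x1)) - u x \<le> 0"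
    proof (rule maximum_principle[of "{x1..}" "\<lambda>x. u x1 * exp (- 2 * (x - x1)) - u x" 4 "u x1"
          "\<lambda>x. 4 * (u x1 * exp (- 2 * (x - x1))) - (Q x * u x + u x ^ 3)"
          "\<lambda>x. - 2 * (u x1 * exp (- 2 * (x - x1))) - u' x"])
      show "u x1 * exp (- 2 * (x - x1)) - u x \<le> u x1" if "x \<in> {x1..}" for x
      proof -
        have "u x1 * exp (- 2 * (x - x1)) \<le> u x1 * 1" using that ux1 by (intro mult_left_mono) auto
        then show ?thesis using ub(1)[of x] by linarith
      qed
      show "x \<in> interior {x1..} \<and> 4 * (u x1 * exp (- 2 * (x - x1)) - u x)
          \<le> 4 * (u x1 * exp (- 2 * (x - x1))) - (Q x * u x + u x ^ 3)"
        if "x \<in> {x1..}" "0 < u x1 * exp (- 2 * (x - x1)) - u x" for x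
        using that Nb(1)[of u x] ub[of x] by (cases "x = x1") (auto simp: N_def)
    qed (use False in \<open>auto intro!: derivative_eq_intros du du' continuous_intros continuous_on_subset[OF uc]\<close>)
    moreover have "0 < u x1 * exp (- 2 * (x - x1))" using ux1 by simp
    ultimately show ?thesis by linarith
  qed
  obtain L R where LR: "(u \<longlongrightarrow> L) at_bot" "(u \<longlongrightarrow> R) at_top" "\<And>x. u x \<le> L" "\<And>x. R \<le> u x"
    using antimono_bounded_tendsto[OF um ub] by blast
  have fb: "((\<lambda>x. Q x * u x + u x ^ 3) \<longlongrightarrow> (- 1) * L + L ^ 3) at_bot"
    by (intro tendsto_intros LR Qbot)
  have ft: "((\<lambda>x. Q x * u x + u x ^ 3) \<longlongrightarrow> 1 * R + R ^ 3) at_top"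
    by (intro tendsto_intros LR Qtop)
  have eb: "(- 1) * L + L ^ 3 = 0" by (rule limit_of_second_deriv_zero[OF du du' _ LR(1) fb]) simp
  have et: "1 * R + R ^ 3 = 0" by (rule limit_of_second_deriv_zero[OF du du' _ LR(2) ft]) simp
  have "0 < L" using upos[of 0] LR(3)[of 0] by linarith
  moreover have "L * (L\<^sup>2 - 1) = 0" using eb by (simp add: algebra_simps power2_eq_square power3_eq_cube)
  ultimately have L: "L = 1" by (auto simp: power2_eq_1_iff)
  have "0 \<le> R" by (rule tendsto_lowerbound[OF LR(2)]) (auto simp: ub)
  then have R: "R = 0" using et by (smt (verit) zero_less_power)
  have "(u' \<longlongrightarrow> 0) at_bot" using deriv_tendsto_zero[OF du du' _ LR(1)] fb eb by simp
  moreover have "(u' \<longlongrightarrow> 0) at_top" using deriv_tendsto_zero[OF du du' _ LR(2)] ft et by simp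
  ultimately show thesis using that[OF du du' upos ub(2)] LR(1,2) L R by simp
qed

section \<open>A lower bound for solutions of Painleve type\<close>

text \<open>Tolerances around \<open>a x = x\<close>, wide enough to admit
  \<open>tanh (d * x) / d\<close> for small \<open>d\<close> and narrow enough for the numerical
  inequalities below. Curvature is controlled only left of \<open>- 3 / 4\<close>, where the square
  root profile is used.\<close>

locale painleve_potential =
  fixes a a' a'' :: "real \<Rightarrow> real"
  assumes a_deriv: "\<And>x. (a has_real_derivative a' x) (at x)"
    and a'_deriv: "\<And>x. (a' has_real_derivative a'' x) (at x)"
    and a'_bounds: "\<And>x. 0 \<le> a' x" "\<And>x. a' x \<le> 1"
    and a''_le: "\<And>x. x \<le> - 3 / 4 \<Longrightarrow> a'' x \<le> - a x / 500"
    and a_left: "- 3 / 4 \<le> a (- 3 / 4)" "a (- 3 / 4) \<le> - 7498 / 10000"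
    and a'_left: "999 / 1000 \<le> a' (- 3 / 4)"
    and a_neg: "\<And>x. - 3 / 4 \<le> x \<Longrightarrow> x \<le> 0 \<Longrightarrow> x \<le> a x \<and> a x \<le> x + 1 / 1000"
    and a_pos: "\<And>x. 0 \<le> x \<Longrightarrow> 0 \<le> a x \<and> a x \<le> x"
    and a_tenth: "1 / 20 \<le> a (1 / 10)"
begin

lemma a_mono: "x \<le> y \<Longrightarrow> a x \<le> a y"
  using DERIV_nonneg_imp_nondecreasing[of x y a] a_deriv a'_bounds by blast

text \<open>With \<open>b = - a\<close>, the function \<open>\<surd>(c b)\<close> is a subsolution where \<open>(1 - 2 c) b\<^sup>3 > 1/4\<close>, and \<open>6 c > 1\<close>
  is needed for a positive lower bound; \<open>c = 19/100\<close> satisfies both for \<open>x \<le> - 3/4\<close>. The parabola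
  vanishing at \<open>23/10\<close> continues it with a slightly larger slope at \<open>- 3/4\<close>, so that the corner is
  convex and the ratio to a solution cannot be maximal there.\<close>

definition sub_left :: "real \<Rightarrow> real" where
  "sub_left x = sqrt (19 / 100 * - a x)"

definition sub_right :: "real \<Rightarrow> real" where
  "sub_right x = sub_left (- 3 / 4) * ((23 / 10 - x) * (20 / 61))\<^sup>2"

definition sub_left' :: "real \<Rightarrow> real" where
  "sub_left' x = - (19 / 100 * a' x) / (2 * sub_left x)"

lemma a_le_left: "x \<le> - 3 / 4 \<Longrightarrow> a x \<le> - 7498 / 10000"
  using a_mono[of x "- 3 / 4"] a_left by linarith

lemma sub_left_sq: "x \<le> - 3 / 4 \<Longrightarrow> (sub_left x)\<^sup>2 = 19 / 100 * - a x"
  and sub_left_pos: "x \<le> - 3 / 4 \<Longrightarrow> 0 < sub_left x"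
  using a_le_left[of x] by (auto simp: sub_left_def)

lemma sub_left_deriv: "x \<le> - 3 / 4 \<Longrightarrow> (sub_left has_real_derivative sub_left' x) (at x)"
  unfolding sub_left_def[abs_def] sub_left'_def using a_le_left[of x]
  by (auto intro!: derivative_eq_intros a_deriv simp: field_simps)

lemma sub_left'_deriv:
  assumes "x \<le> - 3 / 4"
  shows "(sub_left' has_real_derivative
    - (19 / 100 * a'' x) / (2 * sub_left x) - (19 / 100 * a' x)\<^sup>2 / (4 * sub_left x ^ 3)) (at x)"
  unfolding sub_left'_def[abs_def] using sub_left_pos[OF assms]
  by (auto intro!: derivative_eq_intros a'_deriv sub_left_deriv[OF assms]
      simp: sub_left'_def field_simps power2_eq_square power3_eq_cube)

text \<open>Multiplied by \<open>sub_left x ^ 3\<close> and divided by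
  \<open>(19 / 100)\<^sup>2\<close>, the claim is
  \<open>b * a'' / 2 + a'\<^sup>2 / 4 \<le> 62 / 100 * b ^ 3\<close> with \<open>b = - a x\<close>,
  where \<open>62 / 100 = 1 - 2 * (19 / 100)\<close>. The worst case is the smallest value
  \<open>b = 7498 / 10000\<close>, where the right side only just exceeds
  \<open>1 / 4\<close>.\<close>

lemma sub_left_subsolution:
  assumes "x \<le> - 3 / 4"
  shows "sub_left x * (a x + 2 * (sub_left x)\<^sup>2)
     \<le> - (19 / 100 * a'' x) / (2 * sub_left x) - (19 / 100 * a' x)\<^sup>2 / (4 * sub_left x ^ 3)"
proof -
  define b where "b = - a x"
  define s where "s = sub_left x"
  have s: "0 < s" "s\<^sup>2 = 19 / 100 * b" using sub_left_pos[OF assms] sub_left_sq[OF assms] by (auto simp: s_def b_def)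
  have b: "7498 / 10000 \<le> b" using a_le_left[OF assms] by (simp add: b_def)
  have a2: "a'' x \<le> b / 500" using a''_le[OF assms] by (simp add: b_def)
  have a1: "(a' x)\<^sup>2 \<le> 1" using a'_bounds[of x] by (simp add: power_le_one)
  have "(7498 / 10000) * (7498 / 10000) \<le> b * b" using b by (intro mult_mono) auto
  then have b2: "5622 / 10000 \<le> b * b" by simp
  have "(5622 / 10000) * (62 / 100 * (7498 / 10000) - 1 / 1000) \<le> (b * b) * (62 / 100 * b - 1 / 1000)"
    using b2 b by (intro mult_mono) auto
  then have "1 / 4 \<le> (b * b) * (62 / 100 * b - 1 / 1000)" by simp
  moreover have "b * a'' x \<le> b * (b / 500)" using a2 b by (intro mult_left_mono) auto
  ultimately have key: "b * a'' x / 2 + (a' x)\<^sup>2 / 4 \<le> 62 / 100 * b * b * b" using a1 by (simp add: algebra_simps)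
  have "s * (- b + 2 * s\<^sup>2) \<le> - (19 / 100 * a'' x) / (2 * s) - (19 / 100 * a' x)\<^sup>2 / (4 * s ^ 3)
     \<longleftrightarrow> (s\<^sup>2)\<^sup>2 * (- b + 2 * s\<^sup>2) \<le> - (19 / 100 * a'' x) * s\<^sup>2 / 2 - (19 / 100 * a' x)\<^sup>2 / 4"
    using s(1) by (simp add: field_simps power2_eq_square power3_eq_cube)
  also have "\<dots>" unfolding s(2) using key by (simp add: power2_eq_square algebra_simps)
  finally show ?thesis by (simp add: s_def b_def)
qed

lemma sub_right_deriv:
  "(sub_right has_real_derivative - (40 / 61) * sub_left (- 3 / 4) * ((23 / 10 - x) * (20 / 61))) (at x)"
  unfolding sub_right_def[abs_def] by (auto intro!: derivative_eq_intros simp: field_simps)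

lemma sub_right'_deriv:
  "((\<lambda>x. - (40 / 61) * sub_left (- 3 / 4) * ((23 / 10 - x) * (20 / 61))) has_real_derivative
      800 / 3721 * sub_left (- 3 / 4)) (at x)"
  by (auto intro!: derivative_eq_intros simp: algebra_simps)

lemma sub_right_subsolution:
  assumes "- 3 / 4 \<le> x" "x \<le> 23 / 10"
  shows "sub_right x * (a x + 2 * (sub_right x)\<^sup>2) \<le> 800 / 3721 * sub_left (- 3 / 4)"
proof -
  \<comment> \<open>\<open>61 / 20\<close> is the distance from \<open>- 3 / 4\<close> to
    \<open>23 / 10\<close>: \<open>y\<close> is \<open>1\<close> at the corner and \<open>0\<close>
    at the zero of the parabola, and \<open>800 / 3721 = 2 * (20 / 61)\<^sup>2\<close> is the second
    derivative of \<open>y\<^sup>2\<close> in \<open>x\<close>.\<close>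
  define y where "y = (23 / 10 - x) * (20 / 61)"
  define s where "s = sub_left (- 3 / 4)"
  have s: "0 < s" "s\<^sup>2 \<le> 57 / 400" using sub_left_pos[of "- 3 / 4"] sub_left_sq[of "- 3 / 4"] a_left
    by (auto simp: s_def)
  have y: "0 \<le> y" "y \<le> 1" using assms by (auto simp: y_def)
  have xy: "x = 23 / 10 - 61 / 20 * y" by (simp add: y_def field_simps)
  have ax: "a x \<le> 2301 / 1000 - 61 / 20 * y"
    using a_neg[of x] a_pos[of x] assms xy by (cases "x \<le> 0") linarith+
  have "y\<^sup>2 * (a x + 2 * (s * y\<^sup>2)\<^sup>2) \<le> 800 / 3721"
  proof -
    have "2 * (s * y\<^sup>2)\<^sup>2 = 2 * s\<^sup>2 * y ^ 4" by (simp add: power_mult_distrib flip: power_mult)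
    also have "\<dots> \<le> 2 * (57 / 400) * y ^ 4" using s by (intro mult_right_mono) auto
    finally have "a x + 2 * (s * y\<^sup>2)\<^sup>2 \<le> 2301 / 1000 - 61 / 20 * y + 57 / 200 * y ^ 4" using ax by simp
    then have "y\<^sup>2 * (a x + 2 * (s * y\<^sup>2)\<^sup>2) \<le> y\<^sup>2 * (2301 / 1000 - 61 / 20 * y + 57 / 200 * y ^ 4)"
      by (intro mult_left_mono) auto
    also have "\<dots> \<le> 800 / 3721"
    \<comment> \<open>In both cases \<open>y ^ 4\<close> is replaced by a multiple of
      \<open>y\<close>, via \<open>y ^ 3 \<le> 343 / 1000\<close> or \<open>y ^ 3 \<le> 1\<close>,
      which leaves a cubic to bound.\<close>
    proof (cases "y \<le> 7 / 10")
      case True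
      have "y ^ 3 \<le> (7 / 10) ^ 3" using True y by (intro power_mono) auto
      then have "y * y ^ 3 \<le> y * (343 / 1000)" using y by (intro mult_left_mono) (auto simp: power3_eq_cube)
      then have "y\<^sup>2 * (2301 / 1000 - 61 / 20 * y + 57 / 200 * y ^ 4)
          \<le> y\<^sup>2 * (2301 / 1000 - 61 / 20 * y + 57 / 200 * (y * (343 / 1000)))"
        by (intro mult_left_mono) (auto simp: power_def numeral_eq_Suc)
      also have "\<dots> \<le> 800 / 3721"
      proof -
        \<comment> \<open>The double root \<open>13 / 25\<close> lies close to the maximiser of the
          remaining cubic.\<close>
        have "0 \<le> (y - 13 / 25)\<^sup>2 * (y + 13 / 50)" using y by (intro mult_nonneg_nonneg) auto
        then have "0 \<le> y * (y * y) - 78 / 100 * (y * y) + 70304 / 1000000"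
          by (simp add: power2_eq_square field_simps)
        moreover have "0 \<le> y * y" by simp
        moreover have "y\<^sup>2 * (2301 / 1000 - 61 / 20 * y + 57 / 200 * (y * (343 / 1000)))
          = 2301 / 1000 * (y * y) - 2952245 / 1000000 * (y * (y * y))"
          by (simp add: power2_eq_square field_simps)
        ultimately show ?thesis by linarith
      qed
      finally show ?thesis .
    next
      case False
      have "y ^ 3 \<le> 1" using y by (intro power_le_one) auto
      then have "y * y ^ 3 \<le> y * 1" using y by (intro mult_left_mono) auto
      then have "y\<^sup>2 * (2301 / 1000 - 61 / 20 * y + 57 / 200 * y ^ 4)
          \<le> y\<^sup>2 * (2301 / 1000 - 2765 / 1000 * y)"
        by (intro mult_left_mono) (auto simp: power_def numeral_eq_Suc)
      also have "\<dots> \<le> 800 / 3721"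
      proof (cases "2301 / 1000 - 2765 / 1000 * y \<le> 0")
        case True
        then have "y\<^sup>2 * (2301 / 1000 - 2765 / 1000 * y) \<le> 0" by (simp add: mult_nonneg_nonpos)
        then show ?thesis by linarith
      next
        case neg: False
        \<comment> \<open>The quadratic \<open>y * (2301 / 1000 - 2765 / 1000 * y)\<close> decreases
          beyond \<open>7 / 10\<close>, so its value there, \<open>25585 / 100000\<close>, bounds
          it.\<close>
        have "0 \<le> (y - 7 / 10) * (2765 / 1000 * y - 3655 / 10000)"
          using False by (intro mult_nonneg_nonneg) auto
        then have "y * (2301 / 1000 - 2765 / 1000 * y) \<le> 25585 / 100000" by (simp add: field_simps)
        moreover have "y \<le> 833 / 1000" using neg by simp
        ultimately have "y * (y * (2301 / 1000 - 2765 / 1000 * y)) \<le> 833 / 1000 * (25585 / 100000)"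
          using y neg by (intro mult_mono) auto
        then show ?thesis unfolding power2_eq_square mult.assoc by linarith
      qed
      finally show ?thesis .
    qed
    finally show ?thesis .
  qed
  then have "s * (y\<^sup>2 * (a x + 2 * (s * y\<^sup>2)\<^sup>2)) \<le> s * (800 / 3721)" using s by (intro mult_left_mono) auto
  then show ?thesis by (simp add: sub_right_def y_def s_def algebra_simps)
qed

lemma sub_right_bound:
  assumes "- 3 / 4 \<le> x" "x \<le> 1 / 10"
  shows "1 / 20 \<le> a x + 6 * (sub_right x)\<^sup>2"
proof -
  define y where "y = (23 / 10 - x) * (20 / 61)"
  define s where "s = sub_left (- 3 / 4)"
  have s: "0 < s" "142462 / 1000000 \<le> s\<^sup>2" using sub_left_pos[of "- 3 / 4"] sub_left_sq[of "- 3 / 4"] a_left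
    by (auto simp: s_def)
  have y: "22 / 10 * (20 / 61) \<le> y" "y \<le> 1" using assms by (auto simp: y_def)
  have xy: "x = 23 / 10 - 61 / 20 * y" by (simp add: y_def field_simps)
  have ax: "23 / 10 - 61 / 20 * y \<le> a x \<or> (0 \<le> a x)"
    using a_neg[of x] a_pos[of x] assms xy by (cases "x \<le> 0") linarith+
  \<comment> \<open>The tangent line of \<open>y ^ 4\<close> at \<open>24 / 25\<close>. There
    \<open>6 * (142462 / 1000000) * y ^ 4\<close> has slope close to \<open>61 / 20\<close>, so the
    linear terms nearly cancel.\<close>
  have y4: "13824 / 15625 * (4 * y - 72 / 25) \<le> y ^ 4"
  proof -
    have "0 \<le> (y - 24 / 25)\<^sup>2 * ((y + 24 / 25)\<^sup>2 + 2 * (24 / 25)\<^sup>2)" by simp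
    also have "\<dots> = y ^ 4 - 13824 / 15625 * (4 * y - 72 / 25)"
      by (simp add: power2_eq_square power_def numeral_eq_Suc field_simps)
    finally show ?thesis by simp
  qed
  have e: "6 * (sub_right x)\<^sup>2 = 6 * s\<^sup>2 * y ^ 4"
    by (simp add: sub_right_def y_def s_def power_mult_distrib flip: power_mult)
  have l: "6 * (142462 / 1000000) * y ^ 4 \<le> 6 * s\<^sup>2 * y ^ 4" using s by (intro mult_right_mono) auto
  have "(7 / 10) ^ 4 \<le> y ^ 4" using y by (intro power_mono) auto
  then have p: "24 / 100 \<le> y ^ 4" by (simp add: power_def numeral_eq_Suc)
  from ax show ?thesis
  proof
    assume "23 / 10 - 61 / 20 * y \<le> a x"
    moreover have "1 / 20 \<le> 23 / 10 - 61 / 20 * y + 6 * (142462 / 1000000) * y ^ 4"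
      using y4 y by simp
    ultimately show ?thesis unfolding e using l by simp
  qed (use e l p in simp)
qed

text \<open>Where \<open>a < 0\<close> the reaction need not be monotone, but divided by the unknown
  it is \<open>a + 2 * W\<^sup>2\<close>, which increases in \<open>W > 0\<close>. Hence
  \<open>W\<close> is scaled, not shifted: if \<open>c\<close> is the maximal ratio of the
  subsolution to \<open>W\<close>, then \<open>c * W\<close> touches the subsolution from above, and
  \<open>c > 1\<close> makes it a strict supersolution.\<close>

lemma solution_ge_sub:
  assumes W: "\<And>x. (W has_real_derivative W' x) (at x)"
    and W': "\<And>x. (W' has_real_derivative a x * W x + 2 * W x ^ 3) (at x)"
    and pos: "\<And>x. 0 < W x"
    and lim: "((\<lambda>x. (W x)\<^sup>2 / - a x) \<longlongrightarrow> 1 / 2) at_bot"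
    and x: "x \<le> 23 / 10"
  shows "(if x \<le> - 3 / 4 then sub_left x else sub_right x) \<le> W x"
proof (rule ccontr)
  define S where "S x = (if x \<le> - 3 / 4 then sub_left x else sub_right x)" for x
  assume "\<not> (if x \<le> - 3 / 4 then sub_left x else sub_right x) \<le> W x"
  then have Sx: "W x < S x" by (simp add: S_def)
  have match: "sub_right (- 3 / 4) = sub_left (- 3 / 4)" by (simp add: sub_right_def)
  have "\<forall>\<^sub>F x in at_bot. 19 / 100 < (W x)\<^sup>2 / - a x" using order_tendstoD(1)[OF lim, of "19/100"] by simp
  then obtain X where X0: "\<And>x. x \<le> X \<Longrightarrow> 19 / 100 < (W x)\<^sup>2 / - a x"
    by (auto simp: eventually_at_bot_linorder)
  \<comment> \<open>The limit \<open>1 / 2\<close> exceeds \<open>19 / 100\<close>, so the ratio is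
    below \<open>1\<close> left of \<open>Y\<close> and only a compact interval remains.\<close>
  define Y where "Y = min X (- 1)"
  have Y: "S z < W z" if "z \<le> Y" for z
  proof -
    have z: "z \<le> X" "z \<le> - 3 / 4" using that by (auto simp: Y_def)
    have "19 / 100 * - a z < (W z)\<^sup>2" using X0[OF z(1)] a_le_left[OF z(2)] by (simp add: field_simps)
    then have "(sub_left z)\<^sup>2 < (W z)\<^sup>2" using sub_left_sq[OF z(2)] by simp
    then show ?thesis using z pos[of z] power2_less_imp_less[of "sub_left z" "W z"] by (simp add: S_def)
  qed
  have Wc: "continuous_on A W" for A
    using W by (meson DERIV_continuous continuous_at_imp_continuous_on)
  have "continuous_on {Y..23/10} S"
    unfolding S_def
  proof (rule continuous_on_cases_le)
    show "continuous_on {t \<in> {Y..23/10}. t \<le> - 3 / 4} sub_left"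
      by (rule DERIV_continuous_on) (use sub_left_deriv in \<open>auto intro: DERIV_subset\<close>)
    show "continuous_on {t \<in> {Y..23/10}. - 3 / 4 \<le> t} sub_right"
      unfolding sub_right_def[abs_def] by (intro continuous_intros)
  qed (use match in \<open>auto intro: continuous_intros\<close>)
  then have "continuous_on {Y..23/10} (\<lambda>z. S z / W z)"
    using pos by (intro continuous_intros Wc) (auto simp: less_imp_neq[THEN not_sym])
  moreover have "{Y..23/10} \<noteq> {}" by (auto simp: Y_def)
  ultimately obtain m where m: "m \<in> {Y..23/10}" "\<And>z. z \<in> {Y..23/10} \<Longrightarrow> S z / W z \<le> S m / W m"
    using continuous_attains_sup[of "{Y..23/10}" "\<lambda>z. S z / W z"] by blast
  define c where "c = S m / W m"
  have "x \<in> {Y..23/10}" using Y[of x] Sx x by (cases "x \<le> Y") auto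
  then have "S x / W x \<le> c" unfolding c_def by (rule m(2))
  moreover have "1 < S x / W x" using Sx pos[of x] by simp
  ultimately have c: "1 < c" by linarith
  have Sm: "S m = c * W m" using pos[of m] by (simp add: c_def)
  have WS: "W m < S m" unfolding Sm using c pos[of m] by simp
  have "m \<noteq> Y" using Y[of Y] WS by auto
  moreover have "m \<noteq> 23 / 10"
  proof
    assume "m = 23 / 10"
    then have "S m = 0" unfolding S_def sub_right_def by simp
    then show False using WS pos[of m] by simp
  qed
  ultimately have mi: "Y < m" "m < 23 / 10" using m(1) by auto
  have max: "S z \<le> c * W z" if "z \<le> 23 / 10" for z
  proof (cases "z \<le> Y")
    case True
    have "1 * W z \<le> c * W z" using c pos[of z] by (intro mult_right_mono) auto
    then show ?thesis using Y[OF True] by simp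
  next
    case False
    then show ?thesis using m(2)[of z] that pos[of z] by (simp add: c_def field_simps)
  qed
  have strict: "c * (a m * W m + 2 * W m ^ 3) < S m * (a m + 2 * (S m)\<^sup>2)"
  proof -
    have Smp: "0 < S m" using WS pos[of m] by simp
    from WS have "(W m)\<^sup>2 < (S m)\<^sup>2" using pos[of m] by (intro power_strict_mono) auto
    then have "S m * (a m + 2 * (W m)\<^sup>2) < S m * (a m + 2 * (S m)\<^sup>2)"
      using Smp by (intro mult_strict_left_mono) auto
    then show ?thesis by (simp add: Sm algebra_simps power2_eq_square power3_eq_cube)
  qed
  consider "m < - 3 / 4" | "m = - 3 / 4" | "- 3 / 4 < m" by linarith
  then show False
  proof cases
    case 1
    have "(- (19 / 100 * a'' m) / (2 * sub_left m) - (19 / 100 * a' m)\<^sup>2 / (4 * sub_left m ^ 3))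
        - c * (a m * W m + 2 * W m ^ 3) \<le> 0"
    proof (rule second_derivative_nonpos_at_max[where S = "{..<- 3/4}" and x = m
          and f = "\<lambda>z. sub_left z - c * W z" and f' = "\<lambda>z. sub_left' z - c * W' z"])
      show "sub_left z - c * W z \<le> sub_left m - c * W m" if "z \<in> {..<- 3/4}" for z
        using max[of z] that Sm 1 by (simp add: S_def)
    qed (use 1 in \<open>auto intro!: derivative_eq_intros sub_left_deriv sub_left'_deriv W W'\<close>)
    then show False using strict sub_left_subsolution[of m] 1 by (simp add: S_def)
  next
    case 3
    have "800 / 3721 * sub_left (- 3 / 4) - c * (a m * W m + 2 * W m ^ 3) \<le> 0"
    proof (rule second_derivative_nonpos_at_max[where S = "{- 3/4<..<23/10}" and x = m
          and f = "\<lambda>z. sub_right z - c * W z"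
          and f' = "\<lambda>x. (- (40 / 61) * sub_left (- 3 / 4) * ((23 / 10 - x) * (20 / 61))) - c * W' x"])
      show "sub_right z - c * W z \<le> sub_right m - c * W m" if "z \<in> {- 3/4<..<23/10}" for z
        using max[of z] that Sm 3 by (simp add: S_def)
      show "((\<lambda>x. (- (40 / 61) * sub_left (- 3 / 4) * ((23 / 10 - x) * (20 / 61))) - c * W' x) has_real_derivative
          800 / 3721 * sub_left (- 3 / 4) - c * (a m * W m + 2 * W m ^ 3)) (at m)"
        by (intro DERIV_diff DERIV_cmult sub_right'_deriv W')
      show "((\<lambda>z. sub_right z - c * W z) has_real_derivative
         (- (40 / 61) * sub_left (- 3 / 4) * ((23 / 10 - y) * (20 / 61))) - c * W' y) (at y)" for y
        by (intro DERIV_diff DERIV_cmult sub_right_deriv W)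
    qed (use 3 mi in auto)
    then show False using strict sub_right_subsolution[of m] 3 mi by (simp add: S_def)
  next
    \<comment> \<open>At the corner only one-sided slopes are available. Maximality forces the slope
      of \<open>sub_right\<close> to be at most that of \<open>sub_left\<close>, which the numbers
      in \<open>a_left\<close> and \<open>a'_left\<close> exclude.\<close>
    case 2
    define s where "s = sub_left (- 3 / 4)"
    have s: "0 < s" "s\<^sup>2 = 19 / 100 * - a (- 3 / 4)"
      using sub_left_pos[of "- 3 / 4"] sub_left_sq[of "- 3 / 4"] by (auto simp: s_def)
    have eq: "s = c * W (- 3 / 4)" using Sm 2 by (simp add: S_def s_def)
    have "\<not> sub_left' (- 3 / 4) - c * W' (- 3 / 4) < 0"
    proof
      assume neg: "sub_left' (- 3 / 4) - c * W' (- 3 / 4) < 0"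
      have "((\<lambda>z. sub_left z - c * W z) has_real_derivative sub_left' (- 3 / 4) - c * W' (- 3 / 4)) (at (- 3 / 4))"
        by (intro DERIV_diff DERIV_cmult sub_left_deriv W) simp
      from DERIV_neg_dec_left[OF this neg] obtain d where d: "d > 0"
        "\<And>h. h > 0 \<Longrightarrow> h < d \<Longrightarrow> sub_left (- 3 / 4) - c * W (- 3 / 4) < sub_left (- 3 / 4 - h) - c * W (- 3 / 4 - h)"
        by blast
      have "sub_left (- 3 / 4 - d / 2) \<le> c * W (- 3 / 4 - d / 2)"
        using max[of "- 3 / 4 - d / 2"] d(1) by (simp add: S_def)
      then show False using d(2)[of "d / 2"] d(1) eq by (simp add: s_def)
    qed
    moreover have "\<not> 0 < (- (40 / 61) * s * ((23 / 10 - (- 3 / 4)) * (20 / 61))) - c * W' (- 3 / 4)"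
    proof
      assume pos: "0 < (- (40 / 61) * s * ((23 / 10 - (- 3 / 4)) * (20 / 61))) - c * W' (- 3 / 4)"
      have "((\<lambda>z. sub_right z - c * W z) has_real_derivative
          (- (40 / 61) * s * ((23 / 10 - (- 3 / 4)) * (20 / 61))) - c * W' (- 3 / 4)) (at (- 3 / 4))"
        unfolding s_def by (intro DERIV_diff DERIV_cmult sub_right_deriv W)
      from DERIV_pos_inc_right[OF this pos] obtain d where d: "d > 0"
        "\<And>h. h > 0 \<Longrightarrow> h < d \<Longrightarrow> sub_right (- 3 / 4) - c * W (- 3 / 4) < sub_right (- 3 / 4 + h) - c * W (- 3 / 4 + h)"
        by blast
      define h where "h = min (d / 2) 1"
      have h: "0 < h" "h < d" "h \<le> 1" using d(1) by (auto simp: h_def)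
      have "sub_right (- 3 / 4 + h) \<le> c * W (- 3 / 4 + h)"
        using max[of "- 3 / 4 + h"] h by (simp add: S_def)
      then show False using d(2)[of h] h eq match by (simp add: s_def)
    qed
    ultimately have "- (40 / 61) * s \<le> sub_left' (- 3 / 4)" by simp
    then have "- (40 / 61) * s * (2 * s) \<le> sub_left' (- 3 / 4) * (2 * s)"
      using s(1) by (intro mult_right_mono) auto
    also have "\<dots> = - (19 / 100 * a' (- 3 / 4))"
      using s(1) unfolding sub_left'_def s_def[symmetric] by simp
    finally have "- (40 / 61) * s * (2 * s) \<le> - (19 / 100 * a' (- 3 / 4))" .
    then have "19 / 100 * a' (- 3 / 4) \<le> 80 / 61 * s\<^sup>2" by (simp add: power2_eq_square)
    then show False using a_left a'_left unfolding s(2) by simp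
  qed
qed

text \<open>Left of \<open>- 3 / 4\<close> the gain is \<open>6 * (19 / 100) > 1\<close> times
  \<open>- a\<close>; up to \<open>1 / 10\<close> the parabola is used; further right
  \<open>a\<close> alone suffices.\<close>

lemma linearized_potential_bound:
  assumes W: "\<And>x. (W has_real_derivative W' x) (at x)"
    and W': "\<And>x. (W' has_real_derivative a x * W x + 2 * W x ^ 3) (at x)"
    and pos: "\<And>x. 0 < W x"
    and lim: "((\<lambda>x. (W x)\<^sup>2 / - a x) \<longlongrightarrow> 1 / 2) at_bot"
  shows "1 / 20 \<le> a x + 6 * (W x)\<^sup>2"
proof -
  note ge = solution_ge_sub[OF W W' pos lim]
  consider "x \<le> - 3 / 4" | "- 3 / 4 < x" "x \<le> 1 / 10" | "1 / 10 < x" by linarith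
  then show ?thesis
  proof cases
    case 1
    have "(sub_left x)\<^sup>2 \<le> (W x)\<^sup>2" using ge[of x] 1 sub_left_pos[OF 1] by (intro power_mono) auto
    then show ?thesis using sub_left_sq[OF 1] a_le_left[OF 1] by simp
  next
    case 2
    have "0 \<le> sub_right x" using sub_left_pos[of "- 3 / 4"] by (simp add: sub_right_def)
    then have "(sub_right x)\<^sup>2 \<le> (W x)\<^sup>2" using ge[of x] 2 by (intro power_mono) auto
    then show ?thesis using sub_right_bound[of x] 2 by simp
  next
    case 3
    have "a (1 / 10) \<le> a x" using 3 by (intro a_mono) simp
    moreover have "0 \<le> (W x)\<^sup>2" by simp
    ultimately show ?thesis using a_tenth by linarith
  qed
qed

end

section \<open>Comparison with the Hastings--McLeod solution\<close>

lemma tanh_cubic_bounds: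
  fixes y :: real
  assumes "0 \<le> y"
  shows "0 \<le> tanh y" "tanh y \<le> y" "y - y ^ 3 / 3 \<le> tanh y"
proof -
  have d: "(tanh has_real_derivative 1 - (tanh x)\<^sup>2) (at x)" for x :: real
    by (auto intro!: derivative_eq_intros)
  show nn: "0 \<le> tanh y" using assms by simp
  have le: "tanh x \<le> x" if "0 \<le> x" for x :: real
  proof -
    have "0 - tanh 0 \<le> x - tanh x"
    proof (rule DERIV_nonneg_imp_nondecreasing[OF that])
      fix t :: real
      show "\<exists>y. ((\<lambda>x. x - tanh x) has_real_derivative y) (at t) \<and> 0 \<le> y"
        by (rule exI[of _ "(tanh t)\<^sup>2"]) (auto intro!: derivative_eq_intros)
    qed
    then show ?thesis by simp
  qed
  show "tanh y \<le> y" by (rule le[OF assms])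
  have "tanh 0 - 0 + 0 ^ 3 / 3 \<le> tanh y - y + y ^ 3 / 3"
  proof (rule DERIV_nonneg_imp_nondecreasing[OF assms])
    fix t :: real assume t: "0 \<le> t" "t \<le> y"
    have "(tanh t)\<^sup>2 \<le> t\<^sup>2" using le[OF t(1)] t(1) by (intro power_mono) auto
    moreover have "((\<lambda>x. tanh x - x + x ^ 3 / 3) has_real_derivative t\<^sup>2 - (tanh t)\<^sup>2) (at t)"
      by (auto intro!: derivative_eq_intros simp: power2_eq_square)
    ultimately show "\<exists>y. ((\<lambda>x. tanh x - x + x ^ 3 / 3) has_real_derivative y) (at t) \<and> 0 \<le> y"
      by (intro exI[of _ "t\<^sup>2 - (tanh t)\<^sup>2"]) auto
  qed
  then show "y - y ^ 3 / 3 \<le> tanh y" by simp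
qed

lemma scaled_tanh_bounds:
  fixes d x :: real
  assumes "0 < d" "0 \<le> x"
  shows "0 \<le> tanh (d * x) / d" "tanh (d * x) / d \<le> x" "x - d\<^sup>2 * x ^ 3 / 3 \<le> tanh (d * x) / d"
proof -
  have "0 \<le> d * x" using assms by simp
  note b = tanh_cubic_bounds[OF this]
  show "0 \<le> tanh (d * x) / d" using b(1) assms by simp
  show "tanh (d * x) / d \<le> x" using b(2) assms by (simp add: field_simps)
  have "(x - d\<^sup>2 * x ^ 3 / 3) * d \<le> tanh (d * x)" using b(3)
    by (simp add: algebra_simps power2_eq_square power3_eq_cube)
  then show "x - d\<^sup>2 * x ^ 3 / 3 \<le> tanh (d * x) / d" using assms by (simp add: field_simps)
qed

lemma scaled_tanh_diff:
  fixes d x M :: real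
  assumes "0 < d" "\<bar>x\<bar> \<le> M"
  shows "\<bar>tanh (d * x) / d - x\<bar> \<le> d\<^sup>2 * M ^ 3 / 3"
proof -
  have p: "\<bar>tanh (d * y) / d - y\<bar> \<le> d\<^sup>2 * M ^ 3 / 3" if "0 \<le> y" "y \<le> M" for y
  proof -
    have "y ^ 3 \<le> M ^ 3" using that by (intro power_mono) auto
    then have "d\<^sup>2 * y ^ 3 \<le> d\<^sup>2 * M ^ 3" by (intro mult_left_mono) auto
    then show ?thesis using scaled_tanh_bounds[OF assms(1) that(1)] by auto
  qed
  show ?thesis
  proof (cases "0 \<le> x")
    case True then show ?thesis using p[of x] assms by simp
  next
    case False
    have "tanh (d * x) / d - x = - (tanh (d * - x) / d - - x)" by simp
    then have "\<bar>tanh (d * x) / d - x\<bar> = \<bar>tanh (d * - x) / d - - x\<bar>" by (metis abs_minus_cancel)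
    then show ?thesis using p[of "- x"] assms False by simp
  qed
qed

lemma painleve_potential_id: "painleve_potential (\<lambda>x. x) (\<lambda>_. 1) (\<lambda>_. 0)"
  by unfold_locales (auto intro!: derivative_eq_intros)

text \<open>On \<open>\<bar>x\<bar> \<le> 3 / 4\<close> the cubic remainder of \<open>tanh\<close>
  contributes at most \<open>2 / 10000\<close>, the origin of \<open>7498 / 10000\<close>; the
  curvature condition is \<open>2 * d\<^sup>2 \<le> 1 / 500\<close>.\<close>

lemma painleve_potential_tanh:
  fixes d :: real
  assumes "0 < d" "d\<^sup>2 \<le> 1 / 1000"
  shows "painleve_potential (\<lambda>x. tanh (d * x) / d) (\<lambda>x. 1 - (tanh (d * x))\<^sup>2)
     (\<lambda>x. - 2 * d * tanh (d * x) * (1 - (tanh (d * x))\<^sup>2))"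
proof
  fix x :: real
  have t1: "(tanh y)\<^sup>2 \<le> 1" for y :: real
    using tanh_real_bounds[of y] by (auto simp: abs_square_le_1 abs_le_iff less_imp_le)
  show "((\<lambda>x. tanh (d * x) / d) has_real_derivative 1 - (tanh (d * x))\<^sup>2) (at x)"
    using assms by (auto intro!: derivative_eq_intros)
  show "((\<lambda>x. 1 - (tanh (d * x))\<^sup>2) has_real_derivative
      - 2 * d * tanh (d * x) * (1 - (tanh (d * x))\<^sup>2)) (at x)"
    by (auto intro!: derivative_eq_intros simp: algebra_simps)
  show "0 \<le> 1 - (tanh (d * x))\<^sup>2" using t1 by simp
  show "1 - (tanh (d * x))\<^sup>2 \<le> 1" by simp
  have diff: "\<bar>tanh (d * x) / d - x\<bar> \<le> 2 / 10000" if "\<bar>x\<bar> \<le> 3 / 4" for x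
  proof -
    have "d\<^sup>2 * (3 / 4) ^ 3 / 3 \<le> 1 / 1000 * (3 / 4) ^ 3 / 3" using assms by simp
    also have "\<dots> \<le> 2 / 10000" by (simp add: power3_eq_cube)
    finally show ?thesis using scaled_tanh_diff[OF assms(1) that] by linarith
  qed
  show "- 2 * d * tanh (d * x) * (1 - (tanh (d * x))\<^sup>2) \<le> - (tanh (d * x) / d) / 500"
    if "x \<le> - 3 / 4"
  proof -
    have t: "tanh (d * x) \<le> 0" using that assms by (simp add: mult_nonneg_nonpos)
    have "- 2 * d * tanh (d * x) * (1 - (tanh (d * x))\<^sup>2) \<le> - 2 * d * tanh (d * x) * 1"
      using t assms by (intro mult_left_mono) (auto simp: mult_nonneg_nonpos divide_nonpos_pos)
    also have "\<dots> = d\<^sup>2 * 2 * (- tanh (d * x) / d)" using assms by (simp add: power2_eq_square)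
    also have "\<dots> \<le> 1 / 1000 * 2 * (- tanh (d * x) / d)" using t assms by (intro mult_right_mono) (auto simp: divide_nonpos_pos)
    finally show ?thesis by simp
  qed
  show "- 3 / 4 \<le> tanh (d * (- 3 / 4)) / d"
    using scaled_tanh_bounds(2)[OF assms(1), of "3 / 4"] by simp
  show "tanh (d * (- 3 / 4)) / d \<le> - 7498 / 10000"
  proof -
    have "\<bar>tanh (d * (- 3 / 4)) / d - (- 3 / 4)\<bar> \<le> 2 / 10000" by (rule diff) simp
    then show ?thesis by linarith
  qed
  show "999 / 1000 \<le> 1 - (tanh (d * (- 3 / 4)))\<^sup>2"
  proof -
    have "(tanh (d * (3 / 4)))\<^sup>2 \<le> (d * (3 / 4))\<^sup>2"
      using tanh_cubic_bounds[of "d * (3 / 4)"] assms by (intro power_mono) auto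
    also have "\<dots> \<le> 1 / 1000" using assms by (simp add: power2_eq_square)
    finally show ?thesis by simp
  qed
  show "x \<le> tanh (d * x) / d \<and> tanh (d * x) / d \<le> x + 1 / 1000" if "- 3 / 4 \<le> x" "x \<le> 0"
  proof -
    have "\<bar>tanh (d * x) / d - x\<bar> \<le> 2 / 10000" by (rule diff) (use that in auto)
    moreover have "x \<le> tanh (d * x) / d" using scaled_tanh_bounds(2)[OF assms(1), of "- x"] that by simp
    ultimately show ?thesis by linarith
  qed
  show "0 \<le> tanh (d * x) / d \<and> tanh (d * x) / d \<le> x" if "0 \<le> x"
    using scaled_tanh_bounds[OF assms(1) that] by simp
  show "1 / 20 \<le> tanh (d * (1 / 10)) / d"
  proof -
    have "\<bar>tanh (d * (1 / 10)) / d - 1 / 10\<bar> \<le> 2 / 10000" by (rule diff) simp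
    then show ?thesis by linarith
  qed
qed

text \<open>In the comparison function the constant \<open>G / k\<^sup>2\<close> absorbs the
  forcing, and a hyperbolic cosine normalised to be at least \<open>D\<close> at both ends absorbs
  the boundary values; in the middle the latter is exponentially small in
  \<open>k * M\<close>.\<close>

lemma linear_interval_bound:
  fixes z z' q g :: "real \<Rightarrow> real"
  assumes z: "\<And>x. (z has_real_derivative z' x) (at x)"
    and z': "\<And>x. (z' has_real_derivative z'' x) (at x)"
    and eq: "\<And>x. \<bar>x\<bar> \<le> M \<Longrightarrow> z'' x = q x * z x + g x"
    and q: "\<And>x. \<bar>x\<bar> \<le> M \<Longrightarrow> k\<^sup>2 \<le> q x" and g: "\<And>x. \<bar>x\<bar> \<le> M \<Longrightarrow> \<bar>g x\<bar> \<le> G"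
    and k: "0 < k" and D: "\<bar>z M\<bar> \<le> D" "\<bar>z (- M)\<bar> \<le> D" and x: "\<bar>x\<bar> \<le> M"
  shows "\<bar>z x\<bar> \<le> G / k\<^sup>2 + D * exp (- k * M) * (exp (k * x) + exp (- k * x))"
proof -
  define B where "B x = G / k\<^sup>2 + D * exp (- k * M) * (exp (k * x) + exp (- k * x))" for x
  have G0: "0 \<le> G" using g[OF x] by linarith
  have D0: "0 \<le> D" using D by linarith
  have B0: "0 \<le> B x" for x using G0 D0 k by (simp add: B_def)
  have Bend: "D \<le> B y" if "y = M \<or> y = - M" for y
  proof -
    have "D * 1 \<le> D * (exp (- k * M) * (exp (k * y) + exp (- k * y)))"
      using that D0 by (intro mult_left_mono) (auto simp: distrib_left simp flip: exp_add)
    moreover have "0 \<le> G / k\<^sup>2" using G0 by simp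
    ultimately show ?thesis unfolding B_def by (simp add: mult.assoc)
  qed
  have main: "s * z x - B x \<le> 0" if s: "s = 1 \<or> s = - 1" for s :: real
  proof (rule maximum_principle[of "{- M..M}" "\<lambda>x. s * z x - B x" "k\<^sup>2" _ 
        "\<lambda>x. s * z'' x - k\<^sup>2 * (B x - G / k\<^sup>2)" "\<lambda>x. s * z' x - D * exp (- k * M) * (k * exp (k * x) - k * exp (- k * x))"])
    have c: "continuous_on {- M..M} (\<lambda>x. s * z x - B x)"
      unfolding B_def using z
      by (intro continuous_intros) (auto intro: DERIV_continuous_on DERIV_subset)
    then show "continuous_on {- M..M} (\<lambda>x. s * z x - B x)" .
    have "bdd_above ((\<lambda>x. s * z x - B x) ` {- M..M})"
      using compact_continuous_image[OF c] by (simp add: bounded_imp_bdd_above compact_imp_bounded)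
    then show "s * z x - B x \<le> (SUP x\<in>{- M..M}. s * z x - B x)" if "x \<in> {- M..M}" for x
      using cSUP_upper[OF that] by simp
    show "y \<in> interior {- M..M} \<and> k\<^sup>2 * (s * z y - B y) \<le> s * z'' y - k\<^sup>2 * (B y - G / k\<^sup>2)"
      if y: "y \<in> {- M..M}" and p: "0 < s * z y - B y" for y
    proof
      have "y \<noteq> M" "y \<noteq> - M" using p Bend[of y] D s by auto
      then show "y \<in> interior {- M..M}" using y by auto
      have ay: "\<bar>y\<bar> \<le> M" using y by auto
      have "k\<^sup>2 * (s * z y) \<le> q y * (s * z y)" using q[OF ay] p B0[of y] by (intro mult_right_mono) auto
      moreover have "s * z'' y = q y * (s * z y) + s * g y" using eq[OF ay] by (simp add: algebra_simps)
      moreover have "- G \<le> s * g y" using g[OF ay] s by auto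
      moreover have "k\<^sup>2 * (G / k\<^sup>2) = G" using k by simp
      ultimately show "k\<^sup>2 * (s * z y - B y) \<le> s * z'' y - k\<^sup>2 * (B y - G / k\<^sup>2)"
        by (simp add: right_diff_distrib)
    qed
    show "((\<lambda>x. s * z x - B x) has_real_derivative
        s * z' y - D * exp (- k * M) * (k * exp (k * y) - k * exp (- k * y))) (at y)" for y
      unfolding B_def by (auto intro!: derivative_eq_intros z simp: algebra_simps)
    show "((\<lambda>x. s * z' x - D * exp (- k * M) * (k * exp (k * x) - k * exp (- k * x))) has_real_derivative
        s * z'' y - k\<^sup>2 * (B y - G / k\<^sup>2)) (at y)" for y
      unfolding B_def by (auto intro!: derivative_eq_intros z' simp: algebra_simps power2_eq_square)
  qed (use k x in auto)
  show ?thesis using main[of 1] main[of "- 1"] unfolding B_def[symmetric] by (auto simp: abs_le_iff)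
qed

lemma hastings_mcleod_square_limit:
  assumes "hastings_mcleod w"
  shows "((\<lambda>x. (w x)\<^sup>2 / - x) \<longlongrightarrow> 1 / 2) at_bot"
proof -
  have pos: "0 < w x" for x using assms by (simp add: hastings_mcleod_def)
  have "w \<sim>[at_bot] (\<lambda>x. sqrt (- x / 2))" using assms by (simp add: hastings_mcleod_def)
  then have "((\<lambda>x. w x / sqrt (- x / 2)) \<longlongrightarrow> 1) at_bot"
    by (rule asymp_equivD_strong) (use pos in \<open>auto simp: less_imp_neq[THEN not_sym]\<close>)
  then have "((\<lambda>x. (w x / sqrt (- x / 2))\<^sup>2 / 2) \<longlongrightarrow> 1\<^sup>2 / 2) at_bot" by (intro tendsto_intros) auto
  then have "((\<lambda>x. (w x / sqrt (- x / 2))\<^sup>2 / 2) \<longlongrightarrow> 1 / 2) at_bot" by simp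
  then show ?thesis
  proof (rule Lim_transform_eventually)
    show "\<forall>\<^sub>F x in at_bot. (w x / sqrt (- x / 2))\<^sup>2 / 2 = (w x)\<^sup>2 / - x"
      unfolding eventually_at_bot_linorder by (rule exI[of _ "- 1"]) (simp add: power_divide)
  qed
qed

text \<open>The difference of the two solutions solves a linear equation whose potential is a
  divided difference, bounded below because both linearizations are. The constants depend on
  \<open>w\<close> only, which gives uniformity in the parameter and in the front.\<close>

lemma hastings_mcleod_comparison:
  assumes hm: "hastings_mcleod w"
  obtains C d0 :: real where "0 < d0"
    "\<And>(d :: real) W W' x. 0 < d \<Longrightarrow> d < d0 \<Longrightarrow> (\<And>x. (W has_real_derivative W' x) (at x)) \<Longrightarrow>
       (\<And>x. (W' has_real_derivative tanh (d * x) / d * W x + 2 * W x ^ 3) (at x)) \<Longrightarrow>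
       (\<And>x. 0 < W x) \<Longrightarrow> (\<And>x. W x \<le> 1 / sqrt d) \<Longrightarrow>
       ((\<lambda>x. (W x)\<^sup>2 / - (tanh (d * x) / d)) \<longlongrightarrow> 1 / 2) at_bot \<Longrightarrow>
       \<bar>x\<bar> \<le> 1 \<Longrightarrow> \<bar>W x - w x\<bar> \<le> C * sqrt d"
proof -
  obtain w' where w: "\<And>x. (w has_real_derivative w' x) (at x)"
    and w': "\<And>x. (w' has_real_derivative x * w x + 2 * w x ^ 3) (at x)"
    using hm by (auto simp: hastings_mcleod_def)
  have wpos: "0 < w x" for x using hm by (simp add: hastings_mcleod_def)
  have wmono: "antimono w" using hm by (simp add: hastings_mcleod_def)
  note wlim = hastings_mcleod_square_limit[OF hm]
  have wlow: "1 / 20 \<le> x + 6 * (w x)\<^sup>2" for x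
    using painleve_potential.linearized_potential_bound[OF painleve_potential_id w w' wpos wlim] by simp
  obtain X where X: "\<And>x. x \<le> X \<Longrightarrow> (w x)\<^sup>2 / - x < 1"
    using order_tendstoD(2)[OF wlim, of 1] by (auto simp: eventually_at_bot_linorder)
  \<comment> \<open>For \<open>M \<ge> M0\<close> the square of \<open>w (- M)\<close> is below
    \<open>M\<close>, hence below \<open>M\<^sup>2\<close>, and monotonicity carries the crude bound
    \<open>w \<le> M\<close> to everything right of \<open>- M\<close>.\<close>
  define M0 where "M0 = max 1 (- X)"
  have wM: "w x \<le> M" if "M0 \<le> M" "- M \<le> x" for x M
  proof -
    have M: "1 \<le> M" "- M \<le> X" using that by (auto simp: M0_def)
    have "(w (- M))\<^sup>2 < M" using X[OF M(2)] M(1) by (simp add: field_simps)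
    also have "M * 1 \<le> M * M" using M by (intro mult_left_mono) auto
    then have "M \<le> M\<^sup>2" by (simp add: power2_eq_square)
    finally have "(w (- M))\<^sup>2 < M\<^sup>2" .
    then have "w (- M) < M" by (rule power2_less_imp_less) (use M in simp)
    then show ?thesis using antimonoD[OF wmono that(2)] by simp
  qed
  \<comment> \<open>\<open>1 / 40\<close> is half of the margin \<open>1 / 20\<close>; the other
    half pays for replacing \<open>y\<close> by \<open>a y\<close> when the bound for
    \<open>w\<close> is the one used.\<close>
  define k where "k = sqrt (1 / 40)"
  have k: "0 < k" "k\<^sup>2 = 1 / 40" "k \<le> 1" by (auto simp: k_def)
  \<comment> \<open>\<open>40 * sqrt d\<close> dominates the forcing part
    \<open>(d / 3) / k\<^sup>2\<close>. In the boundary part \<open>256 = 4 ^ 4\<close> and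
    \<open>1600 = 1 / k ^ 4\<close> stem from
    \<open>(k * M / 4) ^ 4 \<le> exp (k * M)\<close>.\<close>
  define C :: real where "C = 40 + 4 * exp 1 * 256 * 1600"
  define d0 where "d0 = min (1 / 100) (1 / M0 ^ 4)"
  have "0 < d0" by (simp add: d0_def M0_def)
  moreover have "\<bar>W x - w x\<bar> \<le> C * sqrt d"
    if d: "0 < d" "d < d0" and W: "\<And>x. (W has_real_derivative W' x) (at x)"
      and W': "\<And>x. (W' has_real_derivative tanh (d * x) / d * W x + 2 * W x ^ 3) (at x)"
      and Wpos: "\<And>x. 0 < W x" and Wle: "\<And>x. W x \<le> 1 / sqrt d"
      and Wlim: "((\<lambda>x. (W x)\<^sup>2 / - (tanh (d * x) / d)) \<longlongrightarrow> 1 / 2) at_bot"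
      and x: "\<bar>x\<bar> \<le> 1" for d :: real and W W' x
  proof -
    have d1: "d < 1 / 100" "d < 1 / M0 ^ 4" using d(2) by (auto simp: d0_def)
    have "d * d \<le> 1 / 100 * (1 / 10)" using d d1 by (intro mult_mono) auto
    then have d2: "d\<^sup>2 \<le> 1 / 1000" by (simp add: power2_eq_square)
    define a where "a x = tanh (d * x) / d" for x
    have Wlow: "1 / 20 \<le> a x + 6 * (W x)\<^sup>2" for x
      unfolding a_def
      by (rule painleve_potential.linearized_potential_bound[OF painleve_potential_tanh[OF d(1) d2] W W' Wpos Wlim])
    \<comment> \<open>The forcing is the potential error \<open>d\<^sup>2 * M ^ 3 / 3\<close> times
      the bound \<open>M\<close> for \<open>w\<close>; the fourth root is what turns this into
      \<open>d / 3\<close>.\<close>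
    define M where "M = 1 / sqrt (sqrt d)"
    have sd: "0 < sqrt d" "sqrt d * sqrt d = d" using d(1) by auto
    have Mpos: "0 < M" using d(1) by (simp add: M_def)
    have M2: "M\<^sup>2 = 1 / sqrt d" using d(1) by (simp add: M_def power_divide)
    have M4: "M ^ 4 = 1 / d"
    proof -
      have "M ^ 4 = (M\<^sup>2)\<^sup>2" by (simp flip: power_mult)
      then show ?thesis using d(1) by (simp add: M2 power_divide)
    qed
    have M0M: "M0 \<le> M"
    proof -
      have "0 < M0" by (simp add: M0_def)
      have "M0 ^ 4 * d < 1" using d1 \<open>0 < M0\<close> by (simp add: field_simps)
      then have "M0 ^ 4 < M ^ 4" unfolding M4 using d(1) by (simp add: field_simps)
      then show ?thesis using Mpos power_less_imp_less_base[of M0 4 M] by simp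
    qed
    then have M1: "1 \<le> M" by (simp add: M0_def)
    have "M ^ 3 \<le> M ^ 4" using M1 by (intro power_increasing) auto
    then have "d\<^sup>2 * M ^ 3 \<le> d\<^sup>2 * M ^ 4" by (intro mult_left_mono) auto
    also have "\<dots> = d" using d(1) by (simp add: M4 power2_eq_square)
    finally have dM3: "d\<^sup>2 * M ^ 3 \<le> d" .
    have adiff: "\<bar>a y - y\<bar> \<le> d\<^sup>2 * M ^ 3 / 3" if "\<bar>y\<bar> \<le> M" for y
      unfolding a_def by (rule scaled_tanh_diff[OF d(1) that])
    define q where "q y = a y + 2 * ((W y)\<^sup>2 + W y * w y + (w y)\<^sup>2)" for y
    have q: "k\<^sup>2 \<le> q y" if "\<bar>y\<bar> \<le> M" for y
    proof -
      have "y - 1 / 40 \<le> a y" using adiff[OF that] dM3 d1 by linarith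
      \<comment> \<open>The mixed product is at least the smaller square. So, up to the change of
        \<open>a\<close>, \<open>q\<close> is bounded below by one of the two linearized
        potentials.\<close>
      moreover have "3 * (W y)\<^sup>2 \<le> (W y)\<^sup>2 + W y * w y + (w y)\<^sup>2 \<or> 3 * (w y)\<^sup>2 \<le> (W y)\<^sup>2 + W y * w y + (w y)\<^sup>2"
      proof (cases "W y \<le> w y")
        case True
        have "W y * W y \<le> W y * w y" "(W y)\<^sup>2 \<le> (w y)\<^sup>2"
          using True Wpos[of y] by (auto intro!: mult_left_mono power_mono less_imp_le)
        then show ?thesis by (simp add: power2_eq_square)
      next
        case False
        have "w y * w y \<le> W y * w y" "(w y)\<^sup>2 \<le> (W y)\<^sup>2"
          using False wpos[of y] by (auto intro!: mult_right_mono power_mono less_imp_le)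
        then show ?thesis by (simp add: power2_eq_square)
      qed
      ultimately show ?thesis using Wlow[of y] wlow[of y] unfolding q_def k(2)
        by (elim disjE) (simp_all add: algebra_simps)
    qed
    have "\<bar>W x - w x\<bar> \<le> (d\<^sup>2 * M ^ 3 / 3 * M) / k\<^sup>2
        + (2 * M\<^sup>2) * exp (- k * M) * (exp (k * x) + exp (- k * x))"
    proof (rule linear_interval_bound[where z = "\<lambda>x. W x - w x" and q = q and g = "\<lambda>x. (a x - x) * w x" and M = M])
      show "((\<lambda>x. W x - w x) has_real_derivative W' y - w' y) (at y)" for y
        by (intro DERIV_diff W w)
      show "((\<lambda>x. W' x - w' x) has_real_derivative
          (tanh (d * y) / d * W y + 2 * W y ^ 3) - (y * w y + 2 * w y ^ 3)) (at y)" for y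
        by (intro DERIV_diff W' w')
      show "(tanh (d * y) / d * W y + 2 * W y ^ 3) - (y * w y + 2 * w y ^ 3)
          = q y * (W y - w y) + (a y - y) * w y" for y
        unfolding q_def a_def by (simp add: algebra_simps diff_divide_distrib power2_eq_square power3_eq_cube)
      show "\<bar>(a y - y) * w y\<bar> \<le> d\<^sup>2 * M ^ 3 / 3 * M" if "\<bar>y\<bar> \<le> M" for y
        unfolding abs_mult using adiff[OF that] wM[OF M0M, of y] wpos[of y] that
        by (intro mult_mono) auto
      have "\<bar>W y - w y\<bar> \<le> 2 * M\<^sup>2" if "- M \<le> y" for y
      proof -
        have "M * 1 \<le> M * M" using M1 by (intro mult_left_mono) auto
        then have "w y \<le> M\<^sup>2" using wM[OF M0M that] by (simp add: power2_eq_square)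
        moreover have "W y \<le> M\<^sup>2" using Wle[of y] by (simp add: M2)
        ultimately show ?thesis using wpos[of y] Wpos[of y] by linarith
      qed
      then show "\<bar>W M - w M\<bar> \<le> 2 * M\<^sup>2" "\<bar>W (- M) - w (- M)\<bar> \<le> 2 * M\<^sup>2" using Mpos by auto
    qed (use k q x M1 in auto)
    also have "(d\<^sup>2 * M ^ 3 / 3 * M) / k\<^sup>2 \<le> 40 * sqrt d"
    proof -
      have "d\<^sup>2 * M ^ 3 * M = d\<^sup>2 * M ^ 4" by (simp add: power_def numeral_eq_Suc)
      also have "\<dots> = d" using d(1) by (simp add: M4 power2_eq_square)
      finally have e: "d\<^sup>2 * M ^ 3 / 3 * M = d / 3" by simp
      have "sqrt d * sqrt d \<le> sqrt d * 1" using d(1) d1 by (intro mult_left_mono) auto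
      then show ?thesis unfolding e k(2) using sd by simp
    qed
    also have "(2 * M\<^sup>2) * exp (- k * M) * (exp (k * x) + exp (- k * x)) \<le> 4 * exp 1 * 256 * 1600 * sqrt d"
    proof -
      have "\<bar>k * x\<bar> \<le> 1 * 1" unfolding abs_mult using k x by (intro mult_mono) auto
      then have e1: "exp (k * x) + exp (- k * x) \<le> 2 * exp 1"
      proof -
        have "exp (k * x) \<le> exp 1" "exp (- k * x) \<le> exp 1"
          using \<open>\<bar>k * x\<bar> \<le> 1 * 1\<close> by (auto simp: abs_le_iff)
        then show ?thesis by linarith
      qed
      \<comment> \<open>A fourth power suffices: \<open>M ^ 4 = 1 / d\<close>, and the boundary
        values \<open>2 * M\<^sup>2\<close> cost only a factor \<open>1 / sqrt d\<close>, so
        \<open>sqrt d\<close> remains.\<close>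
      have "k * M / 4 \<le> exp (k * M / 4)" using exp_ge_add_one_self[of "k * M / 4"] by linarith
      then have "(k * M / 4) ^ 4 \<le> exp (k * M / 4) ^ 4" using k Mpos by (intro power_mono) auto
      also have "\<dots> = exp (k * M)" by (simp flip: exp_of_nat_mult)
      also have "(k * M / 4) ^ 4 = (k\<^sup>2)\<^sup>2 * M ^ 4 / 256" by (simp add: power_mult_distrib power_divide flip: power_mult)
      finally have "M ^ 4 / (256 * 1600) \<le> exp (k * M)" unfolding k(2) by (simp add: power2_eq_square)
      then have "1 / exp (k * M) \<le> 1 / (M ^ 4 / (256 * 1600))"
        using Mpos by (intro divide_left_mono) auto
      then have e2: "exp (- k * M) \<le> 256 * 1600 * d" using d(1) by (simp add: M4 exp_minus field_simps)
      have "(2 * M\<^sup>2) * exp (- k * M) * (exp (k * x) + exp (- k * x)) \<le> (2 * M\<^sup>2) * (256 * 1600 * d) * (2 * exp 1)"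
        using e1 e2 d(1) by (intro mult_mono) auto
      also have "\<dots> = 4 * exp 1 * 256 * 1600 * (M\<^sup>2 * d)" by simp
      also have "M\<^sup>2 * d = sqrt d" unfolding M2 using sd by (simp add: field_simps)
      finally show ?thesis .
    qed
    finally show ?thesis by (simp add: C_def algebra_simps)
  qed
  ultimately show thesis using that by blast
qed

text \<open>Here \<open>h ^ 3\<close> is the original \<open>\<epsilon>\<close>. In the last claim
  \<open>h\<close> cancels from the prefactor: the quotient is
  \<open>u\<^sup>2 / (2 * - tanh)\<close>, and \<open>u\<close> tends to \<open>1\<close>.\<close>

lemma front_rescaling:
  assumes h: "0 < h"
    and u: "\<And>x. (u has_real_derivative u' x) (at x)"
    and u': "\<And>x. (u' has_real_derivative tanh (h ^ 3 * x) * u x + u x ^ 3) (at x)"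
    and lim: "(u \<longlongrightarrow> 1) at_bot"
  defines "W \<equiv> \<lambda>x. u (x / h) / (sqrt 2 * h)" and "W' \<equiv> \<lambda>x. u' (x / h) / (sqrt 2 * h\<^sup>2)"
  shows "(W has_real_derivative W' x) (at x)"
    "(W' has_real_derivative tanh (h\<^sup>2 * x) / h\<^sup>2 * W x + 2 * W x ^ 3) (at x)"
    "((\<lambda>x. (W x)\<^sup>2 / - (tanh (h\<^sup>2 * x) / h\<^sup>2)) \<longlongrightarrow> 1 / 2) at_bot"
proof -
  have du: "((\<lambda>x. u (x / h)) has_real_derivative u' (x / h) * (1 / h)) (at x)" for x
    using DERIV_cdivide[OF DERIV_ident, of h x UNIV] DERIV_chain2[where f = u and g = "\<lambda>x. x / h" and Db = "1 / h" and s = UNIV, OF u] by simp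
  have du': "((\<lambda>x. u' (x / h)) has_real_derivative (tanh (h ^ 3 * (x / h)) * u (x / h) + u (x / h) ^ 3) * (1 / h)) (at x)" for x
    using DERIV_cdivide[OF DERIV_ident, of h x UNIV] DERIV_chain2[where f = u' and g = "\<lambda>x. x / h" and Db = "1 / h" and s = UNIV, OF u'] by simp
  have e: "h ^ 3 * (x / h) = h\<^sup>2 * x" for x using h by (simp add: power2_eq_square power3_eq_cube)
  show "(W has_real_derivative W' x) (at x)"
    unfolding W_def W'_def using h DERIV_cdivide[OF du[of x], of "sqrt 2 * h"]
    by (simp add: power2_eq_square mult_ac)
  have s8: "sqrt 2 ^ 3 = 2 * sqrt 2" by (simp add: power3_eq_cube)
  have "(tanh (h\<^sup>2 * x) * u (x / h) + u (x / h) ^ 3) * (1 / h) / (sqrt 2 * h\<^sup>2)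
      = tanh (h\<^sup>2 * x) / h\<^sup>2 * W x + 2 * W x ^ 3"
  proof -
    define U where "U = u (x / h)"
    define T where "T = tanh (h\<^sup>2 * x)"
    have "(U / (sqrt 2 * h)) ^ 3 = U ^ 3 / (2 * sqrt 2 * h ^ 3)"
      by (simp add: power_divide power_mult_distrib s8)
    then have "T / h\<^sup>2 * (U / (sqrt 2 * h)) + 2 * (U / (sqrt 2 * h)) ^ 3 = (T * U + U ^ 3) * (1 / h) / (sqrt 2 * h\<^sup>2)"
      using h by (simp add: add_divide_distrib power2_eq_square power3_eq_cube mult_ac)
    then show ?thesis by (simp add: W_def U_def T_def)
  qed
  then show "(W' has_real_derivative tanh (h\<^sup>2 * x) / h\<^sup>2 * W x + 2 * W x ^ 3) (at x)"
    unfolding W'_def using DERIV_cdivide[OF du'[of x], of "sqrt 2 * h\<^sup>2"] by (simp only: e)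
  have f1: "filterlim (\<lambda>x. x / h) at_bot at_bot"
    using filterlim_tendsto_pos_mult_at_bot[OF tendsto_const[of "1 / h"] _ filterlim_ident] h by simp
  have f2: "filterlim (\<lambda>x. h\<^sup>2 * x) at_bot at_bot"
    using filterlim_tendsto_pos_mult_at_bot[OF tendsto_const[of "h\<^sup>2"] _ filterlim_ident] h by simp
  have "((\<lambda>x. (u (x / h))\<^sup>2 / (2 * - tanh (h\<^sup>2 * x))) \<longlongrightarrow> 1\<^sup>2 / (2 * - (- 1))) at_bot"
    by (rule tendsto_divide[OF tendsto_power[OF filterlim_compose[OF lim f1]]
          tendsto_mult[OF tendsto_const tendsto_minus[OF filterlim_compose[OF tanh_real_at_bot f2]]]]) simp
  moreover have "(W x)\<^sup>2 / - (tanh (h\<^sup>2 * x) / h\<^sup>2) = (u (x / h))\<^sup>2 / (2 * - tanh (h\<^sup>2 * x))" for x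
    unfolding W_def using h by (simp add: power_divide power_mult_distrib)
  ultimately show "((\<lambda>x. (W x)\<^sup>2 / - (tanh (h\<^sup>2 * x) / h\<^sup>2)) \<longlongrightarrow> 1 / 2) at_bot" by simp
qed

section \<open>Perturbations of a front\<close>

text \<open>Only one-sided inequalities on \<open>Z\<close> are assumed, so that the bound also
  covers nonlinear equations such as the one with a cutoff.\<close>

lemma whole_line_bound:
  fixes z z' Z :: "real \<Rightarrow> real"
  assumes z: "\<And>x. (z has_real_derivative z' x) (at x)"
    and z': "\<And>x. (z' has_real_derivative Z x) (at x)"
    and bd: "bounded (range z)" and k: "0 < k" and G: "0 \<le> G"
    and up: "\<And>x. 0 < z x \<Longrightarrow> k * z x - G \<le> Z x"
    and lo: "\<And>x. z x < 0 \<Longrightarrow> Z x \<le> k * z x + G"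
  shows "\<bar>z x\<bar> \<le> G / k"
proof -
  obtain B where B: "\<And>x. \<bar>z x\<bar> \<le> B" using bd by (auto simp: bounded_iff)
  have G0: "0 \<le> G / k" "k * (G / k) = G" using G k by auto
  have main: "s * z x - G / k \<le> 0" if s: "s = 1 \<or> s = - 1" for s :: real
  proof (rule maximum_principle[of UNIV "\<lambda>x. s * z x - G / k" k B "\<lambda>x. s * Z x" "\<lambda>x. s * z' x"])
    show "continuous_on UNIV (\<lambda>x. s * z x - G / k)"
      using z by (intro continuous_intros) (auto intro: DERIV_continuous_on DERIV_subset)
    show "s * z y - G / k \<le> B" for y using B[of y] s G0 by auto
    show "y \<in> interior UNIV \<and> k * (s * z y - G / k) \<le> s * Z y" if "0 < s * z y - G / k" for y
    proof -
      have "0 < s * z y" using that G0 by linarith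
      then have "k * (s * z y) - G \<le> s * Z y" using s up[of y] lo[of y] by auto
      then show ?thesis using G0 by (simp add: right_diff_distrib)
    qed
  qed (use k in \<open>auto intro!: derivative_eq_intros z z'\<close>)
  show ?thesis using main[of 1] main[of "- 1"] by (auto simp: abs_le_iff)
qed

lemma whole_line_linear_bound:
  fixes z z' Z q g :: "real \<Rightarrow> real"
  assumes z: "\<And>x. (z has_real_derivative z' x) (at x)"
    and z': "\<And>x. (z' has_real_derivative Z x) (at x)"
    and bd: "bounded (range z)" and k: "0 < k"
    and eq: "\<And>x. Z x = q x * z x + g x"
    and q: "\<And>x. k \<le> q x" "\<And>x. q x \<le> B" and g: "\<And>x. \<bar>g x\<bar> \<le> G"
  shows "\<bar>z x\<bar> \<le> G / k" "\<bar>z' x\<bar> \<le> (2 + B) * (G / k) + G"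
proof -
  have G: "0 \<le> G" using g[of 0] by linarith
  have zb: "\<bar>z x\<bar> \<le> G / k" for x
  proof (rule whole_line_bound[OF z z' bd k G])
    fix x
    show "k * z x - G \<le> Z x" if "0 < z x"
      using mult_right_mono[OF q(1), of "z x" x] that g[of x] unfolding eq by linarith
    show "Z x \<le> k * z x + G" if "z x < 0"
      using mult_right_mono_neg[OF q(1), of "z x" x] that g[of x] unfolding eq by linarith
  qed
  then show "\<bar>z x\<bar> \<le> G / k" .
  have "\<bar>z' x\<bar> \<le> 2 * (G / k) + (B * (G / k) + G)"
  proof (rule deriv_bound_of_bounds[OF z z'])
    fix y
    have "\<bar>q y * z y\<bar> \<le> B * (G / k)"
      unfolding abs_mult using q[of y] k zb[of y] by (intro mult_mono) auto
    then show "\<bar>Z y\<bar> \<le> B * (G / k) + G" unfolding eq using g[of y] by linarith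
  qed (use zb in auto)
  then show "\<bar>z' x\<bar> \<le> (2 + B) * (G / k) + G" by (simp add: algebra_simps)
qed

text \<open>This is the divided difference of \<open>3 * c * z\<^sup>2 + z ^ 3\<close>; counted with
  multiplicity it has nine terms of size \<open>r\<close>. For \<open>r = m / 18\<close> the bound
  is \<open>m / 2\<close>, half of the linear margin.\<close>

lemma cubic_factor_bound:
  fixes a b c r :: real
  assumes "\<bar>a\<bar> \<le> r" "\<bar>b\<bar> \<le> r" "r \<le> 1" "0 \<le> c" "c \<le> 1"
  shows "\<bar>3 * c * (a + b) + a\<^sup>2 + a * b + b\<^sup>2\<bar> \<le> 9 * r"
proof -
  have p: "\<bar>x * y\<bar> \<le> r" if "\<bar>x\<bar> \<le> r" "\<bar>y\<bar> \<le> 1" for x y :: real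
  proof -
    have "\<bar>x\<bar> * \<bar>y\<bar> \<le> r * 1" using that by (intro mult_mono) auto
    then show ?thesis by (simp add: abs_mult)
  qed
  have one: "\<bar>c\<bar> \<le> 1" "\<bar>a\<bar> \<le> 1" "\<bar>b\<bar> \<le> 1" using assms by auto
  note p[OF assms(1) one(1)] p[OF assms(2) one(1)] p[OF assms(1) one(2)] p[OF assms(1) one(3)] p[OF assms(2) one(3)]
  moreover have "3 * c * (a + b) + a\<^sup>2 + a * b + b\<^sup>2 = 3 * (a * c) + 3 * (b * c) + a * a + a * b + b * b"
    by (simp add: power2_eq_square algebra_simps)
  ultimately show ?thesis by linarith
qed

section \<open>Responses of a front to small forcings\<close>

locale front =
  fixes \<epsilon> m :: real and u u' :: "real \<Rightarrow> real"
  assumes eps_pos: "0 < \<epsilon>" and m_pos: "0 < m"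
    and u_deriv: "\<And>x. (u has_real_derivative u' x) (at x)"
    and u'_deriv: "\<And>x. (u' has_real_derivative tanh (\<epsilon> * x) * u x + u x ^ 3) (at x)"
    and u_bounds: "\<And>x. 0 < u x" "\<And>x. u x \<le> 1"
    and u_lims: "(u \<longlongrightarrow> 1) at_bot" "(u \<longlongrightarrow> 0) at_top" "(u' \<longlongrightarrow> 0) at_bot" "(u' \<longlongrightarrow> 0) at_top"
    and m_le: "\<And>x. m \<le> tanh (\<epsilon> * x) + 3 * (u x)\<^sup>2"
begin

text \<open>The potential of the linearized equation: the derivative of
  \<open>tanh (\<epsilon> * x) * u + u ^ 3\<close> in the state, taken along the front.\<close>

definition p :: "real \<Rightarrow> real" where "p x = tanh (\<epsilon> * x) + 3 * (u x)\<^sup>2"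

lemma p_bounds: "m \<le> p x" "p x \<le> 4"
proof -
  show "m \<le> p x" using m_le by (simp add: p_def)
  have "(u x)\<^sup>2 \<le> 1" using u_bounds[of x] by (simp add: power_le_one)
  then show "p x \<le> 4" using tanh_real_lt_1[of "\<epsilon> * x"] by (simp add: p_def)
qed

lemma m_le_4: "m \<le> 4" using p_bounds[of 0] by linarith

lemma u_continuous: "continuous_on S u"
  using u_deriv by (meson DERIV_continuous continuous_at_imp_continuous_on)

lemma p_continuous: "continuous_on S p"
  unfolding p_def[abs_def] by (intro continuous_intros u_continuous) auto

text \<open>This potential times \<open>w\<close> is the exact increment of the reaction from
  \<open>u x\<close> to \<open>u x + w\<close>. So a small nonlinear perturbation also solves a
  linear equation with a positive potential.\<close>

lemma perturbed_potential_bounds: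
  assumes "\<bar>w\<bar> \<le> m / 18"
  shows "m / 2 \<le> p x + (3 * u x * w + w\<^sup>2)" "p x + (3 * u x * w + w\<^sup>2) \<le> 9"
proof -
  have "\<bar>3 * u x * (w + 0) + w\<^sup>2 + w * 0 + 0\<^sup>2\<bar> \<le> 9 * (m / 18)"
    using assms u_bounds[of x] m_le_4 m_pos by (intro cubic_factor_bound) auto
  then have "\<bar>3 * u x * w + w\<^sup>2\<bar> \<le> m / 2" by simp
  then show "m / 2 \<le> p x + (3 * u x * w + w\<^sup>2)" "p x + (3 * u x * w + w\<^sup>2) \<le> 9"
    using p_bounds[of x] m_le_4 by linarith+
qed

text \<open>\<open>1 + 22 / m\<close> is \<open>(2 + 9) / (m / 2) + 1\<close>, the factor in the
  slope bound; it also dominates the factor for the value, so one constant serves both.\<close>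

lemma linear_response_bound:
  fixes z z' Z q g :: "real \<Rightarrow> real"
  assumes z: "\<And>x. (z has_real_derivative z' x) (at x)"
    and z': "\<And>x. (z' has_real_derivative Z x) (at x)"
    and bd: "bounded (range z)"
    and eq: "\<And>x. Z x = q x * z x + g x"
    and q: "\<And>x. m / 2 \<le> q x" "\<And>x. q x \<le> 9" and g: "\<And>x. \<bar>g x\<bar> \<le> G"
  shows "\<bar>z x\<bar> \<le> (1 + 22 / m) * G" "\<bar>z' x\<bar> \<le> (1 + 22 / m) * G"
proof -
  have G: "0 \<le> G" using g[of 0] by linarith
  have k: "0 < m / 2" using m_pos by simp
  note b = whole_line_linear_bound[OF z z' bd k eq q g, of x]
  have e: "(2 + 9) * (G / (m / 2)) + G = (1 + 22 / m) * G" by (simp add: algebra_simps)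
  show "\<bar>z' x\<bar> \<le> (1 + 22 / m) * G" using b(2) unfolding e .
  have "0 \<le> G / (m / 2)" using G m_pos by simp
  moreover have "x \<le> (2 + 9) * x + G" if "0 \<le> x" for x using that G by simp
  ultimately have "G / (m / 2) \<le> (2 + 9) * (G / (m / 2)) + G" by blast
  then show "\<bar>z x\<bar> \<le> (1 + 22 / m) * G" using b(1) unfolding e by linarith
qed

text \<open>A forcing supported away from a half-line produces a one-parameter family of solutions of
  the unforced equation on that half-line. Outside the range \<open>\<bar>z\<bar> \<le> m / 18\<close> the nonlinearity
  is cut off, so that it becomes globally monotone; the a priori bound shows that the cutoff is
  inactive.\<close>

lemma forced_solution_exists:
  assumes \<phi>: "continuous_on UNIV \<phi>" "\<And>x. \<bar>\<phi> x\<bar> \<le> 1" and s: "\<bar>s\<bar> \<le> m\<^sup>2 / 36"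
  obtains z z' where "\<And>x. (z has_real_derivative z' x) (at x)"
    "\<And>x. (z' has_real_derivative p x * z x + 3 * u x * (z x)\<^sup>2 + z x ^ 3 + s * \<phi> x) (at x)"
    "\<And>x. \<bar>z x\<bar> \<le> m / 18"
proof -
  define r where "r = m / 18"
  have r: "0 < r" "r \<le> 1" "9 * r = m / 2" using m_pos m_le_4 by (auto simp: r_def)
  define clip where "clip z = max (- r) (min r z)" for z
  define h where "h x z = p x * z + (3 * u x * (clip z)\<^sup>2 + clip z ^ 3) + s * \<phi> x" for x z
  have clip: "\<bar>clip z\<bar> \<le> r" for z using r by (auto simp: clip_def)
  have mono: "m / 2 * (z - w) \<le> h x z - h x w \<and> h x z - h x w \<le> 3\<^sup>2 * (z - w)" if "w \<le> z" for x z w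
  proof -
    define a where "a = clip z"
    define b where "b = clip w"
    have ab: "b \<le> a" "a - b \<le> z - w" using that by (auto simp: a_def b_def clip_def)
    have "\<bar>3 * u x * (a + b) + a\<^sup>2 + a * b + b\<^sup>2\<bar> \<le> 9 * r"
      using clip u_bounds[of x] r by (intro cubic_factor_bound) (auto simp: a_def b_def)
    then have "\<bar>3 * u x * (a + b) + a\<^sup>2 + a * b + b\<^sup>2\<bar> * \<bar>a - b\<bar> \<le> (m / 2) * (z - w)"
      using ab r by (intro mult_mono) auto
    moreover have "(3 * u x * (a + b) + a\<^sup>2 + a * b + b\<^sup>2) * (a - b)
        = (3 * u x * a\<^sup>2 + a ^ 3) - (3 * u x * b\<^sup>2 + b ^ 3)"
      by (simp add: algebra_simps power2_eq_square power3_eq_cube)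
    ultimately have "\<bar>(3 * u x * a\<^sup>2 + a ^ 3) - (3 * u x * b\<^sup>2 + b ^ 3)\<bar> \<le> m / 2 * (z - w)"
      by (simp flip: abs_mult)
    moreover have "m * (z - w) \<le> p x * (z - w)"
      by (rule mult_right_mono[OF p_bounds(1)]) (use that in simp)
    moreover have "p x * (z - w) \<le> 4 * (z - w)"
      by (rule mult_right_mono[OF p_bounds(2)]) (use that in simp)
    moreover have "m / 2 * (z - w) \<le> 2 * (z - w)"
      by (rule mult_right_mono) (use that m_le_4 in simp_all)
    moreover have "h x z - h x w = p x * (z - w) + ((3 * u x * a\<^sup>2 + a ^ 3) - (3 * u x * b\<^sup>2 + b ^ 3))"
      by (simp add: h_def a_def b_def algebra_simps)
    ultimately show ?thesis by (simp add: abs_le_iff) argo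
  qed
  have h0: "h x 0 = s * \<phi> x" for x using r by (simp add: h_def clip_def)
  have "continuous_on UNIV (\<lambda>(x, z). h x z)"
    unfolding h_def clip_def split_beta
    by (intro continuous_intros continuous_on_compose2[OF p_continuous] continuous_on_compose2[OF u_continuous]
        continuous_on_compose2[OF \<phi>(1)]) auto
  moreover have sX: "\<bar>s * \<phi> x\<bar> \<le> \<bar>s\<bar>" for x
    using mult_left_mono[OF \<phi>(2), of "\<bar>s\<bar>" x] by (simp add: abs_mult)
  ultimately obtain z z' where z: "\<And>x. (z has_real_derivative z' x) (at x)"
    and z': "\<And>x. (z' has_real_derivative h x (z x)) (at x)" and bd: "bounded (range z)"
    using bounded_solution_exists[of 3 "m / 2" h "\<bar>s\<bar>"] m_pos mono h0 by auto
  have zr: "\<bar>z x\<bar> \<le> r" for x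
  proof -
    \<comment> \<open>The reaction with the cutoff has slope at least \<open>m / 2\<close>. The
      range of \<open>s\<close> is \<open>m\<^sup>2 / 36 = (m / 2) * (m / 18)\<close>, chosen so
      that the solution stays inside the cutoff.\<close>
    have "\<bar>z x\<bar> \<le> \<bar>s\<bar> / (m / 2)"
    proof (rule whole_line_bound[OF z z' bd])
      show "m / 2 * z x - \<bar>s\<bar> \<le> h x (z x)" if "0 < z x" for x
        using mono[of 0 "z x" x] that sX[of x] by (simp add: h0 abs_le_iff)
      show "h x (z x) \<le> m / 2 * z x + \<bar>s\<bar>" if "z x < 0" for x
        using mono[of "z x" 0 x] that sX[of x] by (simp add: h0 abs_le_iff)
    qed (use m_pos in auto)
    also have "\<dots> \<le> (m\<^sup>2 / 36) / (m / 2)" using s m_pos by (intro divide_right_mono) auto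
    also have "\<dots> = r" using m_pos by (simp add: r_def power2_eq_square)
    finally show ?thesis .
  qed
  have "clip (z x) = z x" for x using zr[of x] by (auto simp: clip_def)
  then have "(z' has_real_derivative p x * z x + 3 * u x * (z x)\<^sup>2 + z x ^ 3 + s * \<phi> x) (at x)" for x
    using z'[of x] by (simp add: h_def algebra_simps)
  then show thesis using that[OF z] zr by (simp add: r_def)
qed

text \<open>\<open>y\<close> is to be the derivative of \<open>z\<close> with respect to the size of
  the forcing; the potential is therefore linearized at \<open>u + z\<close> and not at
  \<open>u\<close>.\<close>

lemma variational_solution_exists:
  assumes \<phi>: "continuous_on UNIV \<phi>" "\<And>x. \<bar>\<phi> x\<bar> \<le> 1"
    and z: "continuous_on UNIV z" "\<And>x. \<bar>z x\<bar> \<le> m / 18"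
  obtains y y' where "\<And>x. (y has_real_derivative y' x) (at x)"
    "\<And>x. (y' has_real_derivative (p x + 6 * u x * z x + 3 * (z x)\<^sup>2) * y x + \<phi> x) (at x)"
    "bounded (range y)"
proof -
  define q where "q x = p x + 6 * u x * z x + 3 * (z x)\<^sup>2" for x
  have q: "m / 2 \<le> q x" "q x \<le> 9" for x
  proof -
    have "\<bar>3 * u x * (z x + z x) + (z x)\<^sup>2 + z x * z x + (z x)\<^sup>2\<bar> \<le> 9 * (m / 18)"
      using z(2)[of x] u_bounds[of x] m_le_4 by (intro cubic_factor_bound) auto
    moreover have "q x = p x + (3 * u x * (z x + z x) + (z x)\<^sup>2 + z x * z x + (z x)\<^sup>2)"
      by (simp add: q_def power2_eq_square)
    ultimately show "m / 2 \<le> q x" "q x \<le> 9" using p_bounds[of x] m_le_4 by linarith+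
  qed
  have "continuous_on UNIV q"
    unfolding q_def[abs_def] by (intro continuous_intros p_continuous u_continuous z)
  moreover have "continuous_on UNIV (\<lambda>w::real \<times> real. f (fst w))" if "continuous_on UNIV f" for f :: "real \<Rightarrow> real"
    by (rule continuous_on_compose2[OF that]) (auto intro: continuous_intros)
  ultimately have "continuous_on UNIV (\<lambda>w::real \<times> real. q (fst w))" "continuous_on UNIV (\<lambda>w::real \<times> real. \<phi> (fst w))"
    using \<phi>(1) by blast+
  then have c: "continuous_on UNIV (\<lambda>(x, y). q x * y + \<phi> x)"
    unfolding split_beta by (intro continuous_on_add continuous_on_mult continuous_on_snd continuous_on_id)
  obtain y y' where y: "\<And>x. (y has_real_derivative y' x) (at x)"
    "\<And>x. (y' has_real_derivative q x * y x + \<phi> x) (at x)" "bounded (range y)"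
  proof (rule bounded_solution_exists[of 3 "m / 2" "\<lambda>x y. q x * y + \<phi> x" 1])
    show "continuous_on UNIV (\<lambda>(x, y). q x * y + \<phi> x)" by (rule c)
    show "\<bar>q x * 0 + \<phi> x\<bar> \<le> 1" for x using \<phi>(2) by simp
    show "m / 2 * (a - b) \<le> q x * a + \<phi> x - (q x * b + \<phi> x) \<and> q x * a + \<phi> x - (q x * b + \<phi> x) \<le> 3\<^sup>2 * (a - b)"
      if "b \<le> a" for x a b
      using mult_right_mono[OF q(1), of "a - b" x] mult_right_mono[OF q(2), of "a - b" x] that
      by (simp add: right_diff_distrib)
  qed (use m_pos in simp, use m_pos in simp, blast)
  show thesis by (rule that[OF y(1) y(2)[unfolded q_def] y(3)])
qed

text \<open>Differentiable dependence on \<open>s\<close> follows from a priori bounds: differences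
  of solutions, first-order remainders and differences of derivatives all solve linear equations,
  and \<open>linear_response_bound\<close> converts the size of the forcing into the size of the
  solution.\<close>

lemma perturbed_family:
  assumes \<phi>: "continuous_on UNIV \<phi>" "\<And>x. \<bar>\<phi> x\<bar> \<le> 1"
  obtains s0 C z z' y y' where "0 < s0"
    "\<And>s x. \<bar>s\<bar> \<le> s0 \<Longrightarrow> (z s has_real_derivative z' s x) (at x)"
    "\<And>s x. \<bar>s\<bar> \<le> s0 \<Longrightarrow> (z' s has_real_derivative p x * z s x + 3 * u x * (z s x)\<^sup>2 + z s x ^ 3 + s * \<phi> x) (at x)"
    "\<And>s x. \<bar>s\<bar> \<le> s0 \<Longrightarrow> \<bar>z s x\<bar> \<le> m / 18"
    "\<And>x. z 0 x = 0" "\<And>x. z' 0 x = 0"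
    "\<And>x. (y 0 has_real_derivative y' 0 x) (at x)"
    "\<And>x. (y' 0 has_real_derivative p x * y 0 x + \<phi> x) (at x)"
    "\<And>x. \<bar>y 0 x\<bar> \<le> C"
    "\<And>s t x. \<bar>s\<bar> \<le> s0 \<Longrightarrow> \<bar>t\<bar> \<le> s0 \<Longrightarrow> \<bar>z s x - z t x - (s - t) * y t x\<bar> \<le> C * (s - t)\<^sup>2"
    "\<And>s t x. \<bar>s\<bar> \<le> s0 \<Longrightarrow> \<bar>t\<bar> \<le> s0 \<Longrightarrow> \<bar>z' s x - z' t x - (s - t) * y' t x\<bar> \<le> C * (s - t)\<^sup>2"
    "\<And>s t x w. \<bar>s\<bar> \<le> s0 \<Longrightarrow> \<bar>t\<bar> \<le> s0 \<Longrightarrow> \<bar>y s x - y t w\<bar> \<le> C * (\<bar>s - t\<bar> + \<bar>x - w\<bar>)"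
    "\<And>s t x w. \<bar>s\<bar> \<le> s0 \<Longrightarrow> \<bar>t\<bar> \<le> s0 \<Longrightarrow> \<bar>y' s x - y' t w\<bar> \<le> C * (\<bar>s - t\<bar> + \<bar>x - w\<bar>)"
proof -
  define s0 where "s0 = m\<^sup>2 / 36"
  have "0 < s0" using m_pos by (simp add: s0_def)
  define K where "K = 1 + 22 / m"
  have K: "1 \<le> K" using m_pos by (simp add: K_def)
  have "\<forall>s. \<exists>z z'. \<bar>s\<bar> \<le> s0 \<longrightarrow> (\<forall>x. (z has_real_derivative z' x) (at x)) \<and>
     (\<forall>x. (z' has_real_derivative p x * z x + 3 * u x * (z x)\<^sup>2 + z x ^ 3 + s * \<phi> x) (at x)) \<and>
     (\<forall>x. \<bar>z x\<bar> \<le> m / 18)"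
    using forced_solution_exists[OF \<phi>] unfolding s0_def by metis
  then obtain z z' where zz: "\<And>s. \<bar>s\<bar> \<le> s0 \<Longrightarrow> (\<forall>x. (z s has_real_derivative z' s x) (at x)) \<and>
     (\<forall>x. (z' s has_real_derivative p x * z s x + 3 * u x * (z s x)\<^sup>2 + z s x ^ 3 + s * \<phi> x) (at x)) \<and>
     (\<forall>x. \<bar>z s x\<bar> \<le> m / 18)"
    by metis
  have z: "(z s has_real_derivative z' s x) (at x)"
    and z': "(z' s has_real_derivative p x * z s x + 3 * u x * (z s x)\<^sup>2 + z s x ^ 3 + s * \<phi> x) (at x)"
    and zr: "\<bar>z s x\<bar> \<le> m / 18" if "\<bar>s\<bar> \<le> s0" for s x
    using zz[OF that] by auto
  have zc: "continuous_on UNIV (z s)" if "\<bar>s\<bar> \<le> s0" for s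
    using z[OF that] by (meson DERIV_continuous continuous_at_imp_continuous_on)
  have "\<forall>s. \<exists>y y'. \<bar>s\<bar> \<le> s0 \<longrightarrow> (\<forall>x. (y has_real_derivative y' x) (at x)) \<and>
     (\<forall>x. (y' has_real_derivative (p x + 6 * u x * z s x + 3 * (z s x)\<^sup>2) * y x + \<phi> x) (at x)) \<and>
     bounded (range y)"
    using variational_solution_exists[OF \<phi> zc zr] by metis
  then obtain y y' where yy: "\<And>s. \<bar>s\<bar> \<le> s0 \<Longrightarrow> (\<forall>x. (y s has_real_derivative y' s x) (at x)) \<and>
     (\<forall>x. (y' s has_real_derivative (p x + 6 * u x * z s x + 3 * (z s x)\<^sup>2) * y s x + \<phi> x) (at x)) \<and>
     bounded (range (y s))"
    by metis
  have y: "(y s has_real_derivative y' s x) (at x)"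
    and y': "(y' s has_real_derivative (p x + 6 * u x * z s x + 3 * (z s x)\<^sup>2) * y s x + \<phi> x) (at x)"
    and ybd: "bounded (range (y s))" if "\<bar>s\<bar> \<le> s0" for s x
    using yy[OF that] by auto
  have zbd: "bounded (range (z s))" if "\<bar>s\<bar> \<le> s0" for s
    unfolding bounded_iff using zr[OF that] by (auto intro!: exI[of _ "m / 18"])
  \<comment> \<open>The divided difference of the reaction between \<open>z s\<close> and
    \<open>z t\<close>; on the diagonal it is the variational potential.\<close>
  define q where "q s t x = p x + (3 * u x * (z s x + z t x) + (z s x)\<^sup>2 + z s x * z t x + (z t x)\<^sup>2)" for s t x
  have q: "m / 2 \<le> q s t x" "q s t x \<le> 9" if "\<bar>s\<bar> \<le> s0" "\<bar>t\<bar> \<le> s0" for s t x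
  proof -
    have "\<bar>3 * u x * (z s x + z t x) + (z s x)\<^sup>2 + z s x * z t x + (z t x)\<^sup>2\<bar> \<le> 9 * (m / 18)"
      using zr that u_bounds[of x] m_le_4 by (intro cubic_factor_bound) auto
    then show "m / 2 \<le> q s t x" "q s t x \<le> 9" using p_bounds[of x] m_le_4 unfolding q_def by linarith+
  qed
  have qq: "p x + 6 * u x * z s x + 3 * (z s x)\<^sup>2 = q s s x" for s x
    by (simp add: q_def power2_eq_square)
  have bd_diff: "bounded (range (\<lambda>x. f x - c * g x))" if fg: "bounded (range f)" "bounded (range g)"
    for f g :: "real \<Rightarrow> real" and c
  proof -
    obtain A where A: "\<And>x. \<bar>f x\<bar> \<le> A" using fg(1) by (auto simp: bounded_iff)
    obtain B where B: "\<And>x. \<bar>g x\<bar> \<le> B" using fg(2) by (auto simp: bounded_iff)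
    have "\<bar>f x - c * g x\<bar> \<le> A + \<bar>c\<bar> * B" for x
      using abs_triangle_ineq4[of "f x" "c * g x"] mult_left_mono[OF B[of x], of "\<bar>c\<bar>"] A[of x]
      unfolding abs_mult by simp
    then show ?thesis unfolding bounded_iff by (auto intro!: exI[of _ "A + \<bar>c\<bar> * B"])
  qed
  have D: "\<bar>z s x - z t x\<bar> \<le> K * \<bar>s - t\<bar>" "\<bar>z' s x - z' t x\<bar> \<le> K * \<bar>s - t\<bar>"
    if st: "\<bar>s\<bar> \<le> s0" "\<bar>t\<bar> \<le> s0" for s t x
  proof -
    have 1: "((\<lambda>x. z s x - z t x) has_real_derivative z' s x - z' t x) (at x)" for x
      by (intro DERIV_diff z st)
    have 2: "((\<lambda>x. z' s x - z' t x) has_real_derivative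
      (p x * z s x + 3 * u x * (z s x)\<^sup>2 + z s x ^ 3 + s * \<phi> x) - (p x * z t x + 3 * u x * (z t x)\<^sup>2 + z t x ^ 3 + t * \<phi> x)) (at x)" for x
      by (intro DERIV_diff z' st)
    have 3: "bounded (range (\<lambda>x. z s x - z t x))" using bd_diff[OF zbd[OF st(1)] zbd[OF st(2)], of 1] by simp
    have 4: "(p x * z s x + 3 * u x * (z s x)\<^sup>2 + z s x ^ 3 + s * \<phi> x) - (p x * z t x + 3 * u x * (z t x)\<^sup>2 + z t x ^ 3 + t * \<phi> x)
       = q s t x * (z s x - z t x) + (s - t) * \<phi> x" for x
      by (simp add: q_def algebra_simps power2_eq_square power3_eq_cube)
    have 5: "\<bar>(s - t) * \<phi> x\<bar> \<le> \<bar>s - t\<bar>" for x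
      using mult_left_mono[OF \<phi>(2), of "\<bar>s - t\<bar>" x] by (simp add: abs_mult)
    show "\<bar>z s x - z t x\<bar> \<le> K * \<bar>s - t\<bar>" "\<bar>z' s x - z' t x\<bar> \<le> K * \<bar>s - t\<bar>"
      unfolding K_def using linear_response_bound[OF 1 2 3 4 q[OF st] 5] by blast+
  qed
  have Y: "\<bar>y s x\<bar> \<le> K" "\<bar>y' s x\<bar> \<le> K" if s: "\<bar>s\<bar> \<le> s0" for s x
    using linear_response_bound[OF y[OF s] y'[OF s] ybd[OF s] _ q[OF s s] \<phi>(2)] by (auto simp: K_def qq)
  have zle1: "\<bar>z s x\<bar> \<le> 1" if "\<bar>s\<bar> \<le> s0" for s x using zr[OF that, of x] m_le_4 by simp
  have E: "\<bar>z s x - z t x - (s - t) * y t x\<bar> \<le> K * (6 * K\<^sup>2 * (s - t)\<^sup>2)"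
    "\<bar>z' s x - z' t x - (s - t) * y' t x\<bar> \<le> K * (6 * K\<^sup>2 * (s - t)\<^sup>2)"
    if st: "\<bar>s\<bar> \<le> s0" "\<bar>t\<bar> \<le> s0" for s t x
  proof -
    have 1: "((\<lambda>x. z s x - z t x - (s - t) * y t x) has_real_derivative z' s x - z' t x - (s - t) * y' t x) (at x)" for x
      by (intro DERIV_diff DERIV_cmult z y st)
    have 2: "((\<lambda>x. z' s x - z' t x - (s - t) * y' t x) has_real_derivative
      (p x * z s x + 3 * u x * (z s x)\<^sup>2 + z s x ^ 3 + s * \<phi> x) - (p x * z t x + 3 * u x * (z t x)\<^sup>2 + z t x ^ 3 + t * \<phi> x)
        - (s - t) * ((p x + 6 * u x * z t x + 3 * (z t x)\<^sup>2) * y t x + \<phi> x)) (at x)" for x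
      by (intro DERIV_diff DERIV_cmult z' y' st)
    have 3: "bounded (range (\<lambda>x. z s x - z t x - (s - t) * y t x))"
      using bd_diff[OF bd_diff[OF zbd[OF st(1)] zbd[OF st(2)], of 1] ybd[OF st(2)], of "s - t"] by simp
    \<comment> \<open>The forcing of the remainder equation has the factors \<open>s - t\<close> and
      \<open>z s x - z t x\<close>, the latter already of order \<open>s - t\<close> by
      \<open>D\<close>; hence the remainder is quadratic.\<close>
    have 4: "(p x * z s x + 3 * u x * (z s x)\<^sup>2 + z s x ^ 3 + s * \<phi> x) - (p x * z t x + 3 * u x * (z t x)\<^sup>2 + z t x ^ 3 + t * \<phi> x)
        - (s - t) * ((p x + 6 * u x * z t x + 3 * (z t x)\<^sup>2) * y t x + \<phi> x)
       = q s t x * (z s x - z t x - (s - t) * y t x) + (s - t) * ((z s x - z t x) * (3 * u x + z s x + 2 * z t x) * y t x)" for x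
      by (simp add: q_def algebra_simps power2_eq_square power3_eq_cube)
    have 5: "\<bar>(s - t) * ((z s x - z t x) * (3 * u x + z s x + 2 * z t x) * y t x)\<bar> \<le> 6 * K\<^sup>2 * (s - t)\<^sup>2" for x
    proof -
      have "\<bar>3 * u x + z s x + 2 * z t x\<bar> \<le> 6"
        using zle1[OF st(1), of x] zle1[OF st(2), of x] u_bounds[of x] by (auto simp: abs_le_iff)
      then have "\<bar>s - t\<bar> * (\<bar>z s x - z t x\<bar> * \<bar>3 * u x + z s x + 2 * z t x\<bar> * \<bar>y t x\<bar>) \<le> \<bar>s - t\<bar> * (K * \<bar>s - t\<bar> * 6 * K)"
        using D[OF st] Y[OF st(2)] K by (intro mult_left_mono mult_mono) auto
      also have "\<dots> = 6 * K\<^sup>2 * (s - t)\<^sup>2" by (simp add: power2_eq_square)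
      finally show ?thesis by (simp add: abs_mult mult.assoc)
    qed
    show "\<bar>z s x - z t x - (s - t) * y t x\<bar> \<le> K * (6 * K\<^sup>2 * (s - t)\<^sup>2)"
      "\<bar>z' s x - z' t x - (s - t) * y' t x\<bar> \<le> K * (6 * K\<^sup>2 * (s - t)\<^sup>2)"
      unfolding K_def using linear_response_bound[OF 1 2 3 4 q[OF st] 5] unfolding K_def by blast+
  qed
  have F: "\<bar>y s x - y t x\<bar> \<le> K * (12 * K\<^sup>2 * \<bar>s - t\<bar>)" "\<bar>y' s x - y' t x\<bar> \<le> K * (12 * K\<^sup>2 * \<bar>s - t\<bar>)"
    if st: "\<bar>s\<bar> \<le> s0" "\<bar>t\<bar> \<le> s0" for s t x
  proof -
    have 1: "((\<lambda>x. y s x - y t x) has_real_derivative y' s x - y' t x) (at x)" for x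
      by (intro DERIV_diff y st)
    have 2: "((\<lambda>x. y' s x - y' t x) has_real_derivative
      ((p x + 6 * u x * z s x + 3 * (z s x)\<^sup>2) * y s x + \<phi> x) - ((p x + 6 * u x * z t x + 3 * (z t x)\<^sup>2) * y t x + \<phi> x)) (at x)" for x
      by (intro DERIV_diff y' st)
    have 3: "bounded (range (\<lambda>x. y s x - y t x))" using bd_diff[OF ybd[OF st(1)] ybd[OF st(2)], of 1] by simp
    have 4: "((p x + 6 * u x * z s x + 3 * (z s x)\<^sup>2) * y s x + \<phi> x) - ((p x + 6 * u x * z t x + 3 * (z t x)\<^sup>2) * y t x + \<phi> x)
       = q s s x * (y s x - y t x) + (z s x - z t x) * (6 * u x + 3 * (z s x + z t x)) * y t x" for x
      by (simp add: q_def algebra_simps power2_eq_square)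
    have 5: "\<bar>(z s x - z t x) * (6 * u x + 3 * (z s x + z t x)) * y t x\<bar> \<le> 12 * K\<^sup>2 * \<bar>s - t\<bar>" for x
    proof -
      have "\<bar>6 * u x + 3 * (z s x + z t x)\<bar> \<le> 12"
        using zle1[OF st(1), of x] zle1[OF st(2), of x] u_bounds[of x] by (auto simp: abs_le_iff)
      then have "\<bar>z s x - z t x\<bar> * \<bar>6 * u x + 3 * (z s x + z t x)\<bar> * \<bar>y t x\<bar> \<le> K * \<bar>s - t\<bar> * 12 * K"
        using D[OF st] Y[OF st(2)] K by (intro mult_mono) auto
      also have "\<dots> = 12 * K\<^sup>2 * \<bar>s - t\<bar>" by (simp add: power2_eq_square)
      finally show ?thesis by (simp add: abs_mult)
    qed
    show "\<bar>y s x - y t x\<bar> \<le> K * (12 * K\<^sup>2 * \<bar>s - t\<bar>)" "\<bar>y' s x - y' t x\<bar> \<le> K * (12 * K\<^sup>2 * \<bar>s - t\<bar>)"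
      unfolding K_def using linear_response_bound[OF 1 2 3 4 q[OF st(1) st(1)] 5] unfolding K_def by blast+
  qed
  define C where "C = 12 * K ^ 3"
  have K3: "K \<le> K ^ 3" using K power_increasing[of 1 3 K] by simp
  have KC: "K \<le> C" "10 * K \<le> C" using K K3 by (auto simp: C_def)
  have lip: "\<bar>f x - f w\<bar> \<le> C * \<bar>x - w\<bar>" if "\<And>x. (f has_real_derivative f' x) (at x)" "\<And>x. \<bar>f' x\<bar> \<le> C"
    for f f' :: "real \<Rightarrow> real" and x w
    using field_differentiable_bound[of UNIV f f' C x w] that by (auto simp: abs_minus_commute DERIV_subset)
  have ydd: "\<bar>(p x + 6 * u x * z s x + 3 * (z s x)\<^sup>2) * y s x + \<phi> x\<bar> \<le> C" if s: "\<bar>s\<bar> \<le> s0" for s x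
  proof -
    have "\<bar>q s s x\<bar> * \<bar>y s x\<bar> \<le> 9 * K"
      using q[OF s s, of x] m_pos Y[OF s, of x] by (intro mult_mono) auto
    then have "\<bar>q s s x * y s x\<bar> \<le> 9 * K" by (simp add: abs_mult)
    then show ?thesis unfolding qq using \<phi>(2)[of x] KC K by linarith
  qed
  have C0: "K * (6 * K\<^sup>2 * (s - t)\<^sup>2) \<le> C * (s - t)\<^sup>2" for s t
    unfolding C_def using K by (simp add: power2_eq_square power3_eq_cube mult_right_mono)
  have C1: "K * (12 * K\<^sup>2 * \<bar>s - t\<bar>) = C * \<bar>s - t\<bar>" for s t
    unfolding C_def by (simp add: power2_eq_square power3_eq_cube)
  \<comment> \<open>Zero forcing leaves a homogeneous equation whose only bounded solution is zero,
    so the family passes through the front itself.\<close>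
  have z0: "z 0 x = 0" "z' 0 x = 0" for x
  proof -
    have 0: "\<bar>0::real\<bar> \<le> s0" using \<open>0 < s0\<close> by simp
    note q0 = perturbed_potential_bounds[OF zr[OF 0]]
    have "p x * z 0 x + 3 * u x * (z 0 x)\<^sup>2 + z 0 x ^ 3 + 0 * \<phi> x = (p x + (3 * u x * z 0 x + (z 0 x)\<^sup>2)) * z 0 x + 0" for x
      by (simp add: algebra_simps power2_eq_square power3_eq_cube)
    from linear_response_bound[OF z[OF 0] z'[OF 0] zbd[OF 0] this q0, of 0 x] show "z 0 x = 0" "z' 0 x = 0" by simp_all
  qed
  show thesis
  proof (rule that[of s0 z z' y y' C, OF \<open>0 < s0\<close> z z' zr z0])
    have 0: "\<bar>0::real\<bar> \<le> s0" using \<open>0 < s0\<close> by simp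
    show "(y 0 has_real_derivative y' 0 x) (at x)" for x by (rule y[OF 0])
    show "(y' 0 has_real_derivative p x * y 0 x + \<phi> x) (at x)" for x using y'[OF 0, of x] by (simp add: z0)
    show "\<bar>y 0 x\<bar> \<le> C" for x using Y(1)[OF 0, of x] KC by linarith
    show "\<bar>z s x - z t x - (s - t) * y t x\<bar> \<le> C * (s - t)\<^sup>2" if "\<bar>s\<bar> \<le> s0" "\<bar>t\<bar> \<le> s0" for s t x
      using E(1)[OF that] C0 order_trans by blast
    show "\<bar>z' s x - z' t x - (s - t) * y' t x\<bar> \<le> C * (s - t)\<^sup>2" if "\<bar>s\<bar> \<le> s0" "\<bar>t\<bar> \<le> s0" for s t x
      using E(2)[OF that] C0 order_trans by blast
    show "\<bar>y s x - y t w\<bar> \<le> C * (\<bar>s - t\<bar> + \<bar>x - w\<bar>)" if st: "\<bar>s\<bar> \<le> s0" "\<bar>t\<bar> \<le> s0" for s t x w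
    proof -
      have "\<bar>y' t x\<bar> \<le> C" for x using Y(2)[OF st(2), of x] KC by linarith
      from lip[OF y[OF st(2)] this, of x w] F(1)[OF st, of x] show ?thesis
        unfolding C1 distrib_left by linarith
    qed
    show "\<bar>y' s x - y' t w\<bar> \<le> C * (\<bar>s - t\<bar> + \<bar>x - w\<bar>)" if st: "\<bar>s\<bar> \<le> s0" "\<bar>t\<bar> \<le> s0" for s t x w
      using lip[OF y'[OF st(2)] ydd[OF st(2)], of x w] F(2)[OF st, of x]
      unfolding C1 distrib_left by linarith
  qed
qed

end

section \<open>Transversality\<close>

text \<open>Comparison with \<open>r * exp (k * (x - x1))\<close>, which equals \<open>r\<close> at
  \<open>x1\<close>. The slope estimate looks at \<open>[x, x + 1]\<close>, so it begins at
  \<open>x1 - 1\<close> and loses one unit in the exponent.\<close>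

lemma left_half_line_decay:
  fixes z z' Z q :: "real \<Rightarrow> real"
  assumes z: "\<And>x. (z has_real_derivative z' x) (at x)"
    and z': "\<And>x. (z' has_real_derivative Z x) (at x)"
    and eq: "\<And>x. x \<le> x1 \<Longrightarrow> Z x = q x * z x"
    and q: "\<And>x. x \<le> x1 \<Longrightarrow> k\<^sup>2 \<le> q x" "\<And>x. x \<le> x1 \<Longrightarrow> q x \<le> B"
    and k: "0 < k" and r: "\<And>x. \<bar>z x\<bar> \<le> r"
  shows "x \<le> x1 \<Longrightarrow> \<bar>z x\<bar> \<le> r * exp (k * (x - x1))"
    "x \<le> x1 - 1 \<Longrightarrow> \<bar>z' x\<bar> \<le> (2 + B) * (r * exp (k * (x + 1 - x1)))"
proof -
  have r0: "0 \<le> r" using r[of 0] by linarith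
  have B0: "0 \<le> B" using q[of x1] zero_le_power2[of k] by linarith
  have main: "s * z x - r * exp (k * (x - x1)) \<le> 0" if s: "s = 1 \<or> s = - 1" and x: "x \<le> x1" for s x :: real
  proof (rule maximum_principle[of "{..x1}" "\<lambda>x. s * z x - r * exp (k * (x - x1))" "k\<^sup>2" r
        "\<lambda>x. s * Z x - k\<^sup>2 * (r * exp (k * (x - x1)))" "\<lambda>x. s * z' x - k * (r * exp (k * (x - x1)))"])
    show "continuous_on {..x1} (\<lambda>x. s * z x - r * exp (k * (x - x1)))"
      using z by (intro continuous_intros) (auto intro: DERIV_continuous_on DERIV_subset)
    show "s * z y - r * exp (k * (y - x1)) \<le> r" for y
    proof -
      have "0 \<le> r * exp (k * (y - x1))" using r0 by simp
      moreover have "s * z y \<le> r" using r[of y] s by auto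
      ultimately show ?thesis by linarith
    qed
    show "y \<in> interior {..x1} \<and> k\<^sup>2 * (s * z y - r * exp (k * (y - x1))) \<le> s * Z y - k\<^sup>2 * (r * exp (k * (y - x1)))"
      if y: "y \<in> {..x1}" and pos: "0 < s * z y - r * exp (k * (y - x1))" for y
    proof
      have "y \<noteq> x1" using pos r[of x1] s by auto
      then show "y \<in> interior {..x1}" using y by auto
      have "0 \<le> r * exp (k * (y - x1))" using r0 by simp
      then have "0 < s * z y" using pos by linarith
      then have "k\<^sup>2 * (s * z y) \<le> q y * (s * z y)" using q(1)[of y] y by (intro mult_right_mono) auto
      then show "k\<^sup>2 * (s * z y - r * exp (k * (y - x1))) \<le> s * Z y - k\<^sup>2 * (r * exp (k * (y - x1)))"
        using eq[of y] y by (simp add: right_diff_distrib mult.left_commute)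
    qed
    show "((\<lambda>x. s * z x - r * exp (k * (x - x1))) has_real_derivative s * z' y - k * (r * exp (k * (y - x1)))) (at y)" for y
      by (auto intro!: derivative_eq_intros z)
    show "((\<lambda>x. s * z' x - k * (r * exp (k * (x - x1)))) has_real_derivative
        s * Z y - k\<^sup>2 * (r * exp (k * (y - x1)))) (at y)" for y
      by (auto intro!: derivative_eq_intros z' simp: power2_eq_square)
  qed (use k x in auto)
  have zb: "\<bar>z x\<bar> \<le> r * exp (k * (x - x1))" if "x \<le> x1" for x
    using main[of 1 x] main[of "- 1" x] that by (auto simp: abs_le_iff)
  show "x \<le> x1 \<Longrightarrow> \<bar>z x\<bar> \<le> r * exp (k * (x - x1))" by (rule zb)
  assume x: "x \<le> x1 - 1"
  have zb1: "\<bar>z y\<bar> \<le> r * exp (k * (x + 1 - x1))" if "x \<le> y" "y \<le> x + 1" for y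
  proof -
    have "r * exp (k * (y - x1)) \<le> r * exp (k * (x + 1 - x1))" using that k r0 by (intro mult_left_mono) auto
    then show ?thesis using zb[of y] that x by linarith
  qed
  have "\<bar>z' x\<bar> \<le> 2 * (r * exp (k * (x + 1 - x1))) + B * (r * exp (k * (x + 1 - x1)))"
  proof (rule deriv_bound_of_bounds[OF z z' zb1])
    fix y assume y: "x \<le> y" "y \<le> x + 1"
    then have y1: "y \<le> x1" using x by simp
    have "0 \<le> q y" using q(1)[OF y1] zero_le_power2[of k] by linarith
    then have "\<bar>q y\<bar> * \<bar>z y\<bar> \<le> B * (r * exp (k * (x + 1 - x1)))"
      using q(2)[OF y1] zb1[OF y] B0 by (intro mult_mono) auto
    then show "\<bar>Z y\<bar> \<le> B * (r * exp (k * (x + 1 - x1)))" by (simp add: eq[OF y1] abs_mult)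
  qed auto
  then show "\<bar>z' x\<bar> \<le> (2 + B) * (r * exp (k * (x + 1 - x1)))" by (simp add: algebra_simps)
qed

text \<open>\<open>X\<close> is fixed before \<open>z\<close>. This gives uniform convergence along
  a whole curve of perturbed orbits, as the tangent spaces demand.\<close>

lemma left_half_line_uniform_decay:
  assumes k: "0 < k" and e: "0 < e" and r: "0 \<le> r" "0 \<le> B"
  obtains X where "\<And>z z' Z q x.
    (\<And>x. (z has_real_derivative z' x) (at x)) \<Longrightarrow> (\<And>x. (z' has_real_derivative Z x) (at x)) \<Longrightarrow>
    (\<And>x. x \<le> x1 \<Longrightarrow> Z x = q x * z x) \<Longrightarrow> (\<And>x. x \<le> x1 \<Longrightarrow> k\<^sup>2 \<le> q x) \<Longrightarrow> (\<And>x. x \<le> x1 \<Longrightarrow> q x \<le> B) \<Longrightarrow>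
    (\<And>x. \<bar>z x\<bar> \<le> r) \<Longrightarrow> x \<le> X \<Longrightarrow> \<bar>z x\<bar> < e \<and> \<bar>z' x\<bar> < (e :: real)"
proof -
  have "((\<lambda>x. (2 + B) * (r * exp (k * (x + (1 - x1))))) \<longlongrightarrow> (2 + B) * (r * 0)) at_bot"
  proof (intro tendsto_mult tendsto_const filterlim_compose[OF exp_at_bot])
    have "filterlim (\<lambda>x. x + (1 - x1)) at_bot (at_bot :: real filter)"
      unfolding filterlim_at_bot eventually_at_bot_linorder
    proof
      fix Z show "\<exists>N. \<forall>n\<le>N. n + (1 - x1) \<le> Z" by (rule exI[of _ "Z - (1 - x1)"]) auto
    qed
    then show "filterlim (\<lambda>x. k * (x + (1 - x1))) at_bot at_bot"
      using filterlim_tendsto_pos_mult_at_bot[OF tendsto_const k] by blast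
  qed
  then have "\<forall>\<^sub>F x in at_bot. (2 + B) * (r * exp (k * (x + (1 - x1)))) < e"
    using order_tendstoD(2)[of _ 0 at_bot e] e by simp
  then obtain X where X: "\<And>x. x \<le> X \<Longrightarrow> (2 + B) * (r * exp (k * (x + (1 - x1)))) < e"
    by (auto simp: eventually_at_bot_linorder)
  show thesis
  proof (rule that[of "min X (x1 - 1)"])
    fix z z' Z q :: "real \<Rightarrow> real" and x
    assume a: "\<And>x. (z has_real_derivative z' x) (at x)" "\<And>x. (z' has_real_derivative Z x) (at x)"
      "\<And>x. x \<le> x1 \<Longrightarrow> Z x = q x * z x" "\<And>x. x \<le> x1 \<Longrightarrow> k\<^sup>2 \<le> q x" "\<And>x. x \<le> x1 \<Longrightarrow> q x \<le> B"
      "\<And>x. \<bar>z x\<bar> \<le> r" and x: "x \<le> min X (x1 - 1)"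
    have "\<bar>z x\<bar> \<le> r * exp (k * (x - x1))"
      by (rule left_half_line_decay(1)[where z' = z' and Z = Z and q = q and B = B]) (use a k x in auto)
    moreover have "\<bar>z' x\<bar> \<le> (2 + B) * (r * exp (k * (x + 1 - x1)))"
      by (rule left_half_line_decay(2)[where z = z and Z = Z and q = q]) (use a k x in auto)
    moreover have 1: "(2 + B) * (r * exp (k * (x + 1 - x1))) < e" using X[of x] x by (simp add: add_diff_eq)
    moreover have "r * exp (k * (x - x1)) \<le> r * exp (k * (x + 1 - x1))" using k r by (intro mult_left_mono) auto
    moreover have "r * exp (k * (x + 1 - x1)) \<le> (2 + B) * (r * exp (k * (x + 1 - x1)))"
      using mult_right_mono[of 1 "2 + B" "r * exp (k * (x + 1 - x1))"] r by simp
    ultimately show "\<bar>z x\<bar> < e \<and> \<bar>z' x\<bar> < e" by linarith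
  qed
qed

section \<open>Curves along which the base point and the forcing vary together\<close>

lemma quadratic_remainder_deriv:
  fixes R :: "real \<Rightarrow> real"
  assumes d: "0 < d" and R: "\<And>t. \<bar>t - s\<bar> < d \<Longrightarrow> \<bar>R t - R s - (t - s) * l\<bar> \<le> K * (t - s)\<^sup>2"
  shows "(R has_real_derivative l) (at s)"
  unfolding has_field_derivative_iff
proof (rule LIM_zero_cancel, rule Lim_null_comparison)
  show "((\<lambda>t. K * \<bar>t - s\<bar>) \<longlongrightarrow> 0) (at s)"
    by (auto intro!: tendsto_eq_intros)
  have "\<forall>\<^sub>F t in at s. t \<in> ball s d - {s}"
    unfolding eventually_at using d by (auto simp: dist_commute)
  then show "\<forall>\<^sub>F t in at s. norm ((R t - R s) / (t - s) - l) \<le> K * \<bar>t - s\<bar>"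
  proof (rule eventually_mono)
    fix t assume t: "t \<in> ball s d - {s}"
    then have ts: "0 < \<bar>t - s\<bar>" "\<bar>t - s\<bar> < d" by (auto simp: dist_real_def)
    have "(R t - R s) / (t - s) - l = (R t - R s - (t - s) * l) / (t - s)" using ts by (simp add: diff_divide_distrib)
    then have "norm ((R t - R s) / (t - s) - l) = \<bar>R t - R s - (t - s) * l\<bar> / \<bar>t - s\<bar>" by (simp add: abs_divide)
    also have "\<dots> \<le> K * (t - s)\<^sup>2 / \<bar>t - s\<bar>" using R[OF ts(2)] by (intro divide_right_mono) auto
    also have "\<dots> = K * \<bar>t - s\<bar>"
    proof -
      have "(t - s)\<^sup>2 = \<bar>t - s\<bar> * \<bar>t - s\<bar>" by (simp add: power2_eq_square)
      moreover have "K * (c * c) / c = K * c" if "0 < c" for c using that by simp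
      ultimately show ?thesis using ts(1) by (simp only:)
    qed
    finally show "norm ((R t - R s) / (t - s) - l) \<le> K * \<bar>t - s\<bar>" .
  qed
qed

text \<open>The increment splits into a motion of \<open>x\<close> with the parameter frozen and a
  change of parameter at the moving point. The second part is quadratic up to carrying
  \<open>g\<close> back to the base point, which \<open>lip\<close> pays for.\<close>

lemma two_parameter_curve_deriv:
  fixes f g :: "real \<Rightarrow> real \<Rightarrow> real"
  assumes f': "(f (b * s) has_real_derivative l) (at (x0 + a * s))"
    and taylor: "\<And>s t x. \<bar>s\<bar> \<le> s0 \<Longrightarrow> \<bar>t\<bar> \<le> s0 \<Longrightarrow> \<bar>f s x - f t x - (s - t) * g t x\<bar> \<le> C * (s - t)\<^sup>2"
    and lip: "\<And>s t x w. \<bar>s\<bar> \<le> s0 \<Longrightarrow> \<bar>t\<bar> \<le> s0 \<Longrightarrow> \<bar>g s x - g t w\<bar> \<le> C * (\<bar>s - t\<bar> + \<bar>x - w\<bar>)"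
    and s: "\<bar>b * s\<bar> < s0"
  shows "((\<lambda>t. f (b * t) (x0 + a * t)) has_real_derivative a * l + b * g (b * s) (x0 + a * s)) (at s)"
proof -
  have "((\<lambda>t. f (b * s) (x0 + a * t)) has_real_derivative l * a) (at s)"
    by (rule DERIV_chain2[where f = "f (b * s)" and g = "\<lambda>t. x0 + a * t", OF f']) (auto intro!: derivative_eq_intros)
  moreover have "((\<lambda>t. f (b * t) (x0 + a * t) - f (b * s) (x0 + a * t)) has_real_derivative b * g (b * s) (x0 + a * s)) (at s)"
  proof (rule quadratic_remainder_deriv)
    \<comment> \<open>This radius keeps \<open>b * t\<close> within the range of the Taylor bound;
      the \<open>+ 1\<close> covers \<open>b = 0\<close>.\<close>
    show "0 < (s0 - \<bar>b * s\<bar>) / (\<bar>b\<bar> + 1)" using s by (simp add: add_nonneg_pos)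
    fix t assume t: "\<bar>t - s\<bar> < (s0 - \<bar>b * s\<bar>) / (\<bar>b\<bar> + 1)"
    have "\<bar>b\<bar> + 1 > 0" by (simp add: add_nonneg_pos)
    then have "\<bar>t - s\<bar> * (\<bar>b\<bar> + 1) < s0 - \<bar>b * s\<bar>" using t by (simp add: pos_less_divide_eq)
    moreover have "\<bar>b * (t - s)\<bar> \<le> \<bar>t - s\<bar> * (\<bar>b\<bar> + 1)"
      by (simp add: abs_mult distrib_left mult.commute)
    ultimately have "\<bar>b * (t - s)\<bar> < s0 - \<bar>b * s\<bar>" by linarith
    moreover have "b * t = b * s + b * (t - s)" by (simp add: algebra_simps)
    ultimately have bt: "\<bar>b * t\<bar> \<le> s0" "\<bar>b * s\<bar> \<le> s0" using s by linarith+
    define w where "w = x0 + a * t"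
    have 1: "\<bar>f (b * t) w - f (b * s) w - (b * t - b * s) * g (b * s) w\<bar> \<le> C * (b * t - b * s)\<^sup>2"
      by (rule taylor[OF bt])
    have "\<bar>g (b * s) w - g (b * s) (x0 + a * s)\<bar> \<le> C * (\<bar>a\<bar> * \<bar>t - s\<bar>)"
      using lip[OF bt(2) bt(2), of w "x0 + a * s"] by (simp add: w_def abs_mult flip: right_diff_distrib)
    then have "\<bar>b * (t - s)\<bar> * \<bar>g (b * s) w - g (b * s) (x0 + a * s)\<bar> \<le> \<bar>b * (t - s)\<bar> * (C * (\<bar>a\<bar> * \<bar>t - s\<bar>))"
      by (intro mult_left_mono) auto
    also have "\<dots> = C * \<bar>a\<bar> * \<bar>b\<bar> * (t - s)\<^sup>2"
    proof -
      have "(t - s)\<^sup>2 = \<bar>t - s\<bar> * \<bar>t - s\<bar>" by (simp add: power2_eq_square)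
      then show ?thesis by (simp add: abs_mult)
    qed
    finally have 2: "\<bar>b * (t - s) * (g (b * s) w - g (b * s) (x0 + a * s))\<bar> \<le> C * \<bar>a\<bar> * \<bar>b\<bar> * (t - s)\<^sup>2"
      by (simp add: abs_mult)
    have "f (b * t) w - f (b * s) w - (t - s) * (b * g (b * s) (x0 + a * s))
      = (f (b * t) w - f (b * s) w - (b * t - b * s) * g (b * s) w) + b * (t - s) * (g (b * s) w - g (b * s) (x0 + a * s))"
      by (simp add: algebra_simps)
    moreover have "C * (b * t - b * s)\<^sup>2 = C * b\<^sup>2 * (t - s)\<^sup>2"
      by (simp add: power_mult_distrib flip: right_diff_distrib)
    ultimately have "\<bar>f (b * t) w - f (b * s) w - (t - s) * (b * g (b * s) (x0 + a * s))\<bar>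
      \<le> C * b\<^sup>2 * (t - s)\<^sup>2 + C * \<bar>a\<bar> * \<bar>b\<bar> * (t - s)\<^sup>2"
      using 1 2 by linarith
    then show "\<bar>f (b * t) (x0 + a * t) - f (b * s) (x0 + a * t) - (f (b * s) (x0 + a * s) - f (b * s) (x0 + a * s))
        - (t - s) * (b * g (b * s) (x0 + a * s))\<bar> \<le> (C * b\<^sup>2 + C * \<bar>a\<bar> * \<bar>b\<bar>) * (t - s)\<^sup>2"
      by (simp add: w_def algebra_simps)
  qed
  ultimately have "((\<lambda>t. f (b * s) (x0 + a * t) + (f (b * t) (x0 + a * t) - f (b * s) (x0 + a * t))) has_real_derivative
      l * a + b * g (b * s) (x0 + a * s)) (at s)"
    by (rule DERIV_add)
  then show ?thesis by (simp add: mult.commute)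
qed

lemma two_parameter_curve_continuous:
  fixes g :: "real \<Rightarrow> real \<Rightarrow> real"
  assumes lip: "\<And>s t x w. \<bar>s\<bar> \<le> s0 \<Longrightarrow> \<bar>t\<bar> \<le> s0 \<Longrightarrow> \<bar>g s x - g t w\<bar> \<le> C * (\<bar>s - t\<bar> + \<bar>x - w\<bar>)"
    and S: "\<And>s. s \<in> S \<Longrightarrow> \<bar>b * s\<bar> \<le> s0"
  shows "continuous_on S (\<lambda>s. g (b * s) (x0 + a * s))"
proof (rule lipschitz_on_continuous_on)
  show "(\<bar>C\<bar> * (\<bar>b\<bar> + \<bar>a\<bar>))-lipschitz_on S (\<lambda>s. g (b * s) (x0 + a * s))"
  proof (rule lipschitz_onI)
    fix s t assume st: "s \<in> S" "t \<in> S"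
    have "\<bar>g (b * s) (x0 + a * s) - g (b * t) (x0 + a * t)\<bar> \<le> C * (\<bar>b * s - b * t\<bar> + \<bar>x0 + a * s - (x0 + a * t)\<bar>)"
      by (rule lip[OF S S]) (rule st)+
    also have "\<dots> \<le> \<bar>C\<bar> * (\<bar>b * s - b * t\<bar> + \<bar>x0 + a * s - (x0 + a * t)\<bar>)" by (intro mult_right_mono) auto
    also have "\<dots> = \<bar>C\<bar> * (\<bar>b\<bar> + \<bar>a\<bar>) * \<bar>s - t\<bar>"
    proof -
      have "b * s - b * t = b * (s - t)" "x0 + a * s - (x0 + a * t) = a * (s - t)"
        by (simp_all add: algebra_simps)
      then show ?thesis by (simp only: abs_mult distrib_right mult.assoc)
    qed
    finally show "dist (g (b * s) (x0 + a * s)) (g (b * t) (x0 + a * t)) \<le> \<bar>C\<bar> * (\<bar>b\<bar> + \<bar>a\<bar>) * dist s t"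
      by (simp add: dist_real_def)
  qed simp
qed

text \<open>A nonnegative forcing pushes the bounded solution below zero, strictly at
  \<open>x2\<close>; exponential comparison with rate \<open>2\<close>, from
  \<open>P \<le> 4\<close>, carries strictness to the left. Left of \<open>x1\<close> the solution
  is strictly concave, and a nonnegative slope there would send it to \<open>- \<infinity>\<close>
  on the left.\<close>

lemma response_sign:
  fixes y y' P \<phi> :: "real \<Rightarrow> real"
  assumes y: "\<And>x. (y has_real_derivative y' x) (at x)"
    and y': "\<And>x. (y' has_real_derivative P x * y x + \<phi> x) (at x)"
    and bd: "\<And>x. \<bar>y x\<bar> \<le> B" and P: "0 < m" "\<And>x. m \<le> P x" "\<And>x. P x \<le> 4"
    and \<phi>: "\<And>x. 0 \<le> \<phi> x" "0 < \<phi> x2" "\<And>x. x \<le> x1 \<Longrightarrow> \<phi> x = 0" and x: "x \<le> x1" "x1 \<le> x2"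
  shows "y x < 0" "y' x < 0"
proof -
  have yc: "continuous_on S y" for S using y by (meson DERIV_continuous continuous_at_imp_continuous_on)
  have nonpos: "y w \<le> 0" for w
  proof (rule maximum_principle[of UNIV y m B "\<lambda>x. P x * y x + \<phi> x" y'])
    show "v \<in> interior UNIV \<and> m * y v \<le> P v * y v + \<phi> v" if "0 < y v" for v
    proof -
      have "m * y v \<le> P v * y v" using P(2) that by (intro mult_right_mono) auto
      then show ?thesis using \<phi>(1)[of v] by simp
    qed
    show "y v \<le> B" for v using bd[of v] by simp
  qed (use P y y' yc in auto)
  have y2: "y x2 < 0"
  proof (rule ccontr)
    assume "\<not> y x2 < 0"
    then have 0: "y x2 = 0" using nonpos[of x2] by simp
    have "P x2 * y x2 + \<phi> x2 \<le> 0"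
      by (rule second_derivative_nonpos_at_max[OF open_UNIV UNIV_I y y']) (simp add: 0 nonpos)
    then show False using 0 \<phi>(2) by simp
  qed
  have neg: "y w < 0" if w: "w \<le> x2" for w
  proof -
    have "y w + - y x2 * exp (2 * (w - x2)) \<le> 0"
    proof (rule maximum_principle[of "{..x2}" "\<lambda>x. y x + - y x2 * exp (2 * (x - x2))" m "- y x2"
          "\<lambda>x. P x * y x + \<phi> x + 4 * (- y x2 * exp (2 * (x - x2)))" "\<lambda>x. y' x + 2 * (- y x2 * exp (2 * (x - x2)))"])
      show "continuous_on {..x2} (\<lambda>x. y x + - y x2 * exp (2 * (x - x2)))" by (intro continuous_intros yc)
      show "y v + - y x2 * exp (2 * (v - x2)) \<le> - y x2" if "v \<in> {..x2}" for v
      proof -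
        have "- y x2 * exp (2 * (v - x2)) \<le> - y x2 * 1" using that y2 by (intro mult_left_mono) auto
        then show ?thesis using nonpos[of v] by linarith
      qed
      show "v \<in> interior {..x2} \<and> m * (y v + - y x2 * exp (2 * (v - x2)))
          \<le> P v * y v + \<phi> v + 4 * (- y x2 * exp (2 * (v - x2)))"
        if v: "v \<in> {..x2}" "0 < y v + - y x2 * exp (2 * (v - x2))" for v
      proof
        define E where "E = - y x2 * exp (2 * (v - x2))"
        have "v \<noteq> x2" using v(2) by auto
        then show "v \<in> interior {..x2}" using v(1) by auto
        have "0 \<le> E" using y2 by (simp add: E_def mult_nonpos_nonneg)
        then have "P v * E \<le> 4 * E" using P(3) by (intro mult_right_mono)
        moreover have "m * (y v + E) \<le> P v * (y v + E)" using v(2) P(2) by (intro mult_right_mono) (auto simp: E_def)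
        ultimately show "m * (y v + - y x2 * exp (2 * (v - x2))) \<le> P v * y v + \<phi> v + 4 * (- y x2 * exp (2 * (v - x2)))"
          unfolding E_def[symmetric] using \<phi>(1)[of v] by (simp add: distrib_left)
      qed
      show "((\<lambda>x. y x + - y x2 * exp (2 * (x - x2))) has_real_derivative y' v + 2 * (- y x2 * exp (2 * (v - x2)))) (at v)" for v
        by (auto intro!: derivative_eq_intros y)
      show "((\<lambda>x. y' x + 2 * (- y x2 * exp (2 * (x - x2)))) has_real_derivative
          P v * y v + \<phi> v + 4 * (- y x2 * exp (2 * (v - x2)))) (at v)" for v
        by (auto intro!: derivative_eq_intros y')
    qed (use P w in auto)
    moreover have "0 < - y x2 * exp (2 * (w - x2))" using y2 by (simp add: mult_neg_pos)
    ultimately show ?thesis by linarith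
  qed
  show "y x < 0" using neg x by simp
  show "y' x < 0"
  proof (rule ccontr)
    assume n: "\<not> y' x < 0"
    have dec: "y' b < y' a" if "a < b" "b \<le> x1" for a b
    proof (rule DERIV_neg_imp_decreasing[OF that(1)])
      fix c assume "a \<le> c" "c \<le> b"
      then have c: "\<phi> c = 0" "y c < 0" "0 < P c" using \<phi>(3)[of c] neg[of c] P(1) P(2)[of c] that x by auto
      then have "P c * y c + \<phi> c < 0" by (simp add: mult_pos_neg)
      then show "\<exists>w. (y' has_real_derivative w) (at c) \<and> w < 0" using y' by blast
    qed
    \<comment> \<open>One step to the left turns \<open>0 \<le> y' x\<close> into a strictly
      positive slope.\<close>
    define w where "w = x - 1"
    have w: "0 < y' w" using dec[of w x] n x by (simp add: w_def)
    \<comment> \<open>Far enough left that slopes of at least \<open>y' w\<close> produce a rise of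
      \<open>2 * B + 1\<close>, more than \<open>\<bar>y\<bar> \<le> B\<close> permits.\<close>
    define v where "v = w - (2 * B + 1) / y' w"
    have B: "0 \<le> B" using bd[of 0] by linarith
    have "v < w" using w B by (simp add: v_def)
    then obtain c where c: "v < c" "c < w" "y w - y v = (w - v) * y' c" using MVT2[of v w y y'] y by auto
    have "y' w \<le> y' c" using dec[of c w] c x by (simp add: w_def)
    then have "(w - v) * y' w \<le> y w - y v" unfolding c(3) using \<open>v < w\<close> by (intro mult_left_mono) auto
    then have "2 * B + 1 \<le> y w - y v" using w by (simp add: v_def)
    then show False using bd[of w] bd[of v] by linarith
  qed
qed

context front
begin

text \<open>The slow component is common to all perturbations, so at equal times they lie in one
  slice; zero perturbation gives the heteroclinic orbit.\<close>

definition point :: "(real \<Rightarrow> real) \<Rightarrow> (real \<Rightarrow> real) \<Rightarrow> real \<Rightarrow> real \<times> real \<times> real" where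
  "point z z' x = (u x + z x, u' x + z' x, - tanh (\<epsilon> * x))"

lemma point_deriv:
  assumes "(z has_real_derivative z' x) (at x)"
    and "(z' has_real_derivative p x * z x + 3 * u x * (z x)\<^sup>2 + z x ^ 3) (at x)"
  shows "(point z z' has_vector_derivative slow_field \<epsilon> (point z z' x)) (at x)"
proof -
  have 1: "((\<lambda>x. u x + z x) has_vector_derivative u' x + z' x) (at x)"
    unfolding has_real_derivative_iff_has_vector_derivative[symmetric] by (intro DERIV_add u_deriv assms)
  have "((\<lambda>x. u' x + z' x) has_real_derivative tanh (\<epsilon> * x) * u x + u x ^ 3 + (p x * z x + 3 * u x * (z x)\<^sup>2 + z x ^ 3)) (at x)"
    by (intro DERIV_add u'_deriv assms)
  moreover have "tanh (\<epsilon> * x) * u x + u x ^ 3 + (p x * z x + 3 * u x * (z x)\<^sup>2 + z x ^ 3)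
      = - (- tanh (\<epsilon> * x)) * (u x + z x) + (u x + z x) ^ 3"
    by (simp add: p_def algebra_simps power2_eq_square power3_eq_cube)
  ultimately have 2: "((\<lambda>x. u' x + z' x) has_vector_derivative - (- tanh (\<epsilon> * x)) * (u x + z x) + (u x + z x) ^ 3) (at x)"
    unfolding has_real_derivative_iff_has_vector_derivative by simp
  have 3: "((\<lambda>x. - tanh (\<epsilon> * x)) has_vector_derivative - \<epsilon> * (1 - (- tanh (\<epsilon> * x))\<^sup>2)) (at x)"
    unfolding has_real_derivative_iff_has_vector_derivative[symmetric]
    by (auto intro!: derivative_eq_intros)
  show ?thesis
    unfolding point_def[abs_def] slow_field_def prod.case
    by (intro has_vector_derivative_Pair 1 2 3)
qed

lemma point_shift_deriv:
  assumes "(z has_real_derivative z' (c + t)) (at (c + t))"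
    and "(z' has_real_derivative p (c + t) * z (c + t) + 3 * u (c + t) * (z (c + t))\<^sup>2 + z (c + t) ^ 3) (at (c + t))"
  shows "((\<lambda>t. point z z' (c + t)) has_vector_derivative slow_field \<epsilon> (point z z' (c + t))) (at t within S)"
proof -
  have "((\<lambda>t. c + t) has_vector_derivative 1) (at t)" by (auto intro!: derivative_eq_intros)
  moreover have "(point z z' has_vector_derivative slow_field \<epsilon> (point z z' (c + t))) (at (c + t))"
    by (rule point_deriv[OF assms])
  ultimately have "((point z z' \<circ> (\<lambda>t. c + t)) has_vector_derivative 1 *\<^sub>R slow_field \<epsilon> (point z z' (c + t))) (at t)"
    by (rule vector_diff_chain_at)
  then show ?thesis by (simp add: o_def has_vector_derivative_at_within)
qed

text \<open>One parameter drives both the time shift and the forcing, so a single curve realises any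
  combination of flow direction and response. The tangent sets are defined through curves, and this
  supplies the combinations directly.\<close>

lemma perturbed_curve_C1:
  assumes z: "\<And>s x. \<bar>s\<bar> \<le> s0 \<Longrightarrow> (z s has_real_derivative z' s x) (at x)"
    and z': "\<And>s x. \<bar>s\<bar> \<le> s0 \<Longrightarrow> (z' s has_real_derivative p x * z s x + 3 * u x * (z s x)\<^sup>2 + z s x ^ 3 + s * \<phi> x) (at x)"
    and z0: "\<And>x. z 0 x = 0" "\<And>x. z' 0 x = 0"
    and \<phi>: "continuous_on UNIV \<phi>"
    and ztay: "\<And>s t x. \<bar>s\<bar> \<le> s0 \<Longrightarrow> \<bar>t\<bar> \<le> s0 \<Longrightarrow> \<bar>z s x - z t x - (s - t) * y t x\<bar> \<le> C * (s - t)\<^sup>2"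
    and z'tay: "\<And>s t x. \<bar>s\<bar> \<le> s0 \<Longrightarrow> \<bar>t\<bar> \<le> s0 \<Longrightarrow> \<bar>z' s x - z' t x - (s - t) * y' t x\<bar> \<le> C * (s - t)\<^sup>2"
    and ylip: "\<And>s t x w. \<bar>s\<bar> \<le> s0 \<Longrightarrow> \<bar>t\<bar> \<le> s0 \<Longrightarrow> \<bar>y s x - y t w\<bar> \<le> C * (\<bar>s - t\<bar> + \<bar>x - w\<bar>)"
    and y'lip: "\<And>s t x w. \<bar>s\<bar> \<le> s0 \<Longrightarrow> \<bar>t\<bar> \<le> s0 \<Longrightarrow> \<bar>y' s x - y' t w\<bar> \<le> C * (\<bar>s - t\<bar> + \<bar>x - w\<bar>)"
    and d: "0 < d" "\<And>s. \<bar>s\<bar> < d \<Longrightarrow> \<bar>b * s\<bar> < s0"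
  shows "(\<lambda>s. point (z (b * s)) (z' (b * s)) (x0 + a * s)) C1_differentiable_on {- d<..<d}"
    and "((\<lambda>s. point (z (b * s)) (z' (b * s)) (x0 + a * s)) has_vector_derivative
       a *\<^sub>R slow_field \<epsilon> (point (\<lambda>_. 0) (\<lambda>_. 0) x0) + b *\<^sub>R (y 0 x0, y' 0 x0, 0)) (at 0)"
proof -
  define Z'' where "Z'' s x = p x * z s x + 3 * u x * (z s x)\<^sup>2 + z s x ^ 3 + s * \<phi> x" for s x
  define U'' where "U'' x = tanh (\<epsilon> * x) * u x + u x ^ 3" for x
  define D where "D s = (a * u' (x0 + a * s) + (a * z' (b * s) (x0 + a * s) + b * y (b * s) (x0 + a * s)),
     a * U'' (x0 + a * s) + (a * Z'' (b * s) (x0 + a * s) + b * y' (b * s) (x0 + a * s)),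
     - (a * \<epsilon> * (1 - (tanh (\<epsilon> * (x0 + a * s)))\<^sup>2)))" for s
  have aff: "((\<lambda>s. x0 + a * s) has_real_derivative a) (at s)" for s by (auto intro!: derivative_eq_intros)
  have zcurve: "((\<lambda>s. z (b * s) (x0 + a * s)) has_real_derivative a * z' (b * s) (x0 + a * s) + b * y (b * s) (x0 + a * s)) (at s)"
    and z'curve: "((\<lambda>s. z' (b * s) (x0 + a * s)) has_real_derivative a * Z'' (b * s) (x0 + a * s) + b * y' (b * s) (x0 + a * s)) (at s)"
    if "\<bar>s\<bar> < d" for s
    unfolding Z''_def
    by (rule two_parameter_curve_deriv[OF _ ztay ylip d(2)[OF that]] two_parameter_curve_deriv[OF _ z'tay y'lip d(2)[OF that]];
        use z z' d(2)[OF that] in \<open>simp add: less_imp_le\<close>)+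
  have ucurve: "((\<lambda>s. u (x0 + a * s)) has_real_derivative a * u' (x0 + a * s)) (at s)"
    and u'curve: "((\<lambda>s. u' (x0 + a * s)) has_real_derivative a * U'' (x0 + a * s)) (at s)" for s
    unfolding U''_def
    by (rule DERIV_cong[OF DERIV_chain2[OF u_deriv aff]], rule mult.commute,
        rule DERIV_cong[OF DERIV_chain2[OF u'_deriv aff]], rule mult.commute)
  have deriv: "((\<lambda>s. point (z (b * s)) (z' (b * s)) (x0 + a * s)) has_vector_derivative D s) (at s)"
    if s: "\<bar>s\<bar> < d" for s
    unfolding point_def D_def
    by (intro has_vector_derivative_Pair; unfold has_real_derivative_iff_has_vector_derivative[symmetric])
      (auto intro!: DERIV_add ucurve u'curve zcurve z'curve s derivative_eq_intros)
  have cont_of_deriv: "continuous_on {- d<..<d} f" if "\<And>s. \<bar>s\<bar> < d \<Longrightarrow> (f has_real_derivative f' s) (at s)" for f f' :: "real \<Rightarrow> real"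
    by (rule DERIV_continuous_on[of _ f f']) (use that in \<open>auto intro: has_field_derivative_at_within\<close>)
  have in_s0: "\<bar>b * s\<bar> \<le> s0" if "s \<in> {- d<..<d}" for s using d(2)[of s] that by (auto simp: abs_less_iff)
  have "continuous_on {- d<..<d} D"
  proof -
    have c: "continuous_on {- d<..<d} (\<lambda>s. f (x0 + a * s))" if "continuous_on UNIV f" for f :: "real \<Rightarrow> real"
      by (rule continuous_on_compose2[OF that]) (auto intro!: continuous_intros)
    show ?thesis
      unfolding D_def Z''_def U''_def
      by (intro continuous_on_Pair continuous_on_add continuous_on_mult continuous_on_const continuous_on_minus
          continuous_on_diff continuous_on_power continuous_on_id
          cont_of_deriv[OF zcurve] cont_of_deriv[OF z'curve] cont_of_deriv[OF ucurve] cont_of_deriv[OF u'curve]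
          two_parameter_curve_continuous[OF ylip in_s0] two_parameter_curve_continuous[OF y'lip in_s0]
          c[OF p_continuous] c[OF \<phi>]
          continuous_on_tanh) auto
  qed
  then show "(\<lambda>s. point (z (b * s)) (z' (b * s)) (x0 + a * s)) C1_differentiable_on {- d<..<d}"
    unfolding C1_differentiable_on_def using deriv by (intro exI[of _ D]) (auto simp: abs_less_iff)
  have "D 0 = a *\<^sub>R slow_field \<epsilon> (point (\<lambda>_. 0) (\<lambda>_. 0) x0) + b *\<^sub>R (y 0 x0, y' 0 x0, 0)"
    by (simp add: D_def point_def slow_field_def Z''_def U''_def z0 algebra_simps)
  then show "((\<lambda>s. point (z (b * s)) (z' (b * s)) (x0 + a * s)) has_vector_derivative
       a *\<^sub>R slow_field \<epsilon> (point (\<lambda>_. 0) (\<lambda>_. 0) x0) + b *\<^sub>R (y 0 x0, y' 0 x0, 0)) (at 0)"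
    using deriv[of 0] d(1) by simp
qed

end

lemma dist_triple_le:
  "dist (a, b, c) (a', b', c') \<le> \<bar>a - a'\<bar> + \<bar>b - b'\<bar> + \<bar>c - c'\<bar>" for a b c a' b' c' :: real
proof -
  have "dist (a, b, c) (a', b', c') = norm (a - a', b - b', c - c')" by (simp add: dist_norm)
  also have "\<dots> \<le> norm (a - a') + (norm (b - b') + norm (c - c'))"
    using norm_Pair_le[of "a - a'" "(b - b', c - c')"] norm_Pair_le[of "b - b'" "c - c'"] by linarith
  finally show ?thesis by simp
qed

text \<open>The second bound keeps \<open>x0 + a * s\<close> within one unit of \<open>x0\<close>,
  inside the zone where the forcing vanishes.\<close>

lemma parameter_range:
  fixes a b s0 :: real
  assumes "0 < s0"
  obtains d where "0 < d" "\<And>s. \<bar>s\<bar> < d \<Longrightarrow> \<bar>b * s\<bar> < s0" "\<And>s. \<bar>s\<bar> < d \<Longrightarrow> \<bar>a * s\<bar> \<le> 1"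
proof -
  define d where "d = min (s0 / (\<bar>b\<bar> + 1)) (1 / (\<bar>a\<bar> + 1))"
  have pos: "0 < \<bar>b\<bar> + 1" "0 < \<bar>a\<bar> + 1" by (auto simp: add_nonneg_pos)
  have "0 < d" using assms pos by (simp add: d_def)
  moreover have "\<bar>b * s\<bar> < s0" "\<bar>a * s\<bar> \<le> 1" if "\<bar>s\<bar> < d" for s
  proof -
    have "\<bar>s\<bar> * (\<bar>b\<bar> + 1) < s0" "\<bar>s\<bar> * (\<bar>a\<bar> + 1) < 1"
      using that pos by (simp_all add: d_def pos_less_divide_eq)
    moreover have "\<bar>b * s\<bar> \<le> \<bar>s\<bar> * (\<bar>b\<bar> + 1)" "\<bar>a * s\<bar> \<le> \<bar>s\<bar> * (\<bar>a\<bar> + 1)"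
      by (simp_all add: abs_mult distrib_left mult.commute)
    ultimately show "\<bar>b * s\<bar> < s0" "\<bar>a * s\<bar> \<le> 1" by linarith+
  qed
  ultimately show thesis using that by blast
qed

context front
begin

lemma point_limits:
  assumes "0 < e"
  obtains X where "\<And>x. x \<le> X \<Longrightarrow> \<bar>u x - 1\<bar> < e \<and> \<bar>u' x\<bar> < e \<and> \<bar>- tanh (\<epsilon> * x) - 1\<bar> < e"
    and "\<And>x. - X \<le> x \<Longrightarrow> \<bar>u x\<bar> < e \<and> \<bar>u' x\<bar> < e \<and> \<bar>- tanh (\<epsilon> * x) + 1\<bar> < e"
proof -
  have fb: "filterlim (\<lambda>x. \<epsilon> * x) at_bot at_bot"
    using filterlim_tendsto_pos_mult_at_bot[OF tendsto_const eps_pos filterlim_ident] .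
  have ft: "filterlim (\<lambda>x. \<epsilon> * x) at_top at_top"
    using filterlim_tendsto_pos_mult_at_top[OF tendsto_const eps_pos filterlim_ident] .
  have tb: "((\<lambda>x. tanh (\<epsilon> * x)) \<longlongrightarrow> - 1) at_bot" by (rule filterlim_compose[OF tanh_real_at_bot fb])
  have tt: "((\<lambda>x. tanh (\<epsilon> * x)) \<longlongrightarrow> 1) at_top" by (rule filterlim_compose[OF tanh_real_at_top ft])
  have "\<forall>\<^sub>F x in at_bot. \<bar>u x - 1\<bar> < e \<and> \<bar>u' x\<bar> < e \<and> \<bar>- tanh (\<epsilon> * x) - 1\<bar> < e"
    using tendstoD[OF u_lims(1) assms] tendstoD[OF u_lims(3) assms] tendstoD[OF tb assms]
    by eventually_elim (auto simp: dist_real_def)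
  then obtain A where A: "\<And>x. x \<le> A \<Longrightarrow> \<bar>u x - 1\<bar> < e \<and> \<bar>u' x\<bar> < e \<and> \<bar>- tanh (\<epsilon> * x) - 1\<bar> < e"
    by (auto simp: eventually_at_bot_linorder)
  have "\<forall>\<^sub>F x in at_top. \<bar>u x\<bar> < e \<and> \<bar>u' x\<bar> < e \<and> \<bar>- tanh (\<epsilon> * x) + 1\<bar> < e"
    using tendstoD[OF u_lims(2) assms] tendstoD[OF u_lims(4) assms] tendstoD[OF tt assms]
    by eventually_elim (auto simp: dist_real_def)
  then obtain B where B: "\<And>x. B \<le> x \<Longrightarrow> \<bar>u x\<bar> < e \<and> \<bar>u' x\<bar> < e \<and> \<bar>- tanh (\<epsilon> * x) + 1\<bar> < e"
    by (auto simp: eventually_at_top_linorder)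
  show thesis by (rule that[of "min A (- B)"]) (use A B in auto)
qed

text \<open>Up to \<open>x0 + 1\<close> the forcing is zero and the perturbed functions are genuine
  orbits; the extra unit makes room for the time shift. Being bounded, they decay to the front at
  \<open>- \<infinity>\<close>, uniformly in \<open>s\<close>.\<close>

lemma tangent_unstable_contains:
  assumes \<phi>: "continuous_on UNIV \<phi>" "\<And>x. \<bar>\<phi> x\<bar> \<le> 1" and zero: "\<And>x. x \<le> x0 + 1 \<Longrightarrow> \<phi> x = 0"
  obtains y y' B where "\<And>x. (y has_real_derivative y' x) (at x)"
    "\<And>x. (y' has_real_derivative p x * y x + \<phi> x) (at x)" "\<And>x. \<bar>y x\<bar> \<le> B"
    "\<And>a b. a *\<^sub>R slow_field \<epsilon> (point (\<lambda>_. 0) (\<lambda>_. 0) x0) + b *\<^sub>R (y x0, y' x0, 0)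
      \<in> tangent_unstable (slow_field \<epsilon>) (1, 0, 1) (point (\<lambda>_. 0) (\<lambda>_. 0) x0)"
proof -
  obtain s0 C z z' y y' where s0: "0 < s0" and
    z: "\<And>s x. \<bar>s\<bar> \<le> s0 \<Longrightarrow> (z s has_real_derivative z' s x) (at x)" and
    z': "\<And>s x. \<bar>s\<bar> \<le> s0 \<Longrightarrow> (z' s has_real_derivative p x * z s x + 3 * u x * (z s x)\<^sup>2 + z s x ^ 3 + s * \<phi> x) (at x)" and
    zr: "\<And>s x. \<bar>s\<bar> \<le> s0 \<Longrightarrow> \<bar>z s x\<bar> \<le> m / 18" and
    z0: "\<And>x. z 0 x = 0" "\<And>x. z' 0 x = 0" and
    y: "\<And>x. (y 0 has_real_derivative y' 0 x) (at x)" and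
    y': "\<And>x. (y' 0 has_real_derivative p x * y 0 x + \<phi> x) (at x)" and
    yb: "\<And>x. \<bar>y 0 x\<bar> \<le> C" and
    tay: "\<And>s t x. \<bar>s\<bar> \<le> s0 \<Longrightarrow> \<bar>t\<bar> \<le> s0 \<Longrightarrow> \<bar>z s x - z t x - (s - t) * y t x\<bar> \<le> C * (s - t)\<^sup>2"
    "\<And>s t x. \<bar>s\<bar> \<le> s0 \<Longrightarrow> \<bar>t\<bar> \<le> s0 \<Longrightarrow> \<bar>z' s x - z' t x - (s - t) * y' t x\<bar> \<le> C * (s - t)\<^sup>2" and
    lip: "\<And>s t x w. \<bar>s\<bar> \<le> s0 \<Longrightarrow> \<bar>t\<bar> \<le> s0 \<Longrightarrow> \<bar>y s x - y t w\<bar> \<le> C * (\<bar>s - t\<bar> + \<bar>x - w\<bar>)"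
    "\<And>s t x w. \<bar>s\<bar> \<le> s0 \<Longrightarrow> \<bar>t\<bar> \<le> s0 \<Longrightarrow> \<bar>y' s x - y' t w\<bar> \<le> C * (\<bar>s - t\<bar> + \<bar>x - w\<bar>)"
    by (rule perturbed_family[OF \<phi>]) blast
  have "a *\<^sub>R slow_field \<epsilon> (point (\<lambda>_. 0) (\<lambda>_. 0) x0) + b *\<^sub>R (y 0 x0, y' 0 x0, 0)
      \<in> tangent_unstable (slow_field \<epsilon>) (1, 0, 1) (point (\<lambda>_. 0) (\<lambda>_. 0) x0)" for a b
  proof -
    obtain d where d: "0 < d" "\<And>s. \<bar>s\<bar> < d \<Longrightarrow> \<bar>b * s\<bar> < s0" "\<And>s. \<bar>s\<bar> < d \<Longrightarrow> \<bar>a * s\<bar> \<le> 1"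
      by (rule parameter_range[OF s0, of b a]) blast
    define X where "X s t = point (z (b * s)) (z' (b * s)) (x0 + a * s + t)" for s t
    have sol: "solves_on (slow_field \<epsilon>) (X s) {..0}" if s: "s \<in> {- d<..<d}" for s
      unfolding solves_on_def
    proof
      fix t :: real assume t: "t \<in> {..0}"
      have s: "\<bar>b * s\<bar> \<le> s0" "\<bar>a * s\<bar> \<le> 1" using d(2)[of s] d(3)[of s] s by (auto simp: abs_less_iff)
      then have 0: "\<phi> (x0 + a * s + t) = 0" using t by (intro zero) auto
      show "(X s has_vector_derivative slow_field \<epsilon> (X s t)) (at t within {..0})"
        unfolding X_def[abs_def] using z[OF s(1)] z'[OF s(1), of "x0 + a * s + t"] unfolding 0
        by (intro point_shift_deriv) simp_all
    qed
    have lim: "uniform_limit {- d<..<d} (\<lambda>t s. X s t) (\<lambda>s. (1, 0, 1)) at_bot"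
    proof (rule uniform_limitI)
      fix e :: real assume e: "0 < e"
      \<comment> \<open>Five small terms enter the distance: two each for \<open>u\<close> and
        \<open>v\<close>, one for \<open>\<mu>\<close>.\<close>
      then have e6: "0 < e / 6" by simp
      obtain A where A: "\<And>x. x \<le> A \<Longrightarrow> \<bar>u x - 1\<bar> < e / 6 \<and> \<bar>u' x\<bar> < e / 6 \<and> \<bar>- tanh (\<epsilon> * x) - 1\<bar> < e / 6"
        by (rule point_limits[OF e6]) blast
      obtain D where D: "\<And>s x. \<bar>s\<bar> \<le> s0 \<Longrightarrow> x \<le> D \<Longrightarrow> \<bar>z s x\<bar> < e / 6 \<and> \<bar>z' s x\<bar> < e / 6"
      proof -
        have k: "0 < sqrt (m / 2)" "(sqrt (m / 2))\<^sup>2 = m / 2" and r: "0 \<le> m / 18" using m_pos by auto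
        show thesis
        proof (rule left_half_line_uniform_decay[OF k(1) e6 r, of 9 "x0 + 1"])
          fix D
          assume D: "\<And>z z' Z q x. (\<And>x. (z has_real_derivative z' x) (at x)) \<Longrightarrow> (\<And>x. (z' has_real_derivative Z x) (at x)) \<Longrightarrow>
            (\<And>x. x \<le> x0 + 1 \<Longrightarrow> Z x = q x * z x) \<Longrightarrow> (\<And>x. x \<le> x0 + 1 \<Longrightarrow> (sqrt (m / 2))\<^sup>2 \<le> q x) \<Longrightarrow>
            (\<And>x. x \<le> x0 + 1 \<Longrightarrow> q x \<le> 9) \<Longrightarrow> (\<And>x. \<bar>z x\<bar> \<le> m / 18) \<Longrightarrow> x \<le> D \<Longrightarrow> \<bar>z x\<bar> < e / 6 \<and> \<bar>z' x\<bar> < e / 6"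
          have "\<bar>z s x\<bar> < e / 6 \<and> \<bar>z' s x\<bar> < e / 6" if s: "\<bar>s\<bar> \<le> s0" and x: "x \<le> D" for s x
          proof (rule D[OF z[OF s] z'[OF s] _ _ _ zr[OF s] x, where q = "\<lambda>x. p x + (3 * u x * z s x + (z s x)\<^sup>2)"])
            show "p x * z s x + 3 * u x * (z s x)\<^sup>2 + z s x ^ 3 + s * \<phi> x = (p x + (3 * u x * z s x + (z s x)\<^sup>2)) * z s x"
              if "x \<le> x0 + 1" for x
              using zero[OF that] by (simp add: algebra_simps power2_eq_square power3_eq_cube)
          qed (simp_all only: k(2) perturbed_potential_bounds[OF zr[OF s]])
          then show thesis using that by blast
        qed simp
      qed
      \<comment> \<open>The final \<open>- 1\<close> absorbs the time shift
        \<open>a * s\<close>.\<close>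
      have "dist (X s t) (1, 0, 1) < e" if t: "t \<le> min A D - x0 - 1" and s: "s \<in> {- d<..<d}" for s t
      proof -
        have s: "\<bar>b * s\<bar> \<le> s0" "\<bar>a * s\<bar> \<le> 1" using d(2)[of s] d(3)[of s] s by (auto simp: abs_less_iff)
        define x where "x = x0 + a * s + t"
        have x: "x \<le> A" "x \<le> D" using t s by (auto simp: x_def)
        have "dist (X s t) (1, 0, 1) \<le> \<bar>u x + z (b * s) x - 1\<bar> + \<bar>u' x + z' (b * s) x - 0\<bar> + \<bar>- tanh (\<epsilon> * x) - 1\<bar>"
          unfolding X_def point_def x_def by (rule dist_triple_le)
        also have "\<dots> < e" using A[OF x(1)] D[OF s(1) x(2)] by linarith
        finally show ?thesis .
      qed
      then show "\<forall>\<^sub>F t in at_bot. \<forall>s\<in>{- d<..<d}. dist (X s t) (1, 0, 1) < e"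
        unfolding eventually_at_bot_linorder by blast
    qed
    have curve: "(\<lambda>s. point (z (b * s)) (z' (b * s)) (x0 + a * s)) C1_differentiable_on {- d<..<d}"
      "((\<lambda>s. point (z (b * s)) (z' (b * s)) (x0 + a * s)) has_vector_derivative
         a *\<^sub>R slow_field \<epsilon> (point (\<lambda>_. 0) (\<lambda>_. 0) x0) + b *\<^sub>R (y 0 x0, y' 0 x0, 0)) (at 0)"
      using perturbed_curve_C1[of s0 z z' \<phi> y C y' d b x0 a] z z' z0 \<phi>(1) tay lip d(1,2) by blast+
    have X0: "X s 0 = point (z (b * s)) (z' (b * s)) (x0 + a * s)" for s by (simp add: X_def)
    have g0: "point (z (b * 0)) (z' (b * 0)) (x0 + a * 0) = point (\<lambda>_. 0) (\<lambda>_. 0) x0"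
      by (simp add: point_def z0)
    show ?thesis
      unfolding tangent_unstable_def mem_Collect_eq
      by (intro exI[of _ d] conjI exI[of _ "\<lambda>s. point (z (b * s)) (z' (b * s)) (x0 + a * s)"] exI[of _ X] curve d(1) g0 lim ballI sol X0)
  qed
  with y y' yb show thesis by (rule that)
qed

text \<open>The mirror image of the unstable case, with the decay estimate applied to functions of
  \<open>- x\<close>. The flow direction is already supplied by the unstable side, so the base point
  stays fixed here.\<close>

lemma tangent_stable_contains:
  assumes \<phi>: "continuous_on UNIV \<phi>" "\<And>x. \<bar>\<phi> x\<bar> \<le> 1" and zero: "\<And>x. x0 - 1 \<le> x \<Longrightarrow> \<phi> x = 0"
  obtains y y' B where "\<And>x. (y has_real_derivative y' x) (at x)"
    "\<And>x. (y' has_real_derivative p x * y x + \<phi> x) (at x)" "\<And>x. \<bar>y x\<bar> \<le> B"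
    "\<And>b. b *\<^sub>R (y x0, y' x0, 0) \<in> tangent_stable (slow_field \<epsilon>) (0, 0, - 1) (point (\<lambda>_. 0) (\<lambda>_. 0) x0)"
proof -
  obtain s0 C z z' y y' where s0: "0 < s0" and
    z: "\<And>s x. \<bar>s\<bar> \<le> s0 \<Longrightarrow> (z s has_real_derivative z' s x) (at x)" and
    z': "\<And>s x. \<bar>s\<bar> \<le> s0 \<Longrightarrow> (z' s has_real_derivative p x * z s x + 3 * u x * (z s x)\<^sup>2 + z s x ^ 3 + s * \<phi> x) (at x)" and
    zr: "\<And>s x. \<bar>s\<bar> \<le> s0 \<Longrightarrow> \<bar>z s x\<bar> \<le> m / 18" and
    z0: "\<And>x. z 0 x = 0" "\<And>x. z' 0 x = 0" and
    y: "\<And>x. (y 0 has_real_derivative y' 0 x) (at x)" and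
    y': "\<And>x. (y' 0 has_real_derivative p x * y 0 x + \<phi> x) (at x)" and
    yb: "\<And>x. \<bar>y 0 x\<bar> \<le> C" and
    tay: "\<And>s t x. \<bar>s\<bar> \<le> s0 \<Longrightarrow> \<bar>t\<bar> \<le> s0 \<Longrightarrow> \<bar>z s x - z t x - (s - t) * y t x\<bar> \<le> C * (s - t)\<^sup>2"
    "\<And>s t x. \<bar>s\<bar> \<le> s0 \<Longrightarrow> \<bar>t\<bar> \<le> s0 \<Longrightarrow> \<bar>z' s x - z' t x - (s - t) * y' t x\<bar> \<le> C * (s - t)\<^sup>2" and
    lip: "\<And>s t x w. \<bar>s\<bar> \<le> s0 \<Longrightarrow> \<bar>t\<bar> \<le> s0 \<Longrightarrow> \<bar>y s x - y t w\<bar> \<le> C * (\<bar>s - t\<bar> + \<bar>x - w\<bar>)"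
    "\<And>s t x w. \<bar>s\<bar> \<le> s0 \<Longrightarrow> \<bar>t\<bar> \<le> s0 \<Longrightarrow> \<bar>y' s x - y' t w\<bar> \<le> C * (\<bar>s - t\<bar> + \<bar>x - w\<bar>)"
    by (rule perturbed_family[OF \<phi>]) blast
  have "b *\<^sub>R (y 0 x0, y' 0 x0, 0)
      \<in> tangent_stable (slow_field \<epsilon>) (0, 0, - 1) (point (\<lambda>_. 0) (\<lambda>_. 0) x0)" for b
  proof -
    obtain d where d: "0 < d" "\<And>s. \<bar>s\<bar> < d \<Longrightarrow> \<bar>b * s\<bar> < s0"
      by (rule parameter_range[OF s0, of b 0]) blast
    define X where "X s t = point (z (b * s)) (z' (b * s)) (x0 + t)" for s t
    have bs: "\<bar>b * s\<bar> \<le> s0" if "s \<in> {- d<..<d}" for s using d(2)[of s] that by (auto simp: abs_less_iff)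
    have sol: "solves_on (slow_field \<epsilon>) (X s) {0..}" if s: "s \<in> {- d<..<d}" for s
      unfolding solves_on_def
    proof
      fix t :: real assume t: "t \<in> {0..}"
      then have 0: "\<phi> (x0 + t) = 0" by (intro zero) auto
      show "(X s has_vector_derivative slow_field \<epsilon> (X s t)) (at t within {0..})"
        unfolding X_def[abs_def] using z[OF bs[OF s]] z'[OF bs[OF s], of "x0 + t"] unfolding 0
        by (intro point_shift_deriv) simp_all
    qed
    have lim: "uniform_limit {- d<..<d} (\<lambda>t s. X s t) (\<lambda>s. (0, 0, - 1)) at_top"
    proof (rule uniform_limitI)
      fix e :: real assume e: "0 < e"
      then have e6: "0 < e / 6" by simp
      obtain A where A: "\<And>x. - A \<le> x \<Longrightarrow> \<bar>u x\<bar> < e / 6 \<and> \<bar>u' x\<bar> < e / 6 \<and> \<bar>- tanh (\<epsilon> * x) + 1\<bar> < e / 6"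
        by (rule point_limits[OF e6]) blast
      obtain D where D: "\<And>s x. \<bar>s\<bar> \<le> s0 \<Longrightarrow> - D \<le> x \<Longrightarrow> \<bar>z s x\<bar> < e / 6 \<and> \<bar>z' s x\<bar> < e / 6"
      proof -
        have k: "0 < sqrt (m / 2)" "(sqrt (m / 2))\<^sup>2 = m / 2" and r: "0 \<le> m / 18" using m_pos by auto
        show thesis
        proof (rule left_half_line_uniform_decay[OF k(1) e6 r, of 9 "- (x0 - 1)"])
          fix D
          assume D: "\<And>z z' Z q x. (\<And>x. (z has_real_derivative z' x) (at x)) \<Longrightarrow> (\<And>x. (z' has_real_derivative Z x) (at x)) \<Longrightarrow>
            (\<And>x. x \<le> - (x0 - 1) \<Longrightarrow> Z x = q x * z x) \<Longrightarrow> (\<And>x. x \<le> - (x0 - 1) \<Longrightarrow> (sqrt (m / 2))\<^sup>2 \<le> q x) \<Longrightarrow>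
            (\<And>x. x \<le> - (x0 - 1) \<Longrightarrow> q x \<le> 9) \<Longrightarrow> (\<And>x. \<bar>z x\<bar> \<le> m / 18) \<Longrightarrow> x \<le> D \<Longrightarrow> \<bar>z x\<bar> < e / 6 \<and> \<bar>z' x\<bar> < e / 6"
          have "\<bar>z s x\<bar> < e / 6 \<and> \<bar>z' s x\<bar> < e / 6" if s: "\<bar>s\<bar> \<le> s0" and x: "- D \<le> x" for s x
          proof -
            define Z where "Z x = p x * z s x + 3 * u x * (z s x)\<^sup>2 + z s x ^ 3 + s * \<phi> x" for x
            have "\<bar>z s (- (- x))\<bar> < e / 6 \<and> \<bar>- z' s (- (- x))\<bar> < e / 6"
            proof (rule D[where z = "\<lambda>x. z s (- x)" and z' = "\<lambda>x. - z' s (- x)" and Z = "\<lambda>x. Z (- x)" and x = "- x"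
                  and q = "\<lambda>x. p (- x) + (3 * u (- x) * z s (- x) + (z s (- x))\<^sup>2)"])
              show "((\<lambda>x. z s (- x)) has_real_derivative - z' s (- x)) (at x)" for x
                by (rule DERIV_cong[OF DERIV_chain2[OF z[OF s] DERIV_minus[OF DERIV_ident]]]) simp
              show "((\<lambda>x. - z' s (- x)) has_real_derivative Z (- x)) (at x)" for x
                unfolding Z_def
                by (rule DERIV_cong[OF DERIV_minus[OF DERIV_chain2[OF z'[OF s] DERIV_minus[OF DERIV_ident]]]]) simp
              show "Z (- x) = (p (- x) + (3 * u (- x) * z s (- x) + (z s (- x))\<^sup>2)) * z s (- x)"
                if "x \<le> - (x0 - 1)" for x
                using zero[of "- x"] that by (simp add: Z_def algebra_simps power2_eq_square power3_eq_cube)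
              show "- x \<le> D" using x by simp
            qed (simp_all only: k(2) perturbed_potential_bounds[OF zr[OF s]] zr[OF s])
            then show ?thesis by simp
          qed
          then show thesis using that by blast
        qed simp
      qed
      have "dist (X s t) (0, 0, - 1) < e" if t: "max (- A) (- D) - x0 \<le> t" and s: "s \<in> {- d<..<d}" for s t
      proof -
        define x where "x = x0 + t"
        have x: "- A \<le> x" "- D \<le> x" using t by (auto simp: x_def)
        have "dist (X s t) (0, 0, - 1) \<le> \<bar>u x + z (b * s) x - 0\<bar> + \<bar>u' x + z' (b * s) x - 0\<bar> + \<bar>- tanh (\<epsilon> * x) - - 1\<bar>"
          unfolding X_def point_def x_def by (rule dist_triple_le)
        also have "\<dots> < e" using A[OF x(1)] D[OF bs[OF s] x(2)]
          unfolding diff_0_right diff_minus_eq_add by linarith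
        finally show ?thesis .
      qed
      then show "\<forall>\<^sub>F t in at_top. \<forall>s\<in>{- d<..<d}. dist (X s t) (0, 0, - 1) < e"
        unfolding eventually_at_top_linorder by blast
    qed
    have curve0: "(\<lambda>s. point (z (b * s)) (z' (b * s)) (x0 + 0 * s)) C1_differentiable_on {- d<..<d}"
      "((\<lambda>s. point (z (b * s)) (z' (b * s)) (x0 + 0 * s)) has_vector_derivative
         0 *\<^sub>R slow_field \<epsilon> (point (\<lambda>_. 0) (\<lambda>_. 0) x0) + b *\<^sub>R (y 0 x0, y' 0 x0, 0)) (at 0)"
      using perturbed_curve_C1[of s0 z z' \<phi> y C y' d b x0 0] z z' z0 \<phi>(1) tay lip d(1,2) by blast+
    note curve = curve0[unfolded mult_zero_left add_0_right scaleR_zero_left add_0_left]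
    have X0: "X s 0 = point (z (b * s)) (z' (b * s)) x0" for s by (simp add: X_def)
    have g0: "point (z (b * 0)) (z' (b * 0)) x0 = point (\<lambda>_. 0) (\<lambda>_. 0) x0"
      by (simp add: point_def z0)
    show ?thesis
      unfolding tangent_stable_def mem_Collect_eq
      by (intro exI[of _ d] conjI exI[of _ "\<lambda>s. point (z (b * s)) (z' (b * s)) x0"] exI[of _ X] curve d(1) g0 lim ballI sol X0)
  qed
  with y y' yb show thesis by (rule that)
qed

lemma orbit_heteroclinic:
  "heteroclinic_orbit (slow_field \<epsilon>) (1, 0, 1) (0, 0, - 1) (point (\<lambda>_. 0) (\<lambda>_. 0))"
proof -
  have d: "(point (\<lambda>_. 0) (\<lambda>_. 0) has_vector_derivative slow_field \<epsilon> (point (\<lambda>_. 0) (\<lambda>_. 0) x)) (at x)" for x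
    by (rule point_deriv) auto
  have "(point (\<lambda>_. 0) (\<lambda>_. 0) \<longlongrightarrow> (1, 0, 1)) at_bot"
  proof (rule tendstoI)
    fix e :: real assume "0 < e"
    then have e3: "0 < e / 3" by simp
    obtain A where A: "\<And>x. x \<le> A \<Longrightarrow> \<bar>u x - 1\<bar> < e / 3 \<and> \<bar>u' x\<bar> < e / 3 \<and> \<bar>- tanh (\<epsilon> * x) - 1\<bar> < e / 3"
      by (rule point_limits[OF e3]) blast
    have "dist (point (\<lambda>_. 0) (\<lambda>_. 0) x) (1, 0, 1) < e" if "x \<le> A" for x
      using dist_triple_le[of "u x" "u' x" "- tanh (\<epsilon> * x)" 1 0 1] A[OF that] by (simp add: point_def)
    then show "\<forall>\<^sub>F x in at_bot. dist (point (\<lambda>_. 0) (\<lambda>_. 0) x) (1, 0, 1) < e"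
      unfolding eventually_at_bot_linorder by blast
  qed
  moreover have "(point (\<lambda>_. 0) (\<lambda>_. 0) \<longlongrightarrow> (0, 0, - 1)) at_top"
  proof (rule tendstoI)
    fix e :: real assume "0 < e"
    then have e3: "0 < e / 3" by simp
    obtain A where A: "\<And>x. - A \<le> x \<Longrightarrow> \<bar>u x\<bar> < e / 3 \<and> \<bar>u' x\<bar> < e / 3 \<and> \<bar>- tanh (\<epsilon> * x) + 1\<bar> < e / 3"
      by (rule point_limits[OF e3]) blast
    have "dist (point (\<lambda>_. 0) (\<lambda>_. 0) x) (0, 0, - 1) < e" if "- A \<le> x" for x
      using dist_triple_le[of "u x" "u' x" "- tanh (\<epsilon> * x)" 0 0 "- 1"] A[OF that] by (simp add: point_def)
    then show "\<forall>\<^sub>F x in at_top. dist (point (\<lambda>_. 0) (\<lambda>_. 0) x) (0, 0, - 1) < e"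
      unfolding eventually_at_top_linorder by blast
  qed
  ultimately show ?thesis using d by (simp add: heteroclinic_orbit_def solves_on_def)
qed

lemma orbit_in_manifolds:
  "point (\<lambda>_. 0) (\<lambda>_. 0) x0 \<in> unstable_manifold (slow_field \<epsilon>) (1, 0, 1)"
  "point (\<lambda>_. 0) (\<lambda>_. 0) x0 \<in> stable_manifold (slow_field \<epsilon>) (0, 0, - 1)"
proof -
  let ?X = "\<lambda>t. point (\<lambda>_. 0) (\<lambda>_. 0) (x0 + t)"
  have sol: "solves_on (slow_field \<epsilon>) ?X S" for S
    unfolding solves_on_def by (intro ballI point_shift_deriv) auto
  have bot: "filterlim (\<lambda>t. x0 + t) at_bot (at_bot :: real filter)"
    unfolding filterlim_at_bot eventually_at_bot_linorder
  proof
    fix Z show "\<exists>N. \<forall>n\<le>N. x0 + n \<le> Z" by (rule exI[of _ "Z - x0"]) auto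
  qed
  have top: "filterlim (\<lambda>t. x0 + t) at_top (at_top :: real filter)"
    by (rule filterlim_tendsto_add_at_top[OF tendsto_const filterlim_ident])
  have "(?X \<longlongrightarrow> (1, 0, 1)) at_bot" "(?X \<longlongrightarrow> (0, 0, - 1)) at_top"
    using orbit_heteroclinic filterlim_compose[OF _ bot] filterlim_compose[OF _ top]
    unfolding heteroclinic_orbit_def by blast+
  then show "point (\<lambda>_. 0) (\<lambda>_. 0) x0 \<in> unstable_manifold (slow_field \<epsilon>) (1, 0, 1)"
    "point (\<lambda>_. 0) (\<lambda>_. 0) x0 \<in> stable_manifold (slow_field \<epsilon>) (0, 0, - 1)"
    unfolding unstable_manifold_def stable_manifold_def mem_Collect_eq
    by (intro exI[of _ ?X] conjI sol; simp)+
qed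

lemma orbit_transverse:
  "point (\<lambda>_. 0) (\<lambda>_. 0) x0 \<in> transverse_intersection (slow_field \<epsilon>) (1, 0, 1) (0, 0, - 1)"
proof -
  define P where "P = point (\<lambda>_. 0) (\<lambda>_. 0) x0"
  \<comment> \<open>The ramps vanish on a half-line that contains \<open>x0\<close> with one unit to
    spare and are positive two units away, \<open>\<phi>\<close> on the right and
    \<open>\<psi>\<close> on the left.\<close>
  define \<phi> where "\<phi> x = max 0 (min 1 (x - (x0 + 1)))" for x
  define \<psi> where "\<psi> x = max 0 (min 1 (x0 - 1 - x))" for x
  have \<phi>: "continuous_on UNIV \<phi>" "\<And>x. \<bar>\<phi> x\<bar> \<le> 1" "\<And>x. x \<le> x0 + 1 \<Longrightarrow> \<phi> x = 0" "\<And>x. 0 \<le> \<phi> x" "0 < \<phi> (x0 + 2)"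
    by (auto simp: \<phi>_def[abs_def] intro!: continuous_intros)
  have \<psi>: "continuous_on UNIV \<psi>" "\<And>x. \<bar>\<psi> x\<bar> \<le> 1" "\<And>x. x0 - 1 \<le> x \<Longrightarrow> \<psi> x = 0" "\<And>x. 0 \<le> \<psi> x" "0 < \<psi> (x0 - 2)"
    by (auto simp: \<psi>_def[abs_def] intro!: continuous_intros)
  obtain y y' B where y: "\<And>x. (y has_real_derivative y' x) (at x)"
    "\<And>x. (y' has_real_derivative p x * y x + \<phi> x) (at x)" "\<And>x. \<bar>y x\<bar> \<le> B"
    and yT: "\<And>a b. a *\<^sub>R slow_field \<epsilon> P + b *\<^sub>R (y x0, y' x0, 0) \<in> tangent_unstable (slow_field \<epsilon>) (1, 0, 1) P"
    unfolding P_def using tangent_unstable_contains[OF \<phi>(1-3)] by metis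
  obtain w w' D where w: "\<And>x. (w has_real_derivative w' x) (at x)"
    "\<And>x. (w' has_real_derivative p x * w x + \<psi> x) (at x)" "\<And>x. \<bar>w x\<bar> \<le> D"
    and wT: "\<And>b. b *\<^sub>R (w x0, w' x0, 0) \<in> tangent_stable (slow_field \<epsilon>) (0, 0, - 1) P"
    unfolding P_def using tangent_stable_contains[OF \<psi>(1-3)] by metis
  have ys: "y x0 < 0" "y' x0 < 0"
    using response_sign[where x = x0, OF y m_pos p_bounds \<phi>(4,5,3)] by simp_all
  \<comment> \<open>Reflection moves the forcing to the right and reverses the slope, so
    \<open>response_sign\<close> applies again.\<close>
  have "w (- (- x0)) < 0" "- w' (- (- x0)) < 0"
  proof -
    have 1: "((\<lambda>x. w (- x)) has_real_derivative - w' (- x)) (at x)" for x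
      by (rule DERIV_cong[OF DERIV_chain2[OF w(1) DERIV_minus[OF DERIV_ident]]]) simp
    have 2: "((\<lambda>x. - w' (- x)) has_real_derivative p (- x) * w (- x) + \<psi> (- x)) (at x)" for x
      by (rule DERIV_cong[OF DERIV_minus[OF DERIV_chain2[OF w(2) DERIV_minus[OF DERIV_ident]]]]) simp
    have 3: "\<psi> (- x) = 0" if "x \<le> - (x0 - 1)" for x using that by (intro \<psi>(3)) simp
    have 4: "0 < \<psi> (- (- (x0 - 2)))" using \<psi>(5) by simp
    show "w (- (- x0)) < 0" "- w' (- (- x0)) < 0"
      using response_sign[where x = "- x0", OF 1 2 w(3) m_pos p_bounds \<psi>(4) 4 3] by simp_all
  qed
  then have ws: "w x0 < 0" "0 < w' x0" by simp_all
  \<comment> \<open>The determinant of the two responses in the \<open>(u, v)\<close> plane; both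
    contributions are negative, so they cannot cancel.\<close>
  define \<Delta> where "\<Delta> = y x0 * w' x0 - y' x0 * w x0"
  have "y x0 * w' x0 < 0" "0 < y' x0 * w x0" using ys ws by (simp_all add: mult_neg_pos mult_neg_neg)
  then have \<Delta>: "\<Delta> \<noteq> 0" by (simp add: \<Delta>_def)
  define F where "F = - \<epsilon> * (1 - (tanh (\<epsilon> * x0))\<^sup>2)"
  have "(tanh (\<epsilon> * x0))\<^sup>2 < 1"
    using tanh_real_bounds[of "\<epsilon> * x0"] by (simp add: abs_square_less_1 abs_less_iff)
  then have F: "F \<noteq> 0" using eps_pos by (simp add: F_def)
  obtain f1 f2 where f: "slow_field \<epsilon> P = (f1, f2, F)"
    by (simp add: P_def point_def slow_field_def F_def)
  have "v \<in> {a + b |a b. a \<in> tangent_unstable (slow_field \<epsilon>) (1, 0, 1) P \<and> b \<in> tangent_stable (slow_field \<epsilon>) (0, 0, - 1) P}" for v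
  proof -
    obtain v1 v2 v3 where v: "v = (v1, v2, v3)" by (cases v) auto
    define a where "a = v3 / F"
    define g where "g = v1 - a * f1"
    define h where "h = v2 - a * f2"
    \<comment> \<open>Cramer's rule for the \<open>(u, v)\<close> components that remain once the
      flow direction has matched the slow one.\<close>
    define b where "b = (g * w' x0 - h * w x0) / \<Delta>"
    define c where "c = (y x0 * h - y' x0 * g) / \<Delta>"
    have "b * y x0 + c * w x0 = ((g * w' x0 - h * w x0) * y x0 + (y x0 * h - y' x0 * g) * w x0) / \<Delta>"
      by (simp add: b_def c_def add_divide_distrib)
    also have "(g * w' x0 - h * w x0) * y x0 + (y x0 * h - y' x0 * g) * w x0 = g * \<Delta>"
      by (simp add: \<Delta>_def algebra_simps)
    finally have e1: "b * y x0 + c * w x0 = g" using \<Delta> by simp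
    have "b * y' x0 + c * w' x0 = ((g * w' x0 - h * w x0) * y' x0 + (y x0 * h - y' x0 * g) * w' x0) / \<Delta>"
      by (simp add: b_def c_def add_divide_distrib)
    also have "(g * w' x0 - h * w x0) * y' x0 + (y x0 * h - y' x0 * g) * w' x0 = h * \<Delta>"
      by (simp add: \<Delta>_def algebra_simps)
    finally have e2: "b * y' x0 + c * w' x0 = h" using \<Delta> by simp
    have e3: "a * F = v3" using F by (simp add: a_def)
    have "v = (a *\<^sub>R slow_field \<epsilon> P + b *\<^sub>R (y x0, y' x0, 0)) + c *\<^sub>R (w x0, w' x0, 0)"
      unfolding v f using e1 e2 e3 by (simp add: g_def h_def algebra_simps)
    then show ?thesis using yT wT by blast
  qed
  then have "{a + b |a b. a \<in> tangent_unstable (slow_field \<epsilon>) (1, 0, 1) P \<and> b \<in> tangent_stable (slow_field \<epsilon>) (0, 0, - 1) P} = UNIV"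
    by blast
  then show ?thesis
    unfolding transverse_intersection_def using orbit_in_manifolds unfolding P_def by blast
qed

end

text \<open>\<open>\<epsilon> < 1 / 1000\<close> means \<open>h < 1 / 10\<close>, so
  \<open>d = h\<^sup>2\<close> satisfies \<open>d\<^sup>2 \<le> 1 / 1000\<close>. Undoing the
  scaling multiplies the bound \<open>1 / 20\<close> by \<open>h\<^sup>2\<close>.\<close>

lemma front_for_small_eps:
  assumes \<epsilon>: "0 < \<epsilon>" "\<epsilon> < 1 / 1000"
  obtains u u' where "front \<epsilon> ((\<epsilon> powr (1 / 3))\<^sup>2 / 20) u u'"
proof -
  define h where "h = \<epsilon> powr (1 / 3)"
  have h: "0 < h" "h ^ 3 = \<epsilon>" using \<epsilon> by (auto simp: h_def powr_realpow[symmetric] powr_powr)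
  have "h < 1 / 10"
  proof (rule ccontr)
    assume "\<not> h < 1 / 10"
    then have "(1 / 10) ^ 3 \<le> h ^ 3" by (intro power_mono) auto
    then show False using h \<epsilon> by (simp add: power3_eq_cube)
  qed
  then have "h ^ 4 \<le> (1 / 10) ^ 4" using h by (intro power_mono) auto
  moreover have "(1 / 10 :: real) ^ 4 \<le> 1 / 1000" by (simp add: power_divide)
  ultimately have h4: "(h\<^sup>2)\<^sup>2 \<le> 1 / 1000" by (simp flip: power_mult)
  have Q: "continuous_on UNIV (\<lambda>x. tanh (\<epsilon> * x))" "mono (\<lambda>x. tanh (\<epsilon> * x))"
    using \<epsilon> by (auto intro!: continuous_intros monoI simp: mult_left_mono)
  have Ql: "((\<lambda>x. tanh (\<epsilon> * x)) \<longlongrightarrow> - 1) at_bot" "((\<lambda>x. tanh (\<epsilon> * x)) \<longlongrightarrow> 1) at_top"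
    using filterlim_compose[OF tanh_real_at_bot filterlim_tendsto_pos_mult_at_bot[OF tendsto_const \<epsilon>(1) filterlim_ident]]
      filterlim_compose[OF tanh_real_at_top filterlim_tendsto_pos_mult_at_top[OF tendsto_const \<epsilon>(1) filterlim_ident]] by auto
  obtain u u' where u: "\<And>x. (u has_real_derivative u' x) (at x)"
    "\<And>x. (u' has_real_derivative tanh (\<epsilon> * x) * u x + u x ^ 3) (at x)"
    "\<And>x. 0 < u x" "\<And>x. u x \<le> 1"
    "(u \<longlongrightarrow> 1) at_bot" "(u \<longlongrightarrow> 0) at_top" "(u' \<longlongrightarrow> 0) at_bot" "(u' \<longlongrightarrow> 0) at_top"
    using front_exists[OF Q Ql] by metis
  have u2: "(u' has_real_derivative tanh (h ^ 3 * x) * u x + u x ^ 3) (at x)" for x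
    using u(2)[of x] by (simp add: h(2))
  note W = front_rescaling[OF h(1) u(1) u2 u(5)]
  have "h\<^sup>2 / 20 \<le> tanh (\<epsilon> * x) + 3 * (u x)\<^sup>2" for x
  proof -
    have "1 / 20 \<le> tanh (h\<^sup>2 * (h * x)) / h\<^sup>2 + 6 * (u ((h * x) / h) / (sqrt 2 * h))\<^sup>2"
      by (rule painleve_potential.linearized_potential_bound[OF painleve_potential_tanh W(1,2) _ W(3)])
        (use h u(3) h4 in auto)
    also have "h\<^sup>2 * (h * x) = \<epsilon> * x" using h(2) by (simp add: power2_eq_square power3_eq_cube mult.assoc)
    also have "6 * (u ((h * x) / h) / (sqrt 2 * h))\<^sup>2 = 3 * (u x)\<^sup>2 / h\<^sup>2"
      using h by (simp add: power_divide power_mult_distrib)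
    finally have "1 / 20 \<le> (tanh (\<epsilon> * x) + 3 * (u x)\<^sup>2) / h\<^sup>2" by (simp add: add_divide_distrib)
    then show ?thesis using h by (simp add: field_simps)
  qed
  then have "front \<epsilon> (h\<^sup>2 / 20) u u'"
    using \<epsilon> h u by unfold_locales auto
  then show thesis using that by (simp add: h_def)
qed

theorem theorem2:
  "\<exists>\<epsilon>\<^sub>0>0. \<exists>u v \<mu> :: real \<Rightarrow> real \<Rightarrow> real.
     (\<forall>\<epsilon>\<in>{0<..<\<epsilon>\<^sub>0}.
        heteroclinic_orbit (slow_field \<epsilon>) (1, 0, 1) (0, 0, -1)
          (\<lambda>\<xi>. (u \<epsilon> \<xi>, v \<epsilon> \<xi>, \<mu> \<epsilon> \<xi>)) \<and>
        \<mu> \<epsilon> 0 = 0 \<and>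
        (\<forall>\<xi>. (u \<epsilon> \<xi>, v \<epsilon> \<xi>, \<mu> \<epsilon> \<xi>)
               \<in> transverse_intersection (slow_field \<epsilon>) (1, 0, 1) (0, 0, -1))) \<and>
     (\<forall>w. hastings_mcleod w \<longrightarrow>
        (\<exists>\<rho>>0. \<exists>C. \<forall>\<^sub>F \<epsilon> in at_right 0. \<forall>\<xi>.
           \<bar>\<xi>\<bar> \<le> \<rho> * \<epsilon> powr (-1/3) \<longrightarrow>
           \<bar>u \<epsilon> \<xi> - u_HM w \<epsilon> \<xi>\<bar> \<le> C * \<epsilon> powr (2/3)))"
proof -
  have "\<forall>\<epsilon>. \<exists>u u'. 0 < \<epsilon> \<and> \<epsilon> < 1 / 1000 \<longrightarrow> front \<epsilon> ((\<epsilon> powr (1 / 3))\<^sup>2 / 20) u u'"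
    using front_for_small_eps by metis
  then obtain u v where front: "\<And>\<epsilon>. 0 < \<epsilon> \<Longrightarrow> \<epsilon> < 1 / 1000 \<Longrightarrow> front \<epsilon> ((\<epsilon> powr (1 / 3))\<^sup>2 / 20) (u \<epsilon>) (v \<epsilon>)"
    by metis
  define \<mu> where "\<mu> \<epsilon> \<xi> = - tanh (\<epsilon> * \<xi>)" for \<epsilon> \<xi> :: real
  have orbit: "heteroclinic_orbit (slow_field \<epsilon>) (1, 0, 1) (0, 0, -1) (\<lambda>\<xi>. (u \<epsilon> \<xi>, v \<epsilon> \<xi>, \<mu> \<epsilon> \<xi>)) \<and>
        \<mu> \<epsilon> 0 = 0 \<and>
        (\<forall>\<xi>. (u \<epsilon> \<xi>, v \<epsilon> \<xi>, \<mu> \<epsilon> \<xi>) \<in> transverse_intersection (slow_field \<epsilon>) (1, 0, 1) (0, 0, -1))"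
    if "\<epsilon> \<in> {0<..<1 / 1000}" for \<epsilon>
  proof -
    interpret front \<epsilon> "(\<epsilon> powr (1 / 3))\<^sup>2 / 20" "u \<epsilon>" "v \<epsilon>" using that by (intro front) auto
    have pt: "point (\<lambda>_. 0) (\<lambda>_. 0) = (\<lambda>\<xi>. (u \<epsilon> \<xi>, v \<epsilon> \<xi>, \<mu> \<epsilon> \<xi>))"
      by (simp add: point_def[abs_def] \<mu>_def)
    have "\<mu> \<epsilon> 0 = 0" by (simp add: \<mu>_def)
    then show ?thesis using orbit_heteroclinic orbit_transverse unfolding pt by blast
  qed
  have approx: "\<exists>\<rho>>0. \<exists>C. \<forall>\<^sub>F \<epsilon> in at_right 0. \<forall>\<xi>. \<bar>\<xi>\<bar> \<le> \<rho> * \<epsilon> powr (-1/3) \<longrightarrow>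
           \<bar>u \<epsilon> \<xi> - u_HM w \<epsilon> \<xi>\<bar> \<le> C * \<epsilon> powr (2/3)" if hm: "hastings_mcleod w" for w
  proof (rule hastings_mcleod_comparison[OF hm])
    fix C d0 :: real
    assume d0: "0 < d0" and
      cmp: "\<And>(d :: real) W W' x. 0 < d \<Longrightarrow> d < d0 \<Longrightarrow> (\<And>x. (W has_real_derivative W' x) (at x)) \<Longrightarrow>
       (\<And>x. (W' has_real_derivative tanh (d * x) / d * W x + 2 * W x ^ 3) (at x)) \<Longrightarrow>
       (\<And>x. 0 < W x) \<Longrightarrow> (\<And>x. W x \<le> 1 / sqrt d) \<Longrightarrow>
       ((\<lambda>x. (W x)\<^sup>2 / - (tanh (d * x) / d)) \<longlongrightarrow> 1 / 2) at_bot \<Longrightarrow>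
       \<bar>x\<bar> \<le> 1 \<Longrightarrow> \<bar>W x - w x\<bar> \<le> C * sqrt d"
    \<comment> \<open>\<open>\<epsilon> < min 1 d0 ^ 3\<close> gives \<open>h < min 1 d0\<close>,
      hence \<open>h\<^sup>2 < d0\<close>.\<close>
    define e1 where "e1 = min (1 / 1000) (min 1 d0 ^ 3)"
    have e1: "0 < e1" using d0 by (simp add: e1_def)
    \<comment> \<open>The radius \<open>1\<close> is the window \<open>\<bar>x\<bar> \<le> 1\<close>
      of the comparison in the scaled variable; the prefactor \<open>sqrt 2 * h\<close> turns its
      error \<open>C * h\<close> into order \<open>h\<^sup>2\<close>.\<close>
    have main: "\<bar>u \<epsilon> \<xi> - u_HM w \<epsilon> \<xi>\<bar> \<le> (sqrt 2 * C) * \<epsilon> powr (2/3)"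
      if \<epsilon>: "0 < \<epsilon>" "\<epsilon> < e1" and \<xi>: "\<bar>\<xi>\<bar> \<le> 1 * \<epsilon> powr (-1/3)" for \<epsilon> \<xi>
    proof -
      interpret front \<epsilon> "(\<epsilon> powr (1 / 3))\<^sup>2 / 20" "u \<epsilon>" "v \<epsilon>" using \<epsilon> by (intro front) (auto simp: e1_def)
      define h where "h = \<epsilon> powr (1 / 3)"
      have h: "0 < h" "h ^ 3 = \<epsilon>" using \<epsilon> by (auto simp: h_def powr_realpow[symmetric] powr_powr)
      have h2: "\<epsilon> powr (2/3) = h\<^sup>2" using \<epsilon> by (simp add: h_def powr_realpow[symmetric] powr_powr)
      have hm1: "\<epsilon> powr (-1/3) = 1 / h" using \<epsilon> by (simp add: h_def powr_minus_divide)
      have hk: "h < min 1 d0"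
      proof (rule ccontr)
        assume "\<not> h < min 1 d0"
        then have "min 1 d0 ^ 3 \<le> h ^ 3" using d0 by (intro power_mono) auto
        then show False using h \<epsilon> by (simp add: e1_def)
      qed
      have "h * h \<le> h * 1" using h hk by (intro mult_left_mono) auto
      then have hd: "h\<^sup>2 < d0" using hk by (simp add: power2_eq_square)
      have u2: "(v \<epsilon> has_real_derivative tanh (h ^ 3 * x) * u \<epsilon> x + u \<epsilon> x ^ 3) (at x)" for x
        using u'_deriv[of x] by (simp add: h(2))
      note W = front_rescaling[OF h(1) u_deriv u2 u_lims(1)]
      have h\<xi>: "\<bar>h * \<xi>\<bar> \<le> 1" using \<xi> h unfolding hm1 by (simp add: abs_mult field_simps)
      have "\<bar>u \<epsilon> ((h * \<xi>) / h) / (sqrt 2 * h) - w (h * \<xi>)\<bar> \<le> C * sqrt (h\<^sup>2)"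
      proof (rule cmp[OF _ hd W(1,2) _ _ W(3)])
        show "u \<epsilon> (x / h) / (sqrt 2 * h) \<le> 1 / sqrt (h\<^sup>2)" for x
        proof -
          have "u \<epsilon> (x / h) / (sqrt 2 * h) \<le> 1 / (1 * h)"
            using u_bounds[of "x / h"] h by (intro frac_le mult_right_mono) auto
          then show ?thesis using h by simp
        qed
      qed (use h h\<xi> u_bounds in auto)
      then have "\<bar>u \<epsilon> \<xi> / (sqrt 2 * h) - w (h * \<xi>)\<bar> \<le> C * h" using h by simp
      then have "(sqrt 2 * h) * \<bar>u \<epsilon> \<xi> / (sqrt 2 * h) - w (h * \<xi>)\<bar> \<le> (sqrt 2 * h) * (C * h)"
        using h by (intro mult_left_mono) auto
      moreover have "(sqrt 2 * h) * \<bar>u \<epsilon> \<xi> / (sqrt 2 * h) - w (h * \<xi>)\<bar> = \<bar>u \<epsilon> \<xi> - sqrt 2 * h * w (h * \<xi>)\<bar>"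
      proof -
        have "(sqrt 2 * h) * \<bar>u \<epsilon> \<xi> / (sqrt 2 * h) - w (h * \<xi>)\<bar> = \<bar>(sqrt 2 * h) * (u \<epsilon> \<xi> / (sqrt 2 * h) - w (h * \<xi>))\<bar>"
          using h by (simp add: abs_mult)
        also have "(sqrt 2 * h) * (u \<epsilon> \<xi> / (sqrt 2 * h) - w (h * \<xi>)) = u \<epsilon> \<xi> - sqrt 2 * h * w (h * \<xi>)"
          using h by (simp add: right_diff_distrib)
        finally show ?thesis .
      qed
      ultimately show ?thesis unfolding u_HM_def h2 h_def[symmetric] by (simp add: power2_eq_square mult_ac)
    qed
    have "\<forall>\<^sub>F \<epsilon> in at_right 0. \<forall>\<xi>. \<bar>\<xi>\<bar> \<le> 1 * \<epsilon> powr (-1/3) \<longrightarrow>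
           \<bar>u \<epsilon> \<xi> - u_HM w \<epsilon> \<xi>\<bar> \<le> (sqrt 2 * C) * \<epsilon> powr (2/3)"
      unfolding eventually_at_right_field using e1 main by blast
    then show "\<exists>\<rho>>0. \<exists>C. \<forall>\<^sub>F \<epsilon> in at_right 0. \<forall>\<xi>. \<bar>\<xi>\<bar> \<le> \<rho> * \<epsilon> powr (-1/3) \<longrightarrow>
        \<bar>u \<epsilon> \<xi> - u_HM w \<epsilon> \<xi>\<bar> \<le> C * \<epsilon> powr (2/3)"
      by (intro exI[of _ 1] conjI zero_less_one exI[of _ "sqrt 2 * C"])
  qed
  show ?thesis
    by (rule exI[of _ "1 / 1000"], rule conjI, simp, rule exI[of _ u], rule exI[of _ v], rule exI[of _ \<mu>])
      (use orbit approx in blast)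
qed

end
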